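(* Suppose that $S$ is a strictly increasing subordinator with Laplace exponent $\phi$ and inverse $E(t)=\inf\{u:S(u)>t\}$. Let $X(t)=x+B(t)-\alpha t$ be a Brownian motion with negative drift ($\alpha\ge 0$), independent of $S$, started from $x\ge 0$. Let $X^*(t)=X(E(t))$ and let $g:\mathbb{R}_+\to\mathbb{R}_+$ be a bounded Borel measurable function with compact support contained in $[0,a]$. Then $$\mathbb{E}\left[\exp\left\{-\int_0^{\tau^*}g(X^*(t))\,dt\right\}\right]=\exp\left\{-2\int_0^x u(s)\,ds\right\},\qquad \tau^*=\inf\{t:X^*(t)=0\},$$ where $u$ is the unique non-negative solution to $$u(r)+2\int_r^a\left(u(s)^2+\alpha u(s)\right)ds=\int_r^a\phi(g(s))\,ds,\qquad r\in[0,a],$$ with $u(r)=0$ for $r>a$.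
   Context: $B$ is a standard Brownian motion. The Laplace exponent $\phi$ of $S$ is defined by $\mathbb{E}[e^{-\lambda S(t)}]=e^{-t\phi(\lambda)}$ for $\lambda,t\ge 0$. *)

theory Defs
  imports "HOL-Probability.Probability"
begin

text \<open>Processes are families \<open>X t \<omega>\<close> of real random variables indexed by \<open>t :: real\<close>; only the
  times \<open>t \<ge> 0\<close> are meaningful. Path properties are required almost surely.\<close>

definition stoch_process :: "'w measure \<Rightarrow> (real \<Rightarrow> 'w \<Rightarrow> real) \<Rightarrow> bool" where
  "stoch_process M X \<longleftrightarrow> (\<forall>t\<ge>0. X t \<in> borel_measurable M)"

definition independent_increments :: "'w measure \<Rightarrow> (real \<Rightarrow> 'w \<Rightarrow> real) \<Rightarrow> bool" where
  "independent_increments M X \<longleftrightarrow>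
     (\<forall>(t :: nat \<Rightarrow> real) n. 0 \<le> t 0 \<and> mono t \<longrightarrow>
        prob_space.indep_vars M (\<lambda>_. borel) (\<lambda>i \<omega>. X (t (Suc i)) \<omega> - X (t i) \<omega>) {..<n})"

definition stationary_increments :: "'w measure \<Rightarrow> (real \<Rightarrow> 'w \<Rightarrow> real) \<Rightarrow> bool" where
  "stationary_increments M X \<longleftrightarrow>
     (\<forall>s\<ge>0. \<forall>h\<ge>0. distr M borel (\<lambda>\<omega>. X (s + h) \<omega> - X s \<omega>)
                    = distr M borel (\<lambda>\<omega>. X h \<omega> - X 0 \<omega>))"

definition cadlag :: "(real \<Rightarrow> real) \<Rightarrow> bool" where
  "cadlag f \<longleftrightarrow>
     (\<forall>t\<ge>0. continuous (at_right t) f) \<and> (\<forall>t>0. \<exists>l. (f \<longlongrightarrow> l) (at_left t))"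

definition standard_brownian_motion :: "'w measure \<Rightarrow> (real \<Rightarrow> 'w \<Rightarrow> real) \<Rightarrow> bool" where
  "standard_brownian_motion M B \<longleftrightarrow>
     stoch_process M B \<and>
     (AE \<omega> in M. B 0 \<omega> = 0) \<and>
     independent_increments M B \<and>
     (\<forall>s t. 0 \<le> s \<and> s < t \<longrightarrow>
        distributed M lborel (\<lambda>\<omega>. B t \<omega> - B s \<omega>) (\<lambda>y. ennreal (normal_density 0 (sqrt (t - s)) y))) \<and>
     (AE \<omega> in M. continuous_on {0..} (\<lambda>t. B t \<omega>))"

definition levy_process :: "'w measure \<Rightarrow> (real \<Rightarrow> 'w \<Rightarrow> real) \<Rightarrow> bool" where
  "levy_process M X \<longleftrightarrow>
     stoch_process M X \<and>
     (AE \<omega> in M. X 0 \<omega> = 0) \<and>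
     independent_increments M X \<and>
     stationary_increments M X \<and>
     (AE \<omega> in M. cadlag (\<lambda>t. X t \<omega>))"

text \<open>Subordinators are real-valued, that is, not killed.\<close>

definition subordinator :: "'w measure \<Rightarrow> (real \<Rightarrow> 'w \<Rightarrow> real) \<Rightarrow> bool" where
  "subordinator M S \<longleftrightarrow> levy_process M S \<and> (AE \<omega> in M. mono_on {0..} (\<lambda>t. S t \<omega>))"

definition strictly_increasing_subordinator :: "'w measure \<Rightarrow> (real \<Rightarrow> 'w \<Rightarrow> real) \<Rightarrow> bool" where
  "strictly_increasing_subordinator M S \<longleftrightarrow>
     subordinator M S \<and> (AE \<omega> in M. strict_mono_on {0..} (\<lambda>t. S t \<omega>))"

definition laplace_exponent :: "'w measure \<Rightarrow> (real \<Rightarrow> 'w \<Rightarrow> real) \<Rightarrow> (real \<Rightarrow> real) \<Rightarrow> bool" where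
  "laplace_exponent M S \<phi> \<longleftrightarrow>
     (\<forall>q\<ge>0. \<forall>t\<ge>0. (\<integral>\<omega>. exp (- q * S t \<omega>) \<partial>M) = exp (- t * \<phi> q))"

definition independent_processes ::
  "'w measure \<Rightarrow> (real \<Rightarrow> 'w \<Rightarrow> real) \<Rightarrow> (real \<Rightarrow> 'w \<Rightarrow> real) \<Rightarrow> bool" where
  "independent_processes M X Y \<longleftrightarrow>
     prob_space.indep_var M
       (PiM {0..} (\<lambda>_. borel)) (\<lambda>\<omega>. \<lambda>t\<in>{0..}. X t \<omega>)
       (PiM {0..} (\<lambda>_. borel)) (\<lambda>\<omega>. \<lambda>t\<in>{0..}. Y t \<omega>)"

text \<open>The infimum is taken in the reals: a strictly increasing subordinator is almost surely
  unbounded, so almost surely the set is nonempty for every \<open>t\<close>.\<close>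

definition inverse_process :: "(real \<Rightarrow> 'w \<Rightarrow> real) \<Rightarrow> real \<Rightarrow> 'w \<Rightarrow> real" where
  "inverse_process S t \<omega> = Inf {u. 0 \<le> u \<and> S u \<omega> > t}"

definition hitting_time_zero :: "(real \<Rightarrow> 'w \<Rightarrow> real) \<Rightarrow> 'w \<Rightarrow> ereal" where
  "hitting_time_zero Y \<omega> = Inf {ereal t | t. 0 \<le> t \<and> Y t \<omega> = 0}"

text \<open>\<open>k\<close> is the integrand on the right-hand side. Integrability is required explicitly because the
  Bochner integral of a non-integrable function is 0 rather than infinite.\<close>

definition nonneg_riccati_solution ::
  "real \<Rightarrow> real \<Rightarrow> (real \<Rightarrow> real) \<Rightarrow> (real \<Rightarrow> real) \<Rightarrow> bool" where
  "nonneg_riccati_solution \<alpha> a k u \<longleftrightarrow>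
     (\<forall>r\<ge>0. 0 \<le> u r) \<and>
     (\<forall>r>a. u r = 0) \<and>
     (\<forall>r\<in>{0..a}.
        set_integrable lborel {r..a} (\<lambda>s. (u s)\<^sup>2 + \<alpha> * u s) \<and>
        u r + 2 * (LBINT s:{r..a}. (u s)\<^sup>2 + \<alpha> * u s) = (LBINT s:{r..a}. k s))"

end

theory Submission
  imports Defs
begin

text \<open>
  Before \<open>\<tau>*\<close> the integral of \<open>g (X*)\<close> is the Stieltjes integral of \<open>g (X)\<close> against \<open>S\<close> up to the hitting time
  of \<open>0\<close> by \<open>X\<close>. On a grid of mesh \<open>h\<close>, independence of \<open>X\<close> and \<open>S\<close> replaces each factor
  \<open>exp (- g (X (i h)) (S ((i+1) h) - S (i h)))\<close> by \<open>exp (- h \<phi> (g (X (i h))))\<close>. Putting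
  \<open>\<psi> y = exp (- 2 \<integral>\<^sub>0\<^sup>y u)\<close> turns the Riccati equation into the linear equation
  \<open>\<psi>''/2 - \<alpha> \<psi>' = \<phi>(g) \<psi>\<close>, so that \<open>\<psi> (X)\<close> times the product of these factors is a martingale up to
  \<open>o(h)\<close> per step; no stochastic calculus is needed. Stopping when the grid walk falls below \<open>\<epsilon>\<close> and
  letting first \<open>h \<rightarrow> 0\<close>, then \<open>\<epsilon> \<rightarrow> 0\<close>, gives the theorem for continuous \<open>g\<close>: the stopping times increase
  to the hitting time strictly from below, so the clock tends to the left limit of \<open>S\<close> there, which
  is \<open>\<tau>*\<close>. For Borel \<open>g\<close> one approximates almost everywhere by continuous functions; applied to functions
  increasing to the indicator of a small open set, the continuous case shows that \<open>X*\<close> spends no time in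
  null sets.
\<close>

section \<open>Discrete Feynman--Kac formula\<close>

text \<open>The clock need not be measurable for M: path properties hold only almost surely, and
  \<tau>* involves uncountably many times. It is reached as an almost sure limit of bounded
  measurable grid functionals, whence the expectation under \<open>completion M\<close>. The barrier
  \<epsilon> is there because \<psi> is continued by the constant 1 to the left of 0 and generally
  has a kink at 0, so the linear equation can be used only at points bounded away from 0; in the
  one-step estimate all other values of \<psi> enter through |\<psi>| \<le> 1 alone. Averaging out S
  is compatible with stopping since the stopping rule looks at X alone. The quadratic term
  disappears because u = -\<psi>'/(2\<psi>) is a logarithmic derivative. For Borel g the difficulty
  lies on the left-hand side: functions equal almost everywhere give the same Riccati equation, but
  not obviously the same clock. The formula itself settles this: a lower bound close to 1 for
  E[exp(-clock)] forces the clock to be small.\<close>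

lemma (in prob_space) indep_var_Fubini_bounded:
  fixes f :: "_ \<Rightarrow> real"
  assumes ind: "indep_var S X T Y" and f [measurable]: "f \<in> borel_measurable (S \<Otimes>\<^sub>M T)"
    and bnd: "\<And>p. \<bar>f p\<bar> \<le> C"
  shows "(\<integral>\<omega>. f (X \<omega>, Y \<omega>) \<partial>M) = (\<integral>\<omega>. (\<integral>\<omega>'. f (X \<omega>, Y \<omega>') \<partial>M) \<partial>M)"
proof -
  have X [measurable]: "X \<in> measurable M S" and Y [measurable]: "Y \<in> measurable M T"
    and eq: "distr M S X \<Otimes>\<^sub>M distr M T Y = distr M (S \<Otimes>\<^sub>M T) (\<lambda>x. (X x, Y x))"
    using ind unfolding indep_var_distribution_eq by auto
  interpret PX: prob_space "distr M S X" by (rule prob_space_distr) simp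
  interpret PY: prob_space "distr M T Y" by (rule prob_space_distr) simp
  interpret P: pair_prob_space "distr M S X" "distr M T Y" ..
  have int: "integrable (distr M S X \<Otimes>\<^sub>M distr M T Y) f"
    by (rule P.integrable_const_bound[where B = C]) (use bnd in \<open>auto cong: measurable_cong_sets\<close>)
  \<comment> \<open>Independence says that the joint law is the product of the marginals. Fubini is
    applied there, and both marginals are pulled back to M, leaving one frozen and one averaged
    copy.\<close>
  have "(\<integral>\<omega>. f (X \<omega>, Y \<omega>) \<partial>M) = integral\<^sup>L (distr M (S \<Otimes>\<^sub>M T) (\<lambda>x. (X x, Y x))) f"
    by (subst integral_distr) auto
  also have "\<dots> = (\<integral>x. (\<integral>y. f (x, y) \<partial>distr M T Y) \<partial>distr M S X)"
    unfolding eq[symmetric] by (rule P.integral_fst'[OF int, symmetric])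
  also have "\<dots> = (\<integral>\<omega>. (\<integral>y. f (X \<omega>, y) \<partial>distr M T Y) \<partial>M)"
    by (subst integral_distr) (auto intro!: PY.borel_measurable_lebesgue_integral simp: split_def cong: measurable_cong_sets)
  also have "\<dots> = (\<integral>\<omega>. (\<integral>\<omega>'. f (X \<omega>, Y \<omega>') \<partial>M) \<partial>M)"
  proof (rule Bochner_Integration.integral_cong[OF refl])
    fix \<omega> assume "\<omega> \<in> space M"
    then have [measurable]: "(\<lambda>y. f (X \<omega>, y)) \<in> borel_measurable T"
      using measurable_space[OF X] by (intro measurable_compose[OF _ f]) auto
    show "(\<integral>y. f (X \<omega>, y) \<partial>distr M T Y) = (\<integral>\<omega>'. f (X \<omega>, Y \<omega>') \<partial>M)"
      by (rule integral_distr) auto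
  qed
  finally show ?thesis .
qed

section \<open>Stopping a discrete path below a barrier\<close>

definition alive :: "real \<Rightarrow> (nat \<Rightarrow> real) \<Rightarrow> nat \<Rightarrow> bool" where
  "alive \<epsilon> y n \<longleftrightarrow> (\<forall>l\<in>{..n}. \<epsilon> \<le> y l)"

text \<open>Survival is inherited by smaller indices, so this count is the first index at which y is
  below \<epsilon>, capped at N. The cardinality form yields measurability directly.\<close>

definition stop_index :: "real \<Rightarrow> (nat \<Rightarrow> real) \<Rightarrow> nat \<Rightarrow> nat" where
  "stop_index \<epsilon> y N = card {i. i < N \<and> alive \<epsilon> y i}"

lemma alive_antimono: "alive \<epsilon> y n \<Longrightarrow> m \<le> n \<Longrightarrow> alive \<epsilon> y m"
  by (auto simp: alive_def)

lemma alive_le: "alive \<epsilon> y n \<Longrightarrow> \<epsilon> \<le> y n"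
  by (auto simp: alive_def)

lemma stop_index_le: "stop_index \<epsilon> y N \<le> N"
proof -
  have "card {i. i < N \<and> alive \<epsilon> y i} \<le> card {..<N}" by (rule card_mono) auto
  then show ?thesis by (simp add: stop_index_def)
qed

lemma stop_index_Suc:
  "stop_index \<epsilon> y (Suc N) = (if alive \<epsilon> y N then Suc N else stop_index \<epsilon> y N)"
proof (cases "alive \<epsilon> y N")
  case True
  then have "{i. i < Suc N \<and> alive \<epsilon> y i} = {..<Suc N}"
    using alive_antimono[of \<epsilon> y N] by auto
  then show ?thesis using True by (simp add: stop_index_def)
next
  case False
  then have "{i. i < Suc N \<and> alive \<epsilon> y i} = {i. i < N \<and> alive \<epsilon> y i}"
    using less_Suc_eq by auto
  then show ?thesis using False by (simp add: stop_index_def)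
qed

lemma stop_index_alive: "alive \<epsilon> y N \<Longrightarrow> stop_index \<epsilon> y N = N"
  by (cases N) (auto simp: stop_index_Suc stop_index_def[of _ _ 0] dest: alive_antimono[where m = "N - 1"])

lemma less_stop_index_iff: "i < stop_index \<epsilon> y N \<longleftrightarrow> i < N \<and> alive \<epsilon> y i"
proof (induction N)
  case (Suc N)
  then show ?case
    using alive_antimono[of \<epsilon> y N i] alive_antimono[of \<epsilon> y i N] stop_index_le[of \<epsilon> y N]
    by (auto simp: stop_index_Suc less_Suc_eq)
qed (simp add: stop_index_def)

lemma stop_index_below:
  assumes "stop_index \<epsilon> y N < N"
  shows "y (stop_index \<epsilon> y N) < \<epsilon>"
proof (rule ccontr)
  let ?m = "stop_index \<epsilon> y N"
  assume "\<not> y ?m < \<epsilon>"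
  then have "alive \<epsilon> y ?m"
    using less_stop_index_iff[of _ \<epsilon> y N] alive_le by (fastforce simp: alive_def le_less)
  with assms show False using less_stop_index_iff[of ?m \<epsilon> y N] by simp
qed

text \<open>The stopped Feynman-Kac functional. Factors from the stopping index on are set to 1
  instead of shortening the product: the index range stays deterministic, so that the product can be
  averaged factor by factor over independent increments of S.\<close>

definition stopped_weight ::
  "real \<Rightarrow> (real \<Rightarrow> real) \<Rightarrow> (nat \<Rightarrow> real) \<Rightarrow> (nat \<Rightarrow> real) \<Rightarrow> nat \<Rightarrow> real" where
  "stopped_weight \<epsilon> \<psi> y c N = (\<Prod>i<N. if alive \<epsilon> y i then c i else 1) * \<psi> (y (stop_index \<epsilon> y N))"

lemma stopped_weight_0 [simp]: "stopped_weight \<epsilon> \<psi> y c 0 = \<psi> (y 0)"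
  by (simp add: stopped_weight_def stop_index_def)

text \<open>A martingale-difference form: nothing changes once the path has fallen below \<epsilon>;
  otherwise the increment is the weight collected before N times a one-step defect that sees the
  future only through \<open>y (Suc N)\<close>.\<close>

lemma stopped_weight_Suc:
  "stopped_weight \<epsilon> \<psi> y c (Suc N) = stopped_weight \<epsilon> \<psi> y c N +
     (if alive \<epsilon> y N then (\<Prod>i<N. c i) * (c N * \<psi> (y (Suc N)) - \<psi> (y N)) else 0)"
proof (cases "alive \<epsilon> y N")
  case True
  then have "(\<Prod>i<N. if alive \<epsilon> y i then c i else 1) = (\<Prod>i<N. c i)"
    by (intro prod.cong refl) (metis alive_antimono lessThan_iff less_imp_le)
  with True show ?thesis
    by (simp add: stopped_weight_def stop_index_Suc stop_index_alive algebra_simps)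
qed (simp add: stopped_weight_def stop_index_Suc)

lemma alive_cong: "(\<And>i. i \<le> n \<Longrightarrow> y i = z i) \<Longrightarrow> alive \<epsilon> y n = alive \<epsilon> z n"
  by (auto simp: alive_def)

lemma measurable_alive [measurable]:
  assumes [measurable]: "\<And>i. i \<le> n \<Longrightarrow> Y i \<in> borel_measurable M"
  shows "Measurable.pred M (\<lambda>\<omega>. alive \<epsilon> (\<lambda>i. Y i \<omega>) n)"
  unfolding alive_def by measurable

lemma abs_prod_le_1: "(\<And>i. i \<in> A \<Longrightarrow> \<bar>c i\<bar> \<le> (1::real)) \<Longrightarrow> \<bar>\<Prod>i\<in>A. c i\<bar> \<le> 1"
  unfolding abs_prod by (rule prod_le_1) auto

lemma abs_stopped_weight_le:
  assumes "\<And>i. i < N \<Longrightarrow> 0 \<le> c i \<and> c i \<le> 1" "\<And>y. \<bar>\<psi> y\<bar> \<le> 1"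
  shows "\<bar>stopped_weight \<epsilon> \<psi> y c N\<bar> \<le> 1"
proof -
  have "\<bar>\<Prod>i<N. if alive \<epsilon> y i then c i else 1\<bar> \<le> 1"
    by (rule abs_prod_le_1) (use assms(1) in auto)
  then have "\<bar>\<Prod>i<N. if alive \<epsilon> y i then c i else 1\<bar> * \<bar>\<psi> (y (stop_index \<epsilon> y N))\<bar> \<le> 1 * 1"
    by (intro mult_mono) (use assms in auto)
  then show ?thesis by (simp add: stopped_weight_def abs_mult)
qed

lemma measurable_stopped_weight [measurable]:
  assumes Y [measurable]: "\<And>i. Y i \<in> borel_measurable M" and [measurable]: "\<And>i. c i \<in> borel_measurable M"
    and [measurable]: "\<psi> \<in> borel_measurable borel"
  shows "(\<lambda>\<omega>. stopped_weight \<epsilon> \<psi> (\<lambda>i. Y i \<omega>) (\<lambda>i. c i \<omega>) N) \<in> borel_measurable M"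
proof -
  have [measurable]: "(\<lambda>\<omega>. stop_index \<epsilon> (\<lambda>i. Y i \<omega>) N) \<in> measurable M (count_space UNIV)"
    unfolding stop_index_def by (intro measurable_card) measurable
  have [measurable]: "(\<lambda>\<omega>. Y (stop_index \<epsilon> (\<lambda>i. Y i \<omega>) N) \<omega>) \<in> borel_measurable M"
    by (rule measurable_compose_countable[OF Y]) measurable
  show ?thesis unfolding stopped_weight_def by measurable
qed

text \<open>Approximate optional stopping. The increment in \<open>stopped_weight_Suc\<close> is a
  past factor of modulus at most 1 times the one-step defect; averaging over the next increment,
  which is independent of the past, leaves at most \<kappa>, and the steps add up.\<close>

lemma (in prob_space) discrete_Feynman_Kac:
  fixes W :: "nat \<Rightarrow> 'a \<Rightarrow> real" and \<psi> p :: "real \<Rightarrow> real" and x :: real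
  defines "Y \<equiv> \<lambda>i \<omega>. x + (\<Sum>l<i. W l \<omega>)"
  assumes ind: "\<And>N. indep_vars (\<lambda>_. borel) W {..<N}"
    and [measurable]: "\<psi> \<in> borel_measurable borel" "p \<in> borel_measurable borel"
    and \<psi>: "\<And>y. \<bar>\<psi> y\<bar> \<le> 1" and p: "\<And>y. 0 \<le> p y \<and> p y \<le> 1"
    and step: "\<And>i y. \<epsilon> \<le> y \<Longrightarrow> \<bar>p y * (\<integral>\<omega>. \<psi> (y + W i \<omega>) \<partial>M) - \<psi> y\<bar> \<le> \<kappa>"
  shows "\<bar>(\<integral>\<omega>. stopped_weight \<epsilon> \<psi> (\<lambda>i. Y i \<omega>) (\<lambda>i. p (Y i \<omega>)) N \<partial>M) - \<psi> x\<bar> \<le> N * \<kappa>"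
proof (induction N)
  case 0
  then show ?case by (simp add: Y_def prob_space)
next
  case (Suc n)
  have W [measurable]: "W i \<in> borel_measurable M" for i
    using ind[of "Suc i"] by (auto simp: indep_vars_def)
  have Y [measurable]: "Y i \<in> borel_measurable M" for i unfolding Y_def by measurable
  define Yv where "Yv \<equiv> \<lambda>i (v :: nat \<Rightarrow> real). x + (\<Sum>l<i. v l)"
  have Yv [measurable]: "Yv i \<in> borel_measurable (PiM {..<n} (\<lambda>_. borel))" if "i \<le> n" for i
    using that unfolding Yv_def by (intro borel_measurable_add borel_measurable_sum measurable_component_singleton) auto
  \<comment> \<open>The past factor, including the survival test up to n, depends only on the
    increments before n and is therefore independent of \<open>W n\<close>.\<close>
  define Av where "Av \<equiv> \<lambda>v. if alive \<epsilon> (\<lambda>i. Yv i v) n then (\<Prod>i<n. p (Yv i v)) else 0"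
  have [measurable]: "Av \<in> borel_measurable (PiM {..<n} (\<lambda>_. borel))"
    unfolding Av_def by measurable
  have Av: "\<bar>Av v\<bar> \<le> 1" for v
    unfolding Av_def using p by (auto intro!: abs_prod_le_1)
  define V where "V \<equiv> \<lambda>\<omega>. restrict (\<lambda>i. W i \<omega>) {..<n}"
  have V [measurable]: "V \<in> measurable M (PiM {..<n} (\<lambda>_. borel))"
    unfolding V_def by measurable
  have YV: "Yv i (V \<omega>) = Y i \<omega>" if "i \<le> n" for i \<omega>
    using that by (auto simp: Yv_def V_def Y_def intro!: sum.cong)
  have "indep_var (PiM {..<n} (\<lambda>_. borel)) (\<lambda>\<omega>. restrict (\<lambda>i. W i \<omega>) {..<n})
      (PiM {n} (\<lambda>_. borel)) (\<lambda>\<omega>. restrict (\<lambda>i. W i \<omega>) {n})"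
    by (rule indep_var_restrict[OF ind[of "Suc n"]]) auto
  then have indV: "indep_var (PiM {..<n} (\<lambda>_. borel)) V (PiM {n} (\<lambda>_. borel)) (\<lambda>\<omega>. \<lambda>i\<in>{n}. W i \<omega>)"
    by (simp only: V_def)
  define f where "f \<equiv> \<lambda>(v, w). Av v * (p (Yv n v) * \<psi> (Yv n v + w n) - \<psi> (Yv n v))"
  have f_meas [measurable]: "f \<in> borel_measurable (PiM {..<n} (\<lambda>_. borel) \<Otimes>\<^sub>M PiM {n} (\<lambda>_. borel))"
    unfolding f_def using Yv[of n] by measurable
  have fb: "\<bar>f q\<bar> \<le> 2" for q
  proof -
    obtain v w where q: "q = (v, w)" by (cases q)
    have "\<bar>p (Yv n v) * \<psi> (Yv n v + w n)\<bar> \<le> 1 * 1"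
      unfolding abs_mult using p \<psi> by (intro mult_mono) auto
    then have "\<bar>p (Yv n v) * \<psi> (Yv n v + w n) - \<psi> (Yv n v)\<bar> \<le> 2"
      using \<psi>[of "Yv n v"] by linarith
    then have "\<bar>Av v\<bar> * \<bar>p (Yv n v) * \<psi> (Yv n v + w n) - \<psi> (Yv n v)\<bar> \<le> 1 * 2"
      using Av by (intro mult_mono) auto
    then show ?thesis by (simp add: q f_def abs_mult)
  qed
  have inner: "\<bar>\<integral>\<omega>'. f (V \<omega>, \<lambda>i\<in>{n}. W i \<omega>') \<partial>M\<bar> \<le> \<kappa>" for \<omega>
  proof (cases "alive \<epsilon> (\<lambda>i. Yv i (V \<omega>)) n")
    case True
    let ?y = "Yv n (V \<omega>)"
    have y: "\<epsilon> \<le> ?y" using alive_le[OF True] .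
    have i1: "integrable M (\<lambda>\<omega>'. \<psi> (?y + W n \<omega>'))"
      by (rule integrable_const_bound[where B = 1]) (use \<psi> in auto)
    have "(\<integral>\<omega>'. f (V \<omega>, \<lambda>i\<in>{n}. W i \<omega>') \<partial>M) = Av (V \<omega>) * (p ?y * (\<integral>\<omega>'. \<psi> (?y + W n \<omega>') \<partial>M) - \<psi> ?y)"
      using i1 by (simp add: f_def prob_space)
    then have "\<bar>\<integral>\<omega>'. f (V \<omega>, \<lambda>i\<in>{n}. W i \<omega>') \<partial>M\<bar> \<le> 1 * \<kappa>"
      unfolding abs_mult using Av[of "V \<omega>"] step[OF y, of n] by (simp only: abs_mult) (intro mult_mono, auto)
    then show ?thesis by simp
  next
    case False
    have "0 \<le> \<kappa>" using step[of \<epsilon> 0] by linarith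
    then show ?thesis using False by (simp add: f_def Av_def)
  qed
  have "\<bar>\<integral>\<omega>. f (V \<omega>, \<lambda>i\<in>{n}. W i \<omega>) \<partial>M\<bar> \<le> \<kappa>"
  proof -
    have m: "(\<lambda>\<omega>. \<integral>\<omega>'. f (V \<omega>, \<lambda>i\<in>{n}. W i \<omega>') \<partial>M) \<in> borel_measurable M"
      by measurable
    have "\<bar>\<integral>\<omega>. (\<integral>\<omega>'. f (V \<omega>, \<lambda>i\<in>{n}. W i \<omega>') \<partial>M) \<partial>M\<bar> \<le> (\<integral>\<omega>. \<bar>\<integral>\<omega>'. f (V \<omega>, \<lambda>i\<in>{n}. W i \<omega>') \<partial>M\<bar> \<partial>M)"
      by (rule integral_abs_bound)
    also have "\<dots> \<le> (\<integral>\<omega>. \<kappa> \<partial>M)"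
      by (rule integral_mono) (use m inner in \<open>auto intro!: integrable_const_bound[where B = \<kappa>]\<close>)
    finally have "\<bar>\<integral>\<omega>. (\<integral>\<omega>'. f (V \<omega>, \<lambda>i\<in>{n}. W i \<omega>') \<partial>M) \<partial>M\<bar> \<le> \<kappa>"
      by (simp add: prob_space)
    then show ?thesis
      by (subst indep_var_Fubini_bounded[OF indV f_meas fb])
  qed
  moreover have "(\<integral>\<omega>. stopped_weight \<epsilon> \<psi> (\<lambda>i. Y i \<omega>) (\<lambda>i. p (Y i \<omega>)) (Suc n) \<partial>M) =
      (\<integral>\<omega>. stopped_weight \<epsilon> \<psi> (\<lambda>i. Y i \<omega>) (\<lambda>i. p (Y i \<omega>)) n \<partial>M) + (\<integral>\<omega>. f (V \<omega>, \<lambda>i\<in>{n}. W i \<omega>) \<partial>M)"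
  proof -
    have "stopped_weight \<epsilon> \<psi> (\<lambda>i. Y i \<omega>) (\<lambda>i. p (Y i \<omega>)) (Suc n) =
        stopped_weight \<epsilon> \<psi> (\<lambda>i. Y i \<omega>) (\<lambda>i. p (Y i \<omega>)) n + f (V \<omega>, \<lambda>i\<in>{n}. W i \<omega>)" for \<omega>
    proof -
      have "alive \<epsilon> (\<lambda>i. Yv i (V \<omega>)) n = alive \<epsilon> (\<lambda>i. Y i \<omega>) n"
        by (rule alive_cong) (simp add: YV)
      moreover have "Y (Suc n) \<omega> = Y n \<omega> + W n \<omega>" by (simp add: Y_def)
      moreover have "(\<Prod>i<n. p (Yv i (V \<omega>))) = (\<Prod>i<n. p (Y i \<omega>))"
        by (intro prod.cong) (auto simp: YV)
      ultimately show ?thesis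
        by (simp add: stopped_weight_Suc f_def Av_def YV)
    qed
    moreover have "integrable M (\<lambda>\<omega>. stopped_weight \<epsilon> \<psi> (\<lambda>i. Y i \<omega>) (\<lambda>i. p (Y i \<omega>)) n)"
      by (rule integrable_const_bound[where B = 1]) (use \<psi> p in \<open>auto intro!: abs_stopped_weight_le\<close>)
    moreover have "integrable M (\<lambda>\<omega>. f (V \<omega>, \<lambda>i\<in>{n}. W i \<omega>))"
      by (rule integrable_const_bound[where B = 2]) (use fb in auto)
    ultimately show ?thesis by simp
  qed
  ultimately show ?case using Suc by (simp add: algebra_simps abs_le_iff)
qed

section \<open>Moments of the increments and the one-step expansion\<close>

lemma exp_neg_quadratic_bound:
  fixes v :: real
  assumes "0 \<le> v"
  shows "\<bar>exp (- v) * (1 + v) - 1\<bar> \<le> v\<^sup>2"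
proof -
  \<comment> \<open>Both bounds come from 1 + t \<le> exp t, used at t = v and at t = -v.\<close>
  have "exp (- v) * (1 + v) \<le> exp (- v) * exp v"
    by (intro mult_left_mono) (use exp_ge_add_one_self[of v] in auto)
  moreover have "exp (- v) * exp v = 1"
    by (simp add: exp_minus)
  moreover have "(1 - v) * (1 + v) \<le> exp (- v) * (1 + v)"
    by (intro mult_right_mono) (use exp_ge_add_one_self[of "- v"] assms in auto)
  moreover have "(1 - v) * (1 + v) = 1 - v\<^sup>2" by (simp add: power2_eq_square algebra_simps)
  ultimately show ?thesis by (simp add: abs_le_iff)
qed

lemma (in prob_space) centred_normal_moments:
  assumes G: "distributed M lborel G (\<lambda>y. ennreal (normal_density 0 (sqrt h) y))" and h: "0 < h"
  shows "integrable M (\<lambda>\<omega>. G \<omega> ^ n)"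
    and "(\<integral>\<omega>. G \<omega> \<partial>M) = 0" "(\<integral>\<omega>. G \<omega> ^ 2 \<partial>M) = h" "(\<integral>\<omega>. G \<omega> ^ 4 \<partial>M) = 3 * h\<^sup>2"
proof -
  have s: "0 < sqrt h" using h by simp
  have [measurable]: "normal_density 0 (sqrt h) \<in> borel_measurable lborel" by simp
  show "integrable M (\<lambda>\<omega>. G \<omega> ^ n)"
    using distributed_integrable[OF G, of "\<lambda>y. y ^ n"] integrable_normal_moment[OF s, of 0 n] by simp
  show "(\<integral>\<omega>. G \<omega> \<partial>M) = 0"
    using distributed_integral[OF G, of "\<lambda>y. y"] integral_normal_moment_odd[OF s, of 0 0] by simp
  show "(\<integral>\<omega>. G \<omega> ^ 2 \<partial>M) = h"
    using distributed_integral[OF G, of "\<lambda>y. y ^ 2"] integral_normal_moment_even[OF s, of 0 1] h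
    by (simp add: eval_nat_numeral)
  have "fact 4 / ((2 / h)\<^sup>2 * 2) = 3 * h\<^sup>2"
    using h by (simp add: fact_numeral field_simps power2_eq_square)
  then show "(\<integral>\<omega>. G \<omega> ^ 4 \<partial>M) = 3 * h\<^sup>2"
    using distributed_integral[OF G, of "\<lambda>y. y ^ 4"] integral_normal_moment_even[OF s, of 0 2] h
    by simp
qed

text \<open>The fourth moment is of order h^2 and thus negligible against h, which is why a quartic
  term may absorb the large increments in the one-step expansion.\<close>

lemma (in prob_space) drifted_normal_moments:
  fixes \<alpha> :: real
  assumes G: "distributed M lborel G (\<lambda>y. ennreal (normal_density 0 (sqrt h) y))" and h: "0 < h"
  defines "W \<equiv> \<lambda>\<omega>. G \<omega> - \<alpha> * h"
  shows "integrable M W" "integrable M (\<lambda>\<omega>. W \<omega> ^ 2)" "integrable M (\<lambda>\<omega>. W \<omega> ^ 4)"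
    and "(\<integral>\<omega>. W \<omega> \<partial>M) = - \<alpha> * h" "(\<integral>\<omega>. W \<omega> ^ 2 \<partial>M) = h + \<alpha>\<^sup>2 * h\<^sup>2"
    and "(\<integral>\<omega>. W \<omega> ^ 4 \<partial>M) \<le> 8 * (3 * h\<^sup>2 + \<alpha> ^ 4 * h ^ 4)"
proof -
  note mom = centred_normal_moments[OF G h]
  have i1: "integrable M G" using mom(1)[of 1] by simp
  show "integrable M W" unfolding W_def using i1 by simp
  show "(\<integral>\<omega>. W \<omega> \<partial>M) = - \<alpha> * h" unfolding W_def using i1 mom(2) by (simp add: prob_space)
  have e2: "(\<lambda>\<omega>. W \<omega> ^ 2) = (\<lambda>\<omega>. G \<omega> ^ 2 - 2 * \<alpha> * h * G \<omega> + \<alpha>\<^sup>2 * h\<^sup>2)"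
    by (auto simp: W_def power2_eq_square algebra_simps)
  show "integrable M (\<lambda>\<omega>. W \<omega> ^ 2)" unfolding e2 using mom(1)[of 2] i1 by simp
  show "(\<integral>\<omega>. W \<omega> ^ 2 \<partial>M) = h + \<alpha>\<^sup>2 * h\<^sup>2" unfolding e2 using mom(1)[of 2] i1 mom(2,3) by (simp add: prob_space)
  have e4: "(\<lambda>\<omega>. W \<omega> ^ 4) = (\<lambda>\<omega>. G \<omega> ^ 4 - 4 * (\<alpha> * h) * G \<omega> ^ 3 + 6 * (\<alpha> * h) ^ 2 * G \<omega> ^ 2
      - 4 * (\<alpha> * h) ^ 3 * G \<omega> + (\<alpha> * h) ^ 4)"
    by (auto simp: W_def eval_nat_numeral algebra_simps)
  show i4: "integrable M (\<lambda>\<omega>. W \<omega> ^ 4)" unfolding e4 using mom(1)[of 2] mom(1)[of 3] mom(1)[of 4] i1 by simp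
  have le: "(u - v) ^ 4 \<le> 8 * (u ^ 4 + v ^ 4)" for u v :: real
  proof -
    \<comment> \<open>The parallelogram bound, used twice, gives the constant 8 = 2^2 * 2.\<close>
    have "(u - v)\<^sup>2 \<le> 2 * (u\<^sup>2 + v\<^sup>2)"
      using zero_le_power2[of "u + v"] by (simp add: power2_eq_square algebra_simps)
    then have "((u - v)\<^sup>2)\<^sup>2 \<le> (2 * (u\<^sup>2 + v\<^sup>2))\<^sup>2" by (intro power_mono) auto
    also have "\<dots> = 4 * (u\<^sup>2 + v\<^sup>2)\<^sup>2" by (subst power_mult_distrib) simp
    also have "(u\<^sup>2 + v\<^sup>2)\<^sup>2 \<le> 2 * (u ^ 4 + v ^ 4)"
      using zero_le_power2[of "u\<^sup>2 - v\<^sup>2"] by (simp add: eval_nat_numeral algebra_simps)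
    finally show ?thesis by simp
  qed
  have "(\<integral>\<omega>. W \<omega> ^ 4 \<partial>M) \<le> (\<integral>\<omega>. 8 * (G \<omega> ^ 4 + (\<alpha> * h) ^ 4) \<partial>M)"
    by (rule integral_mono[OF i4]) (use mom(1)[of 4] le in \<open>auto simp: W_def\<close>)
  also have "\<dots> = 8 * (3 * h\<^sup>2 + \<alpha> ^ 4 * h ^ 4)"
    using mom(1)[of 4] mom(4) by (simp add: prob_space power_mult_distrib)
  finally show "(\<integral>\<omega>. W \<omega> ^ 4 \<partial>M) \<le> 8 * (3 * h\<^sup>2 + \<alpha> ^ 4 * h ^ 4)" .
qed

text \<open>Large increments are absorbed into a quartic term, so \<open>\<psi>\<close> need only be smooth near the points
  under consideration.\<close>

definition uniform_Taylor2 ::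
  "real \<Rightarrow> (real \<Rightarrow> real) \<Rightarrow> (real \<Rightarrow> real) \<Rightarrow> (real \<Rightarrow> real) \<Rightarrow> bool" where
  "uniform_Taylor2 \<epsilon> \<psi> D1 D2 \<longleftrightarrow>
     (\<forall>\<eta>>0. \<exists>\<delta>>0. \<forall>y\<ge>\<epsilon>. \<forall>z. \<bar>z\<bar> < \<delta> \<longrightarrow>
        \<bar>\<psi> (y + z) - \<psi> y - D1 y * z - D2 y * z\<^sup>2 / 2\<bar> \<le> \<eta> * z\<^sup>2)"

lemma uniform_Taylor2_global:
  assumes T: "uniform_Taylor2 \<epsilon> \<psi> D1 D2" and \<eta>: "0 < \<eta>"
    and \<psi>: "\<And>y. \<bar>\<psi> y\<bar> \<le> 1" and D: "\<And>y. \<epsilon> \<le> y \<Longrightarrow> \<bar>D1 y\<bar> \<le> K \<and> \<bar>D2 y\<bar> \<le> K"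
  shows "\<exists>C\<ge>0. \<forall>y z. \<epsilon> \<le> y \<longrightarrow>
    \<bar>\<psi> (y + z) - \<psi> y - D1 y * z - D2 y * z\<^sup>2 / 2\<bar> \<le> \<eta> * z\<^sup>2 + C * z ^ 4"
proof -
  obtain d where d: "d > 0" "\<And>y z. \<epsilon> \<le> y \<Longrightarrow> \<bar>z\<bar> < d \<Longrightarrow>
      \<bar>\<psi> (y + z) - \<psi> y - D1 y * z - D2 y * z\<^sup>2 / 2\<bar> \<le> \<eta> * z\<^sup>2"
    using T[unfolded uniform_Taylor2_def, rule_format, OF \<eta>] by auto
  \<comment> \<open>One summand for each term of the crude bound
    \<open>2 + K * w + K * w\<^sup>2\<close>, used for w = |z| \<ge> d: powers of w/d \<ge> 1 lift
    each term to a multiple of w^4.\<close>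
  define C where "C = 2 / d ^ 4 + K / d ^ 3 + K / d ^ 2"
  have K: "0 \<le> K" using D[of \<epsilon>] by linarith
  have C: "0 \<le> C" unfolding C_def using d(1) K by simp
  show ?thesis
  proof (intro exI[of _ C] conjI C allI impI)
    fix y z assume y: "\<epsilon> \<le> y"
    show "\<bar>\<psi> (y + z) - \<psi> y - D1 y * z - D2 y * z\<^sup>2 / 2\<bar> \<le> \<eta> * z\<^sup>2 + C * z ^ 4"
    proof (cases "\<bar>z\<bar> < d")
      case True
      then show ?thesis using d(2)[OF y True] C by (simp add: add_increasing2)
    next
      case False
      define w where "w = \<bar>z\<bar>"
      have w: "d \<le> w" "0 < w" using False d(1) by (auto simp: w_def)
      have "\<bar>D1 y * z\<bar> \<le> K * w" unfolding abs_mult w_def using D[OF y] by (intro mult_right_mono) auto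
      moreover have "\<bar>D2 y * z\<^sup>2\<bar> \<le> K * w\<^sup>2" unfolding abs_mult w_def using D[OF y] by (simp add: mult_right_mono)
      ultimately have "\<bar>\<psi> (y + z) - \<psi> y - D1 y * z - D2 y * z\<^sup>2 / 2\<bar> \<le> 2 + K * w + K * w\<^sup>2 / 2"
        using \<psi>[of y] \<psi>[of "y + z"] by linarith
      also have "\<dots> \<le> 2 + K * w + K * w\<^sup>2" using K by simp
      also have "\<dots> \<le> C * w ^ 4"
      proof -
        have 1: "1 \<le> w / d" using w d(1) by simp
        have "C * w ^ 4 = 2 / d ^ 4 * w ^ 4 + K / d ^ 3 * w ^ 4 + K / d ^ 2 * w ^ 4"
          unfolding C_def distrib_right ..
        also have "\<dots> = 2 * (w / d) ^ 4 + K * w * (w / d) ^ 3 + K * w\<^sup>2 * (w / d) ^ 2"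
          by (simp add: power_divide eval_nat_numeral)
        finally have eq: "C * w ^ 4 = 2 * (w / d) ^ 4 + K * w * (w / d) ^ 3 + K * w\<^sup>2 * (w / d) ^ 2" .
        have "2 * 1 \<le> 2 * (w / d) ^ 4" by (intro mult_left_mono one_le_power 1) auto
        moreover have "K * w * 1 \<le> K * w * (w / d) ^ 3"
          by (intro mult_left_mono one_le_power 1) (use K w in auto)
        moreover have "K * w\<^sup>2 * 1 \<le> K * w\<^sup>2 * (w / d) ^ 2"
          by (intro mult_left_mono one_le_power 1) (use K w in auto)
        ultimately have "2 * 1 + K * w * 1 + K * w\<^sup>2 * 1 \<le> C * w ^ 4"
          unfolding eq by (intro add_mono)
        then show ?thesis by simp
      qed
      also have "C * w ^ 4 = C * z ^ 4" by (simp add: w_def)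
      also have "\<dots> \<le> \<eta> * z\<^sup>2 + C * z ^ 4" using \<eta> by simp
      finally show ?thesis .
    qed
  qed
qed

text \<open>One step of the generator: \<open>D2/2 - \<alpha> D1 = k \<psi>\<close> cancels all terms of order \<open>h\<close>.\<close>

lemma (in prob_space) one_step_estimate:
  assumes T: "uniform_Taylor2 \<epsilon> \<psi> D1 D2" and \<eta>: "0 < \<eta>"
    and [measurable]: "\<psi> \<in> borel_measurable borel"
    and \<psi>: "\<And>y. \<bar>\<psi> y\<bar> \<le> 1" and D: "\<And>y. \<epsilon> \<le> y \<Longrightarrow> \<bar>D1 y\<bar> \<le> K \<and> \<bar>D2 y\<bar> \<le> K"
    and k: "\<And>y. 0 \<le> k y \<and> k y \<le> K"
    and ode: "\<And>y. \<epsilon> \<le> y \<Longrightarrow> D2 y / 2 - \<alpha> * D1 y = k y * \<psi> y"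
  shows "\<exists>C. \<forall>h G y. 0 < h \<longrightarrow> h \<le> 1 \<longrightarrow>
      distributed M lborel G (\<lambda>y. ennreal (normal_density 0 (sqrt h) y)) \<longrightarrow> \<epsilon> \<le> y \<longrightarrow>
      \<bar>exp (- h * k y) * (\<integral>\<omega>. \<psi> (y + (G \<omega> - \<alpha> * h)) \<partial>M) - \<psi> y\<bar> \<le> h * (\<eta> * (1 + \<alpha>\<^sup>2) + C * h)"
proof -
  obtain C0 where C0: "0 \<le> C0"
    "\<And>y z. \<epsilon> \<le> y \<Longrightarrow> \<bar>\<psi> (y + z) - \<psi> y - D1 y * z - D2 y * z\<^sup>2 / 2\<bar> \<le> \<eta> * z\<^sup>2 + C0 * z ^ 4"
    using uniform_Taylor2_global[OF T \<eta> \<psi> D] by auto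
  have K: "0 \<le> K" using k[of 0] by linarith
  \<comment> \<open>The coefficients of h^2 in the error: K^2 from the exponential factor, K
    \<alpha>^2/2 from the squared drift in the second moment, the rest from the fourth
    moment.\<close>
  define C where "C = K\<^sup>2 + K * \<alpha>\<^sup>2 / 2 + C0 * (8 * (3 + \<alpha> ^ 4))"
  show ?thesis
  proof (intro exI[of _ C] allI impI)
    fix h G y
    assume h: "0 < h" "h \<le> (1::real)" and y: "\<epsilon> \<le> y"
      and G: "distributed M lborel G (\<lambda>y. ennreal (normal_density 0 (sqrt h) y))"
    define W where "W \<omega> = G \<omega> - \<alpha> * h" for \<omega>
    note mom = drifted_normal_moments[OF G h(1), of \<alpha>, folded W_def]
    have [measurable]: "W \<in> borel_measurable M" using mom(1) by auto
    define R where "R = (\<lambda>\<omega>. \<psi> (y + W \<omega>) - \<psi> y - D1 y * W \<omega> - D2 y * (W \<omega>)\<^sup>2 / 2)"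
    have i\<psi>: "integrable M (\<lambda>\<omega>. \<psi> (y + W \<omega>))"
      by (rule integrable_const_bound[where B = 1]) (use \<psi> in auto)
    have iR: "integrable M R" unfolding R_def using i\<psi> mom(1,2) by auto
    have "\<bar>\<integral>\<omega>. R \<omega> \<partial>M\<bar> \<le> (\<integral>\<omega>. \<bar>R \<omega>\<bar> \<partial>M)" by (rule integral_abs_bound)
    also have "\<dots> \<le> (\<integral>\<omega>. \<eta> * W \<omega> ^ 2 + C0 * W \<omega> ^ 4 \<partial>M)"
      by (rule integral_mono) (use iR mom(2,3) C0(2)[OF y] in \<open>simp_all add: R_def\<close>)
    also have "\<dots> = \<eta> * (h + \<alpha>\<^sup>2 * h\<^sup>2) + C0 * (\<integral>\<omega>. W \<omega> ^ 4 \<partial>M)" using mom(2,3,5) by simp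
    also have "\<dots> \<le> \<eta> * (h + \<alpha>\<^sup>2 * h\<^sup>2) + C0 * (8 * (3 * h\<^sup>2 + \<alpha> ^ 4 * h ^ 4))"
      using mom(6) C0(1) by (simp add: mult_left_mono)
    finally have R1: "\<bar>\<integral>\<omega>. R \<omega> \<partial>M\<bar> \<le> \<eta> * (h + \<alpha>\<^sup>2 * h\<^sup>2) + C0 * (8 * (3 * h\<^sup>2 + \<alpha> ^ 4 * h ^ 4))" .
    have h2: "h\<^sup>2 \<le> h" "h ^ 4 \<le> h\<^sup>2"
      using h power_decreasing[of 1 2 h] power_decreasing[of 2 4 h] by auto
    have "\<alpha>\<^sup>2 * h\<^sup>2 \<le> \<alpha>\<^sup>2 * h" using h2 by (intro mult_left_mono) auto
    then have a1: "\<eta> * (h + \<alpha>\<^sup>2 * h\<^sup>2) \<le> \<eta> * (h + \<alpha>\<^sup>2 * h)" using \<eta> by (intro mult_left_mono) auto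
    have "\<alpha> ^ 4 * h ^ 4 \<le> \<alpha> ^ 4 * h\<^sup>2" using h2 by (intro mult_left_mono) auto
    then have "C0 * (8 * (3 * h\<^sup>2 + \<alpha> ^ 4 * h ^ 4)) \<le> C0 * (8 * (3 * h\<^sup>2 + \<alpha> ^ 4 * h\<^sup>2))"
      using C0 by (intro mult_left_mono) auto
    with R1 a1 have R2: "\<bar>\<integral>\<omega>. R \<omega> \<partial>M\<bar> \<le> \<eta> * (h + \<alpha>\<^sup>2 * h) + C0 * (8 * (3 * h\<^sup>2 + \<alpha> ^ 4 * h\<^sup>2))"
      by linarith
    \<comment> \<open>What the cancellation leaves over: the h^2 part of the second moment and the
      Taylor remainder.\<close>
    define \<rho> where "\<rho> = D2 y / 2 * (\<alpha>\<^sup>2 * h\<^sup>2) + (\<integral>\<omega>. R \<omega> \<partial>M)"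
    have "(\<integral>\<omega>. R \<omega> \<partial>M) = (\<integral>\<omega>. \<psi> (y + W \<omega>) \<partial>M) - \<psi> y - D1 y * (- \<alpha> * h) - D2 y * (h + \<alpha>\<^sup>2 * h\<^sup>2) / 2"
      unfolding R_def using i\<psi> mom by (simp add: prob_space)
    then have "(\<integral>\<omega>. \<psi> (y + W \<omega>) \<partial>M) = \<psi> y + h * (D2 y / 2 - \<alpha> * D1 y) + \<rho>"
      by (simp add: \<rho>_def algebra_simps add_divide_distrib)
    also have "\<dots> = \<psi> y * (1 + h * k y) + \<rho>" by (simp add: ode[OF y] algebra_simps)
    finally have E: "(\<integral>\<omega>. \<psi> (y + W \<omega>) \<partial>M) = \<psi> y * (1 + h * k y) + \<rho>" .
    have "\<bar>D2 y / 2 * (\<alpha>\<^sup>2 * h\<^sup>2)\<bar> \<le> K / 2 * (\<alpha>\<^sup>2 * h\<^sup>2)"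
      unfolding abs_mult using D[OF y] by (intro mult_mono) auto
    then have \<rho>: "\<bar>\<rho>\<bar> \<le> K / 2 * (\<alpha>\<^sup>2 * h\<^sup>2) + (\<eta> * (h + \<alpha>\<^sup>2 * h) + C0 * (8 * (3 * h\<^sup>2 + \<alpha> ^ 4 * h\<^sup>2)))"
      unfolding \<rho>_def using R2 by linarith
    have hk: "0 \<le> h * k y" using h k by simp
    define A1 where "A1 = \<psi> y * (exp (- (h * k y)) * (1 + h * k y) - 1)"
    define A2 where "A2 = exp (- (h * k y)) * \<rho>"
    have eq: "exp (- h * k y) * (\<integral>\<omega>. \<psi> (y + W \<omega>) \<partial>M) - \<psi> y = A1 + A2"
      unfolding E A1_def A2_def by (simp add: algebra_simps)
    have "\<bar>A1\<bar> \<le> 1 * (h * k y)\<^sup>2"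
      unfolding A1_def abs_mult by (rule mult_mono[OF \<psi> exp_neg_quadratic_bound[OF hk]]) auto
    also have "\<dots> \<le> (h * K)\<^sup>2"
      unfolding mult_1 by (intro power_mono mult_left_mono) (use h k hk in auto)
    finally have A1: "\<bar>A1\<bar> \<le> (h * K)\<^sup>2" .
    have "\<bar>A2\<bar> \<le> 1 * \<bar>\<rho>\<bar>"
      unfolding A2_def abs_mult by (rule mult_right_mono) (use hk in auto)
    then have A2: "\<bar>A2\<bar> \<le> \<bar>\<rho>\<bar>" by simp
    have "\<bar>exp (- h * k y) * (\<integral>\<omega>. \<psi> (y + W \<omega>) \<partial>M) - \<psi> y\<bar> \<le> (h * K)\<^sup>2 + \<bar>\<rho>\<bar>"
      unfolding eq by (rule order_trans[OF abs_triangle_ineq add_mono[OF A1 A2]])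
    also have "\<dots> \<le> (h * K)\<^sup>2 + (K / 2 * (\<alpha>\<^sup>2 * h\<^sup>2) + (\<eta> * (h + \<alpha>\<^sup>2 * h) + C0 * (8 * (3 * h\<^sup>2 + \<alpha> ^ 4 * h\<^sup>2))))"
      using \<rho> by simp
    also have "\<dots> = h * (\<eta> * (1 + \<alpha>\<^sup>2)) + h\<^sup>2 * C"
      unfolding C_def by (simp add: field_simps)
    also have "\<dots> = h * (\<eta> * (1 + \<alpha>\<^sup>2) + C * h)"
      by (simp add: power2_eq_square algebra_simps)
    finally show "\<bar>exp (- h * k y) * (\<integral>\<omega>. \<psi> (y + (G \<omega> - \<alpha> * h)) \<partial>M) - \<psi> y\<bar> \<le> h * (\<eta> * (1 + \<alpha>\<^sup>2) + C * h)"
      unfolding W_def .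
  qed
qed

lemma AE_integral_eq:
  fixes f g :: "_ \<Rightarrow> real"
  assumes "f \<in> borel_measurable M" "g \<in> borel_measurable M" "AE x in M. f x = g x"
  shows "integral\<^sup>L M f = integral\<^sup>L M g"
  by (rule integral_cong_AE) (use assms in auto)

text \<open>\<open>N * Suc n\<close> steps of length \<open>1 / Suc n\<close> cover the horizon N,
  so a defect of h (\<eta> (1 + \<alpha>^2) + C h) per step sums to N (\<eta> (1 + \<alpha>^2) + C
  h). Since \<eta> is arbitrary and C depends on \<eta> but not on h, the total error
  vanishes.\<close>

lemma (in prob_space) stopped_Feynman_Kac_limit:
  fixes x \<alpha> :: real and h :: "nat \<Rightarrow> real"
  defines "h \<equiv> \<lambda>n. 1 / real (Suc n)"
  assumes bm: "standard_brownian_motion M B"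
    and X: "\<And>t \<omega>. X t \<omega> = x + B t \<omega> - \<alpha> * t"
    and T: "uniform_Taylor2 \<epsilon> \<psi> D1 D2"
    and [measurable]: "\<psi> \<in> borel_measurable borel" "k \<in> borel_measurable borel"
    and \<psi>: "\<And>y. \<bar>\<psi> y\<bar> \<le> 1" and D: "\<And>y. \<epsilon> \<le> y \<Longrightarrow> \<bar>D1 y\<bar> \<le> K \<and> \<bar>D2 y\<bar> \<le> K"
    and k: "\<And>y. 0 \<le> k y \<and> k y \<le> K"
    and ode: "\<And>y. \<epsilon> \<le> y \<Longrightarrow> D2 y / 2 - \<alpha> * D1 y = k y * \<psi> y"
  shows "(\<lambda>n. \<integral>\<omega>. stopped_weight \<epsilon> \<psi> (\<lambda>i. X (i * h n) \<omega>) (\<lambda>i. exp (- h n * k (X (i * h n) \<omega>)))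
            (N * Suc n) \<partial>M) \<longlonglongrightarrow> \<psi> x"
proof (rule LIMSEQ_I)
  fix e :: real assume e: "0 < e"
  \<comment> \<open>Makes N \<eta> (1 + \<alpha>^2) at most e/2; the 1 added to N covers N =
    0.\<close>
  define \<eta> where "\<eta> = e / (2 * (1 + N) * (1 + \<alpha>\<^sup>2))"
  have a2: "0 < 1 + \<alpha>\<^sup>2" by (simp add: add_pos_nonneg)
  have \<eta>: "0 < \<eta>" unfolding \<eta>_def using e a2 by simp
  obtain C where C: "\<And>h G y. 0 < h \<Longrightarrow> h \<le> 1 \<Longrightarrow>
      distributed M lborel G (\<lambda>y. ennreal (normal_density 0 (sqrt h) y)) \<Longrightarrow> \<epsilon> \<le> y \<Longrightarrow>
      \<bar>exp (- h * k y) * (\<integral>\<omega>. \<psi> (y + (G \<omega> - \<alpha> * h)) \<partial>M) - \<psi> y\<bar> \<le> h * (\<eta> * (1 + \<alpha>\<^sup>2) + C * h)"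
    using one_step_estimate[OF T \<eta> assms(5) \<psi> D k ode] by auto
  have B [measurable]: "B t \<in> borel_measurable M" if "0 \<le> t" for t
    using bm that by (auto simp: standard_brownian_motion_def stoch_process_def)
  have bound: "\<bar>(\<integral>\<omega>. stopped_weight \<epsilon> \<psi> (\<lambda>i. X (i * h n) \<omega>) (\<lambda>i. exp (- h n * k (X (i * h n) \<omega>)))
            (N * Suc n) \<partial>M) - \<psi> x\<bar> \<le> N * (\<eta> * (1 + \<alpha>\<^sup>2) + C * h n)" for n
  proof -
    have h: "0 < h n" "h n \<le> 1" by (auto simp: h_def)
    define W where "W \<equiv> \<lambda>i \<omega>. (B (Suc i * h n) \<omega> - B (i * h n) \<omega>) - \<alpha> * h n"
    have "indep_vars (\<lambda>_. borel) (\<lambda>i \<omega>. B (Suc i * h n) \<omega> - B (i * h n) \<omega>) {..<m}" for m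
    proof -
      have "mono (\<lambda>i. real i * h n)" using h by (intro monoI mult_right_mono) auto
      with bm show ?thesis
        unfolding standard_brownian_motion_def independent_increments_def
        by (auto dest!: spec[of _ "\<lambda>i. real i * h n"])
    qed
    from indep_vars_compose2[OF this, where Y = "\<lambda>_ y. y - \<alpha> * h n" and N = "\<lambda>_. borel"]
    have indW: "indep_vars (\<lambda>_. borel) W {..<m}" for m
      by (simp add: W_def)
    define Y where "Y \<equiv> \<lambda>i \<omega>. x + (\<Sum>l<i. W l \<omega>)"
    \<comment> \<open>X is built from B t and not from B t - B 0, so the two walks are identified
      where B 0 = 0, that is almost surely.\<close>
    have YX: "Y i \<omega> = X (i * h n) \<omega>" if "B 0 \<omega> = 0" for i \<omega>
    proof -
      have "(\<Sum>l<i. W l \<omega>) = (\<Sum>l<i. B (Suc l * h n) \<omega> - B (l * h n) \<omega>) - i * (\<alpha> * h n)"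
        unfolding W_def by (simp add: sum_subtractf)
      also have "(\<Sum>l<i. B (Suc l * h n) \<omega> - B (l * h n) \<omega>) = B (i * h n) \<omega>"
        using sum_lessThan_telescope[of "\<lambda>l. B (l * h n) \<omega>" i] that by simp
      finally show ?thesis by (simp add: Y_def X)
    qed
    have step: "\<bar>exp (- h n * k y) * (\<integral>\<omega>. \<psi> (y + W i \<omega>) \<partial>M) - \<psi> y\<bar> \<le> h n * (\<eta> * (1 + \<alpha>\<^sup>2) + C * h n)"
      if "\<epsilon> \<le> y" for i y
    proof -
      have "real i * h n < Suc i * h n" using h by simp
      moreover have "real (Suc i) * h n - real i * h n = h n" by (simp add: algebra_simps)
      moreover have "0 \<le> real i * h n" using h by simp
      moreover have "\<forall>s t. 0 \<le> s \<and> s < t \<longrightarrow> distributed M lborel (\<lambda>\<omega>. B t \<omega> - B s \<omega>)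
          (\<lambda>y. ennreal (normal_density 0 (sqrt (t - s)) y))"
        using bm by (simp add: standard_brownian_motion_def)
      ultimately have "distributed M lborel (\<lambda>\<omega>. B (Suc i * h n) \<omega> - B (i * h n) \<omega>)
          (\<lambda>y. ennreal (normal_density 0 (sqrt (h n)) y))" by metis
      from C[OF h this that] show ?thesis by (simp only: W_def)
    qed
    have p: "0 \<le> exp (- h n * k y) \<and> exp (- h n * k y) \<le> 1" for y
      using h(1) k[of y] by simp
    have "\<bar>(\<integral>\<omega>. stopped_weight \<epsilon> \<psi> (\<lambda>i. Y i \<omega>) (\<lambda>i. exp (- h n * k (Y i \<omega>))) (N * Suc n) \<partial>M) - \<psi> x\<bar>
        \<le> real (N * Suc n) * (h n * (\<eta> * (1 + \<alpha>\<^sup>2) + C * h n))"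
      unfolding Y_def
      by (rule discrete_Feynman_Kac[OF indW _ _ \<psi> p step]) measurable
    also have "real (N * Suc n) * (h n * (\<eta> * (1 + \<alpha>\<^sup>2) + C * h n)) = N * (\<eta> * (1 + \<alpha>\<^sup>2) + C * h n)"
      by (simp add: h_def del: of_nat_Suc mult_Suc_right)
    also have "(\<integral>\<omega>. stopped_weight \<epsilon> \<psi> (\<lambda>i. Y i \<omega>) (\<lambda>i. exp (- h n * k (Y i \<omega>))) (N * Suc n) \<partial>M) =
        (\<integral>\<omega>. stopped_weight \<epsilon> \<psi> (\<lambda>i. X (i * h n) \<omega>) (\<lambda>i. exp (- h n * k (X (i * h n) \<omega>))) (N * Suc n) \<partial>M)"
    proof (rule AE_integral_eq)
      have W [measurable]: "W i \<in> borel_measurable M" for i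
        using indW[of "Suc i"] by (auto simp: indep_vars_def)
      have Y [measurable]: "Y i \<in> borel_measurable M" for i unfolding Y_def by measurable
      have [measurable]: "X (i * h n) \<in> borel_measurable M" for i :: nat
      proof -
        have "X (i * h n) = (\<lambda>\<omega>. x + B (i * h n) \<omega> - \<alpha> * (i * h n))" by (auto simp: X)
        then show ?thesis using B[of "i * h n"] h by simp
      qed
      show "(\<lambda>\<omega>. stopped_weight \<epsilon> \<psi> (\<lambda>i. Y i \<omega>) (\<lambda>i. exp (- h n * k (Y i \<omega>))) (N * Suc n)) \<in> borel_measurable M"
        by measurable
      show "(\<lambda>\<omega>. stopped_weight \<epsilon> \<psi> (\<lambda>i. X (i * h n) \<omega>) (\<lambda>i. exp (- h n * k (X (i * h n) \<omega>))) (N * Suc n)) \<in> borel_measurable M"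
        by measurable
      have "AE \<omega> in M. B 0 \<omega> = 0" using bm by (simp add: standard_brownian_motion_def)
      then show "AE \<omega> in M. stopped_weight \<epsilon> \<psi> (\<lambda>i. Y i \<omega>) (\<lambda>i. exp (- h n * k (Y i \<omega>))) (N * Suc n) =
          stopped_weight \<epsilon> \<psi> (\<lambda>i. X (i * h n) \<omega>) (\<lambda>i. exp (- h n * k (X (i * h n) \<omega>))) (N * Suc n)"
        by eventually_elim (simp add: YX)
    qed
    finally show ?thesis .
  qed
  have "(\<lambda>n. N * (C * h n)) \<longlonglongrightarrow> N * (C * 0)"
    unfolding h_def by (intro tendsto_intros LIMSEQ_Suc[OF lim_1_over_n])
  then have "\<forall>\<^sub>F n in sequentially. N * (C * h n) < e / 2"
    using e by (intro order_tendstoD) auto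
  then obtain n0 where n0: "\<And>n. n0 \<le> n \<Longrightarrow> N * (C * h n) < e / 2"
    by (auto simp: eventually_sequentially)
  have "N * (\<eta> * (1 + \<alpha>\<^sup>2)) \<le> e / 2"
  proof -
    have "\<eta> * (1 + \<alpha>\<^sup>2) = e / (2 * (1 + N))" unfolding \<eta>_def using a2 by simp
    then show ?thesis unfolding \<open>\<eta> * (1 + \<alpha>\<^sup>2) = e / (2 * (1 + N))\<close>
      using e by (simp add: field_simps)
  qed
  then have "norm ((\<integral>\<omega>. stopped_weight \<epsilon> \<psi> (\<lambda>i. X (i * h n) \<omega>) (\<lambda>i. exp (- h n * k (X (i * h n) \<omega>)))
            (N * Suc n) \<partial>M) - \<psi> x) < e" if "n0 \<le> n" for n
    using bound[of n] n0[OF that] by (simp add: distrib_left)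
  then show "\<exists>no. \<forall>n\<ge>no. norm ((\<integral>\<omega>. stopped_weight \<epsilon> \<psi> (\<lambda>i. X (i * h n) \<omega>) (\<lambda>i. exp (- h n * k (X (i * h n) \<omega>)))
            (N * Suc n) \<partial>M) - \<psi> x) < e" by blast
qed

text \<open>For frozen X the stopping index and the coefficients g (X (i h)) are constants. What
  remains is a product over independent increments of S, each with E[exp (-c (S (t + h) - S t))] =
  exp (-h \<phi> c).\<close>

lemma (in prob_space) Laplace_substitution:
  fixes h :: real
  assumes ind: "independent_processes M X S"
    and S: "subordinator M S" and \<phi>: "laplace_exponent M S \<phi>"
    and \<phi>m: "(\<lambda>y. \<phi> (g y)) \<in> borel_measurable borel"
    and [measurable]: "g \<in> borel_measurable borel" "\<psi> \<in> borel_measurable borel"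
    and g: "\<And>y. 0 \<le> g y" and \<psi>: "\<And>y. \<bar>\<psi> y\<bar> \<le> 1" and h: "0 < h"
  shows "(\<integral>\<omega>. stopped_weight \<epsilon> \<psi> (\<lambda>i. X (i * h) \<omega>)
             (\<lambda>i. exp (- g (X (i * h) \<omega>) * (S (Suc i * h) \<omega> - S (i * h) \<omega>))) N \<partial>M) =
         (\<integral>\<omega>. stopped_weight \<epsilon> \<psi> (\<lambda>i. X (i * h) \<omega>) (\<lambda>i. exp (- h * \<phi> (g (X (i * h) \<omega>)))) N \<partial>M)"
proof -
  let ?P = "PiM {0..} (\<lambda>_. borel) :: (real \<Rightarrow> real) measure"
  let ?X = "\<lambda>\<omega>. \<lambda>t\<in>{0..}. X t \<omega>" and ?S = "\<lambda>\<omega>. \<lambda>t\<in>{0..}. S t \<omega>"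
  have indXS: "indep_var ?P ?X ?P ?S" using ind by (simp add: independent_processes_def)
  have t0: "0 \<le> real i * h" for i using h by simp
  have Xm [measurable]: "X (i * h) \<in> borel_measurable M" for i :: nat
  proof -
    have "(\<lambda>\<omega>. ?X \<omega> (i * h)) \<in> borel_measurable M"
      using indep_var_rv1[OF indXS] by (rule measurable_compose) (use t0 in auto)
    then show ?thesis using t0[of i] by simp
  qed
  have Sm [measurable]: "S (i * h) \<in> borel_measurable M" for i :: nat
    using S t0 by (auto simp: subordinator_def levy_process_def stoch_process_def)
  have "AE \<omega> in M. mono_on {0..} (\<lambda>t. S t \<omega>)" using S by (simp add: subordinator_def)
  then have incr: "AE \<omega> in M. \<forall>i::nat. S (i * h) \<omega> \<le> S (Suc i * h) \<omega>"
    by eventually_elim (use h in \<open>auto simp: mono_on_def intro!: mult_right_mono\<close>)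
  \<comment> \<open>\<open>max 0\<close> bounds the functional by 1 for every pair of paths, as the
    Fubini step demands; almost surely it changes nothing because S increases.\<close>
  define f where "f \<equiv> \<lambda>(p :: real \<Rightarrow> real, s :: real \<Rightarrow> real). stopped_weight \<epsilon> \<psi> (\<lambda>i. p (i * h))
       (\<lambda>i. exp (- g (p (i * h)) * max 0 (s (Suc i * h) - s (i * h)))) N"
  have comp [measurable]: "(\<lambda>q. fst q (real i * h)) \<in> borel_measurable (?P \<Otimes>\<^sub>M ?P)"
      "(\<lambda>q. snd q (real i * h)) \<in> borel_measurable (?P \<Otimes>\<^sub>M ?P)" for i
    using t0[of i] by (auto intro!: measurable_compose[OF measurable_fst] measurable_compose[OF measurable_snd])
  have fm: "f \<in> borel_measurable (?P \<Otimes>\<^sub>M ?P)"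
    unfolding f_def split_def by measurable
  have fb: "\<bar>f q\<bar> \<le> 1" for q
    unfolding f_def split_def using g \<psi> by (intro abs_stopped_weight_le) auto
  have Lap: "(\<integral>\<omega>. exp (- c * max 0 (S (Suc i * h) \<omega> - S (i * h) \<omega>)) \<partial>M) = exp (- h * \<phi> c)"
    if c: "0 \<le> c" for i :: nat and c
  proof -
    have "(\<integral>\<omega>. exp (- c * max 0 (S (Suc i * h) \<omega> - S (i * h) \<omega>)) \<partial>M) =
        (\<integral>\<omega>. exp (- c * (S (i * h + h) \<omega> - S (i * h) \<omega>)) \<partial>M)"
    proof (rule AE_integral_eq)
      have [measurable]: "S (i * h + h) \<in> borel_measurable M" using Sm[of "Suc i"] by (simp add: algebra_simps)
      show "(\<lambda>\<omega>. exp (- c * (S (i * h + h) \<omega> - S (i * h) \<omega>))) \<in> borel_measurable M" by measurable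
      show "AE \<omega> in M. exp (- c * max 0 (S (Suc i * h) \<omega> - S (i * h) \<omega>)) = exp (- c * (S (i * h + h) \<omega> - S (i * h) \<omega>))"
        using incr by eventually_elim (auto simp: max_def algebra_simps dest!: spec[of _ i])
    qed measurable
    also have "\<dots> = (\<integral>z. exp (- c * z) \<partial>distr M borel (\<lambda>\<omega>. S (i * h + h) \<omega> - S (i * h) \<omega>))"
      using Sm[of "Suc i"] Sm[of i] by (subst integral_distr) (auto simp: algebra_simps)
    also have "distr M borel (\<lambda>\<omega>. S (i * h + h) \<omega> - S (i * h) \<omega>) = distr M borel (\<lambda>\<omega>. S h \<omega> - S 0 \<omega>)"
      using S t0[of i] h by (simp add: subordinator_def levy_process_def stationary_increments_def)
    also have "(\<integral>z. exp (- c * z) \<partial>distr M borel (\<lambda>\<omega>. S h \<omega> - S 0 \<omega>)) = (\<integral>\<omega>. exp (- c * (S h \<omega> - S 0 \<omega>)) \<partial>M)"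
      using Sm[of 0] Sm[of 1] by (subst integral_distr) auto
    also have "\<dots> = (\<integral>\<omega>. exp (- c * S h \<omega>) \<partial>M)"
    proof (rule AE_integral_eq)
      have "AE \<omega> in M. S 0 \<omega> = 0" using S by (simp add: subordinator_def levy_process_def)
      then show "AE \<omega> in M. exp (- c * (S h \<omega> - S 0 \<omega>)) = exp (- c * S h \<omega>)" by eventually_elim simp
    qed (use Sm[of 0] Sm[of 1] in auto)
    also have "\<dots> = exp (- h * \<phi> c)" using \<phi> c h by (simp add: laplace_exponent_def)
    finally show ?thesis .
  qed
  have indD: "indep_vars (\<lambda>_. borel) (\<lambda>i \<omega>. S (Suc i * h) \<omega> - S (i * h) \<omega>) {..<N}"
  proof -
    have "mono (\<lambda>i. real i * h)" using h by (intro monoI mult_right_mono) auto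
    with S show ?thesis
      unfolding subordinator_def levy_process_def independent_increments_def
      by (auto dest!: spec[of _ "\<lambda>i. real i * h"])
  qed
  have inner: "(\<integral>\<omega>'. f (?X \<omega>, ?S \<omega>') \<partial>M) =
      stopped_weight \<epsilon> \<psi> (\<lambda>i. X (i * h) \<omega>) (\<lambda>i. exp (- h * \<phi> (g (X (i * h) \<omega>)))) N" for \<omega>
  proof -
    let ?y = "\<lambda>i. X (real i * h) \<omega>"
    let ?Z = "\<lambda>i \<omega>'. if alive \<epsilon> ?y i then exp (- g (?y i) * max 0 (S (Suc i * h) \<omega>' - S (i * h) \<omega>')) else 1"
    have "f (?X \<omega>, ?S \<omega>') = (\<Prod>i<N. ?Z i \<omega>') * \<psi> (?y (stop_index \<epsilon> ?y N))" for \<omega>'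
      using t0 by (simp add: f_def stopped_weight_def h[THEN less_imp_le] cong: prod.cong if_cong)
    then have "(\<integral>\<omega>'. f (?X \<omega>, ?S \<omega>') \<partial>M) = (\<integral>\<omega>'. (\<Prod>i<N. ?Z i \<omega>') \<partial>M) * \<psi> (?y (stop_index \<epsilon> ?y N))"
      by simp
    also have "(\<integral>\<omega>'. (\<Prod>i<N. ?Z i \<omega>') \<partial>M) = (\<Prod>i<N. \<integral>\<omega>'. ?Z i \<omega>' \<partial>M)"
    proof (rule indep_vars_lebesgue_integral)
      show "indep_vars (\<lambda>_. borel) ?Z {..<N}"
        using indep_vars_compose2[OF indD, of "\<lambda>i d. if alive \<epsilon> ?y i then exp (- g (?y i) * max 0 d) else 1" "\<lambda>_. borel"]
        by simp
      show "integrable M (?Z i)" for i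
        by (rule integrable_const_bound[where B = 1]) (use g[of "?y i"] in auto)
    qed simp
    also have "\<dots> = (\<Prod>i<N. if alive \<epsilon> ?y i then exp (- h * \<phi> (g (?y i))) else 1)"
    proof (rule prod.cong[OF refl])
      fix i
      show "(\<integral>\<omega>'. ?Z i \<omega>' \<partial>M) = (if alive \<epsilon> ?y i then exp (- h * \<phi> (g (?y i))) else 1)"
      proof (cases "alive \<epsilon> ?y i")
        case True
        then show ?thesis by (simp only: if_True Lap[OF g])
      qed (simp add: prob_space)
    qed
    finally show ?thesis by (simp only: stopped_weight_def)
  qed
  have "(\<integral>\<omega>. stopped_weight \<epsilon> \<psi> (\<lambda>i. X (i * h) \<omega>)
             (\<lambda>i. exp (- g (X (i * h) \<omega>) * (S (Suc i * h) \<omega> - S (i * h) \<omega>))) N \<partial>M) =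
        (\<integral>\<omega>. f (?X \<omega>, ?S \<omega>) \<partial>M)"
  proof (rule AE_integral_eq)
    have fe: "f (?X \<omega>, ?S \<omega>) = stopped_weight \<epsilon> \<psi> (\<lambda>i. X (i * h) \<omega>)
        (\<lambda>i. exp (- g (X (i * h) \<omega>) * max 0 (S (Suc i * h) \<omega> - S (i * h) \<omega>))) N" for \<omega>
      using t0 by (simp add: f_def h[THEN less_imp_le])
    show "(\<lambda>\<omega>. f (?X \<omega>, ?S \<omega>)) \<in> borel_measurable M" unfolding fe by measurable
    show "AE \<omega> in M. stopped_weight \<epsilon> \<psi> (\<lambda>i. X (i * h) \<omega>)
             (\<lambda>i. exp (- g (X (i * h) \<omega>) * (S (Suc i * h) \<omega> - S (i * h) \<omega>))) N = f (?X \<omega>, ?S \<omega>)"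
      using incr by eventually_elim (simp add: fe max_absorb2 del: of_nat_Suc)
  qed measurable
  also have "\<dots> = (\<integral>\<omega>. (\<integral>\<omega>'. f (?X \<omega>, ?S \<omega>') \<partial>M) \<partial>M)"
    by (rule indep_var_Fubini_bounded[OF indXS fm fb])
  finally show ?thesis unfolding inner .
qed

section \<open>Time change along a path\<close>

text \<open>Inserting T caps the time at the horizon and keeps the set nonempty, so that the real
  infimum is never an unspecified value.\<close>

definition first_below :: "real \<Rightarrow> (real \<Rightarrow> real) \<Rightarrow> real \<Rightarrow> real" where
  "first_below \<epsilon> f T = Inf (insert T {t. 0 \<le> t \<and> t \<le> T \<and> f t < \<epsilon>})"

text \<open>\<open>inverse_process\<close> for a single path, so that the time change can be studied
  deterministically.\<close>

definition right_inverse :: "(real \<Rightarrow> real) \<Rightarrow> real \<Rightarrow> real" where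
  "right_inverse s t = Inf {u. 0 \<le> u \<and> s u > t}"

lemma first_below_bdd: "bdd_below (insert T {t. 0 \<le> t \<and> t \<le> T \<and> f t < \<epsilon>})" for T :: real
  by (auto intro!: bdd_belowI[of _ "min 0 T"])

lemma first_below_lower: "0 \<le> t \<Longrightarrow> f t < \<epsilon> \<Longrightarrow> first_below \<epsilon> f T \<le> t"
proof (cases "t \<le> T")
  case True
  assume "0 \<le> t" "f t < \<epsilon>"
  then show ?thesis unfolding first_below_def using True by (intro cInf_lower first_below_bdd) auto
next
  case False
  have "first_below \<epsilon> f T \<le> T" unfolding first_below_def by (intro cInf_lower first_below_bdd) auto
  with False show ?thesis by linarith
qed

lemma first_below_le: "first_below \<epsilon> f T \<le> T"
  unfolding first_below_def by (intro cInf_lower first_below_bdd) auto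

lemma first_below_greatest:
  "(\<And>t. 0 \<le> t \<Longrightarrow> t \<le> T \<Longrightarrow> f t < \<epsilon> \<Longrightarrow> v \<le> t) \<Longrightarrow> v \<le> T \<Longrightarrow> v \<le> first_below \<epsilon> f T"
  unfolding first_below_def by (intro cInf_greatest) auto

lemma first_below_nonneg: "0 \<le> T \<Longrightarrow> 0 \<le> first_below \<epsilon> f T"
  by (rule first_below_greatest) auto

lemma first_below_less:
  assumes "first_below \<epsilon> f T < v" "v \<le> T"
  obtains t where "0 \<le> t" "t < v" "f t < \<epsilon>"
proof -
  have "\<exists>t\<in>insert T {t. 0 \<le> t \<and> t \<le> T \<and> f t < \<epsilon>}. t < v"
    using assms(1) unfolding first_below_def by (subst (asm) cInf_less_iff[OF _ first_below_bdd]) auto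
  with assms(2) that show thesis by auto
qed

text \<open>If the walk stops before N, its stopping time is one of the times competing in
  \<open>first_below\<close>; otherwise it has run past the cap T.\<close>

lemma stop_index_ge_first_below:
  fixes h :: real
  assumes "0 < h" "T \<le> N * h"
  shows "first_below \<epsilon> f T \<le> stop_index \<epsilon> (\<lambda>i. f (i * h)) N * h"
proof (cases "stop_index \<epsilon> (\<lambda>i. f (i * h)) N < N")
  case True
  from stop_index_below[OF this] assms show ?thesis by (intro first_below_lower) auto
next
  case False
  then have "stop_index \<epsilon> (\<lambda>i. f (i * h)) N = N" using stop_index_le[of \<epsilon> "\<lambda>i. f (i * h)" N] by simp
  with first_below_le[of \<epsilon> f T] assms show ?thesis by simp
qed

text \<open>The limit is the first time strictly below \<open>\<epsilon>\<close>, not at \<open>\<epsilon>\<close>: \<open>f < \<epsilon>\<close> is an open condition and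
  is therefore seen by a fine grid.\<close>

lemma stop_index_tendsto_first_below:
  fixes f :: "real \<Rightarrow> real" and T :: nat and h :: "nat \<Rightarrow> real"
  defines "h \<equiv> \<lambda>n. 1 / real (Suc n)"
  assumes f: "continuous_on {0..} f"
  shows "(\<lambda>n. stop_index \<epsilon> (\<lambda>i. f (i * h n)) (T * Suc n) * h n) \<longlonglongrightarrow> first_below \<epsilon> f T"
proof (rule LIMSEQ_I)
  fix e :: real assume e: "0 < e"
  let ?\<sigma> = "first_below \<epsilon> f T"
  let ?m = "\<lambda>n. stop_index \<epsilon> (\<lambda>i. f (i * h n)) (T * Suc n)"
  have h: "0 < h n" for n by (simp add: h_def)
  have Th: "real (T * Suc n) * h n = T" for n by (simp add: h_def del: of_nat_Suc mult_Suc_right)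
  have ge: "?\<sigma> \<le> ?m n * h n" for n
    by (rule stop_index_ge_first_below[OF h]) (rule eq_refl[OF Th[symmetric]])
  have leT: "?m n * h n \<le> T" for n
  proof -
    have "real (?m n) * h n \<le> real (T * Suc n) * h n"
      using stop_index_le[of \<epsilon> "\<lambda>i. f (i * h n)" "T * Suc n"] h[of n] by (intro mult_right_mono) (auto simp del: of_nat_mult)
    then show ?thesis using Th by simp
  qed
  have "\<exists>no. \<forall>n\<ge>no. ?m n * h n < ?\<sigma> + e"
  proof (cases "?\<sigma> + e \<le> T")
    case False
    then have "?m n * h n < ?\<sigma> + e" for n using leT[of n] by linarith
    then show ?thesis by blast
  next
    case True
    obtain t where t: "0 \<le> t" "t < ?\<sigma> + e" "f t < \<epsilon>"
      using first_below_less[of \<epsilon> f T "?\<sigma> + e"] e True by auto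
    have "(f \<longlongrightarrow> f t) (at t within {0..})" using f t(1) by (auto simp: continuous_on_def)
    then have "\<forall>\<^sub>F u in at t within {0..}. f u < \<epsilon>" using t(3) by (rule order_tendstoD)
    then obtain d where d: "0 < d" "\<And>u. 0 \<le> u \<Longrightarrow> u \<noteq> t \<Longrightarrow> dist u t < d \<Longrightarrow> f u < \<epsilon>"
      by (auto simp: eventually_at)
    define d' where "d' = min d (?\<sigma> + e - t)"
    have d': "0 < d'" using d t by (auto simp: d'_def)
    have "h \<longlonglongrightarrow> 0" unfolding h_def by (intro LIMSEQ_Suc[OF lim_1_over_n])
    then have "\<forall>\<^sub>F n in sequentially. h n < d'" using d' by (rule order_tendstoD)
    then obtain no where no: "\<And>n. no \<le> n \<Longrightarrow> h n < d'" by (auto simp: eventually_sequentially)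
    have "?m n * h n < ?\<sigma> + e" if n: "no \<le> n" for n
    proof -
      \<comment> \<open>The first grid point from t on. It lies within h n of t, where f is still
        below \<epsilon>, so the grid walk has stopped by then.\<close>
      define i where "i = nat \<lceil>t / h n\<rceil>"
      have "real i = real_of_int \<lceil>t / h n\<rceil>" unfolding i_def using t h[of n] by simp
      then have "t / h n \<le> i" "i < t / h n + 1" by linarith+
      then have i: "t \<le> i * h n" "i * h n < t + h n" using h[of n] by (auto simp: field_simps)
      have "f (i * h n) < \<epsilon>"
      proof (cases "i * h n = t")
        case False
        show ?thesis by (rule d(2)) (use i t no[OF n] False in \<open>auto simp: dist_real_def d'_def\<close>)
      qed (use t in simp)
      then have "\<not> alive \<epsilon> (\<lambda>i. f (i * h n)) i" using alive_le by fastforce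
      then have "?m n \<le> i" using less_stop_index_iff[of i \<epsilon> _ "T * Suc n"] by (meson not_le)
      then have "?m n * h n \<le> i * h n" using h[of n] by (intro mult_right_mono) auto
      with i(2) no[OF n] show ?thesis unfolding d'_def by linarith
    qed
    then show ?thesis by blast
  qed
  then show "\<exists>no. \<forall>n\<ge>no. norm (?m n * h n - ?\<sigma>) < e"
    using ge by (auto simp: abs_less_iff) (smt (verit) ge)
qed

section \<open>The time change along a single increasing path\<close>

lemma partition_index:
  fixes a :: "nat \<Rightarrow> 'b :: linorder"
  assumes "a 0 \<le> t"
  shows "t < a m \<Longrightarrow> \<exists>i<m. a i \<le> t \<and> t < a (Suc i)"
proof (induction m)
  case (Suc m)
  then show ?case by (cases "t < a m") (auto simp: less_Suc_eq not_less)
qed (use assms in auto)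

text \<open>The supremum of s may be finite here, and \<open>right_inverse s t\<close> is a genuine
  infimum only below it; hence the witness \<open>v\<close> with \<open>t < s v\<close> in the
  lemmas that follow.\<close>

locale time_change =
  fixes s :: "real \<Rightarrow> real"
  assumes strict_mono: "strict_mono_on {0..} s"
    and right_cont: "\<And>t. 0 \<le> t \<Longrightarrow> continuous (at_right t) s"
    and zero: "s 0 = 0"
begin

lemma s_less: "0 \<le> u \<Longrightarrow> u < v \<Longrightarrow> s u < s v"
  using strict_mono by (auto simp: strict_mono_on_def)

lemma s_le: "0 \<le> u \<Longrightarrow> u \<le> v \<Longrightarrow> s u \<le> s v"
  using s_less[of u v] by (cases "u = v") auto

lemma s_nonneg: "0 \<le> u \<Longrightarrow> 0 \<le> s u"
  using s_le[of 0 u] zero by simp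

lemma right_inverse_bdd: "bdd_below {u. 0 \<le> u \<and> s u > t}"
  by (auto intro!: bdd_belowI[of _ 0])

lemma right_inverse_le: "0 \<le> v \<Longrightarrow> t < s v \<Longrightarrow> right_inverse s t \<le> v"
  unfolding right_inverse_def by (intro cInf_lower right_inverse_bdd) auto

lemma right_inverse_ge:
  assumes "0 \<le> u" "s u \<le> t" "0 \<le> v" "t < s v"
  shows "u \<le> right_inverse s t"
  unfolding right_inverse_def
proof (rule cInf_greatest)
  show "{u. 0 \<le> u \<and> s u > t} \<noteq> {}" using assms by auto
  fix w assume "w \<in> {u. 0 \<le> u \<and> s u > t}"
  then show "u \<le> w" using s_le[of w u] assms by (cases "w \<le> u") auto
qed

lemma right_inverse_nonneg:
  assumes "0 \<le> t" "0 \<le> v" "t < s v"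
  shows "0 \<le> right_inverse s t"
  using right_inverse_ge[of 0 t v] assms zero by simp

text \<open>Monotonicity makes \<open>right_inverse s\<close> Borel on \<open>{0..<c}\<close>. Since
  f is continuous only on the half line, it is first replaced by the function of
  \<open>max u 0\<close>.\<close>

lemma measurable_time_changed:
  fixes f g :: "real \<Rightarrow> real"
  assumes c: "\<And>t. t < c \<Longrightarrow> \<exists>v\<ge>0. t < s v" and f: "continuous_on {0..} f"
    and g [measurable]: "g \<in> borel_measurable borel"
  shows "(\<lambda>t. indicator {0..<c} t * g (f (right_inverse s t))) \<in> borel_measurable borel"
proof -
  have "mono_on {0..<c} (right_inverse s)"
  proof (rule mono_onI)
    fix r t assume rt: "r \<in> {0..<c}" "t \<in> {0..<c}" "r \<le> t"
    obtain v where v: "0 \<le> v" "t < s v" using c[of t] rt by auto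
    show "right_inverse s r \<le> right_inverse s t"
      unfolding right_inverse_def
      by (rule cInf_superset_mono) (use v rt right_inverse_bdd in auto)
  qed
  then have "(\<lambda>t. indicator {0..<c} t *\<^sub>R right_inverse s t) \<in> borel_measurable borel"
    using borel_measurable_mono_on_fnc[of "{0..<c}" "right_inverse s"]
    by (subst (asm) borel_measurable_restrict_space_iff) auto
  then have [measurable]: "(\<lambda>t. indicator {0..<c} t * right_inverse s t) \<in> borel_measurable borel" by simp
  have "continuous_on UNIV (\<lambda>u. f (max u 0))"
    by (rule continuous_on_compose2[OF f]) (auto intro!: continuous_intros)
  then have [measurable]: "(\<lambda>u. f (max u 0)) \<in> borel_measurable borel"
    by (rule borel_measurable_continuous_onI)
  have "(\<lambda>t. indicator {0..<c} t * g (f (right_inverse s t))) =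
      (\<lambda>t. indicator {0..<c} t * g ((\<lambda>u. f (max u 0)) (indicator {0..<c} t * right_inverse s t)))"
  proof
    fix t
    show "indicator {0..<c} t * g (f (right_inverse s t)) =
      indicator {0..<c} t * g ((\<lambda>u. f (max u 0)) (indicator {0..<c} t * right_inverse s t))"
    proof (cases "t \<in> {0..<c}")
      case True
      then have "0 \<le> right_inverse s t" using c[of t] right_inverse_nonneg by auto
      with True show ?thesis by simp
    qed simp
  qed
  then show ?thesis by simp
qed

text \<open>The Stieltjes sum is the Lebesgue integral of the step function \<open>G n\<close>,
  constant on each block from s (i h) to s ((i + 1) h). For t in such a block
  \<open>right_inverse s t\<close> lies between i h and (i + 1) h, so \<open>G n t\<close> tends to
  g (f (right_inverse s t)), and dominated convergence applies.\<close>

lemma grid_sum_tendsto: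
  fixes f g :: "real \<Rightarrow> real" and \<epsilon> :: real and T :: nat and h :: "nat \<Rightarrow> real"
  defines "h \<equiv> \<lambda>n. 1 / real (Suc n)"
  defines "m \<equiv> \<lambda>n. stop_index \<epsilon> (\<lambda>i. f (i * h n)) (T * Suc n)"
  defines "\<sigma> \<equiv> first_below \<epsilon> f T"
  assumes f: "continuous_on {0..} f" and g: "continuous_on UNIV g"
    and gC: "\<And>y. 0 \<le> g y \<and> g y \<le> C"
  shows "(\<lambda>n. \<Sum>i<m n. g (f (i * h n)) * (s (Suc i * h n) - s (i * h n))) \<longlonglongrightarrow>
    (\<integral>t. indicator {0..<s \<sigma>} t * g (f (right_inverse s t)) \<partial>lborel)"
proof -
  have h: "0 < h n" for n by (simp add: h_def)
  have h0: "h \<longlonglongrightarrow> 0" unfolding h_def by (intro LIMSEQ_Suc[OF lim_1_over_n])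
  have Th: "real (T * Suc n) * h n = T" for n by (simp add: h_def del: of_nat_Suc mult_Suc_right)
  have \<sigma>0: "0 \<le> \<sigma>" unfolding \<sigma>_def by (rule first_below_nonneg) simp
  have ge: "\<sigma> \<le> m n * h n" for n
    unfolding m_def \<sigma>_def by (rule stop_index_ge_first_below[OF h]) (rule eq_refl[OF Th[symmetric]])
  have lim: "(\<lambda>n. m n * h n) \<longlonglongrightarrow> \<sigma>"
    unfolding m_def \<sigma>_def h_def by (rule stop_index_tendsto_first_below[OF f])
  have leT: "m n * h n \<le> T" for n
  proof -
    have "real (m n) * h n \<le> real (T * Suc n) * h n"
      unfolding m_def using stop_index_le[of \<epsilon> "\<lambda>i. f (i * h n)" "T * Suc n"] h[of n]
      by (intro mult_right_mono) (auto simp del: of_nat_mult)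
    then show ?thesis using Th by simp
  qed
  have s_grid: "s (i * h n) \<le> s (j * h n)" if "i \<le> j" for i j n :: nat
    using that h[of n] by (intro s_le mult_right_mono) auto
  define G where "G n t = (\<Sum>i<m n. g (f (i * h n)) * indicator {s (i * h n)..<s (Suc i * h n)} t)" for n t
  have G_meas: "G n \<in> borel_measurable lborel" for n
    unfolding G_def by measurable
  have G_int: "(\<integral>t. G n t \<partial>lborel) = (\<Sum>i<m n. g (f (i * h n)) * (s (Suc i * h n) - s (i * h n)))" for n
  proof -
    have le: "s (i * h n) \<le> s (Suc i * h n)" for i by (rule s_grid) simp
    have "(\<integral>t. G n t \<partial>lborel) = (\<Sum>i<m n. \<integral>t. g (f (i * h n)) * indicator {s (i * h n)..<s (Suc i * h n)} t \<partial>lborel)"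
      unfolding G_def by (rule Bochner_Integration.integral_sum) (use le in \<open>simp del: of_nat_Suc\<close>)
    also have "\<dots> = (\<Sum>i<m n. g (f (i * h n)) * (s (Suc i * h n) - s (i * h n)))"
      by (rule sum.cong) (use le in \<open>simp_all del: of_nat_Suc\<close>)
    finally show ?thesis .
  qed
  have single: "\<exists>i<m n. s (i * h n) \<le> t \<and> t < s (Suc i * h n) \<and> G n t = g (f (i * h n))"
    if "0 \<le> t" "t < s (m n * h n)" for t n
  proof -
    obtain i where i: "i < m n" "s (i * h n) \<le> t" "t < s (Suc i * h n)"
      using partition_index[of "\<lambda>i. s (i * h n)" t "m n"] \<open>0 \<le> t\<close> \<open>t < s (m n * h n)\<close> zero by (auto simp del: of_nat_Suc)
    have "indicator {s (j * h n)..<s (Suc j * h n)} t = (0::real)" if "j \<noteq> i" for j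
    proof (cases "j < i")
      case True
      then show ?thesis using s_grid[of "Suc j" i n] i by (auto simp: indicator_def)
    next
      case False
      then show ?thesis using s_grid[of "Suc i" j n] i that by (auto simp: indicator_def)
    qed
    then have "G n t = (\<Sum>j<m n. if j = i then g (f (i * h n)) else 0)"
      unfolding G_def using i by (intro sum.cong) (auto simp: indicator_def)
    then show ?thesis using i by (auto intro!: exI[of _ i])
  qed
  have zeroG: "G n t = 0" if "t < 0 \<or> s (m n * h n) \<le> t" for t n
  proof -
    have "indicator {s (i * h n)..<s (Suc i * h n)} t = (0::real)" if "i < m n" for i
      using s_grid[of "Suc i" "m n" n] s_nonneg[of "i * h n"] h[of n] that \<open>t < 0 \<or> s (m n * h n) \<le> t\<close>
      by (auto simp: indicator_def)
    then show ?thesis unfolding G_def by (intro sum.neutral) auto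
  qed
  have "(\<lambda>n. \<integral>t. G n t \<partial>lborel) \<longlonglongrightarrow> (\<integral>t. indicator {0..<s \<sigma>} t * g (f (right_inverse s t)) \<partial>lborel)"
  proof (rule integral_dominated_convergence)
    show "(\<lambda>t. indicator {0..<s \<sigma>} t * g (f (right_inverse s t))) \<in> borel_measurable lborel"
      using measurable_time_changed[OF _ f borel_measurable_continuous_onI[OF g], of "s \<sigma>"] \<sigma>0 by auto
    show "G n \<in> borel_measurable lborel" for n by (rule G_meas)
    show "integrable lborel (\<lambda>t. C * indicator {0..<s T} t)" using s_nonneg[of T] by simp
    show "AE t in lborel. norm (G n t) \<le> C * indicator {0..<s T} t" for n
    proof (rule AE_I2)
      fix t
      have C: "0 \<le> C" using gC[of 0] by linarith
      have "s (m n * h n) \<le> s T" using leT h[of n] by (intro s_le) auto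
      then show "norm (G n t) \<le> C * indicator {0..<s T} t"
        using single[of t n] zeroG[of t n] gC C by (cases "0 \<le> t \<and> t < s (m n * h n)") (auto simp: indicator_def)
    qed
    \<comment> \<open>At this single point the step functions may keep a nonzero value, because
      \<open>s (m n * h n)\<close> can exceed \<open>s \<sigma>\<close> for every n.\<close>
    have "AE t in lborel. t \<noteq> s \<sigma>" by (rule AE_lborel_singleton)
    then show "AE t in lborel. (\<lambda>n. G n t) \<longlonglongrightarrow> indicator {0..<s \<sigma>} t * g (f (right_inverse s t))"
    proof eventually_elim
      fix t assume t: "t \<noteq> s \<sigma>"
      consider "t < 0" | "s \<sigma> < t" "0 \<le> t" | "0 \<le> t" "t < s \<sigma>" using t by fastforce
      then show "(\<lambda>n. G n t) \<longlonglongrightarrow> indicator {0..<s \<sigma>} t * g (f (right_inverse s t))"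
      proof cases
        case 1
        then show ?thesis using zeroG by simp
      next
        case 2
        \<comment> \<open>The grid stopping times approach \<sigma> from the right, so
          right-continuity of s brings the end of the last block below t.\<close>
        have "(s \<longlongrightarrow> s \<sigma>) (at_right \<sigma>)" using right_cont[OF \<sigma>0] by (simp add: continuous_within)
        then have "\<forall>\<^sub>F u in at_right \<sigma>. s u < t" using 2 by (intro order_tendstoD)
        then obtain b where b: "\<sigma> < b" "\<And>u. \<sigma> < u \<Longrightarrow> u < b \<Longrightarrow> s u < t"
          by (auto simp: eventually_at_right_field)
        have "\<forall>\<^sub>F n in sequentially. m n * h n < b" using lim b(1) by (rule order_tendstoD)
        then have "\<forall>\<^sub>F n in sequentially. G n t = 0"
        proof eventually_elim
          fix n assume "m n * h n < b"
          then have "s (m n * h n) \<le> t"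
            using ge[of n] b(2)[of "m n * h n"] 2 by (cases "m n * h n = \<sigma>") auto
          then show "G n t = 0" using zeroG by simp
        qed
        then show ?thesis using 2 by (simp add: tendsto_eventually)
      next
        case 3
        have tm: "t < s (m n * h n)" for n
          using s_le[OF \<sigma>0 ge[of n]] 3 by simp
        then have "\<forall>n. \<exists>i. s (i * h n) \<le> t \<and> t < s (Suc i * h n) \<and> G n t = g (f (i * h n))"
          using single[OF 3(1)] by blast
        then obtain i where i: "\<And>n. s (real (i n) * h n) \<le> t" "\<And>n. t < s (Suc (i n) * h n)"
          "\<And>n. G n t = g (f (i n * h n))" by metis
        let ?e = "right_inverse s t"
        have e1: "i n * h n \<le> ?e" for n
          using i(1)[of n] h[of n] 3 \<sigma>0 by (intro right_inverse_ge[of _ _ \<sigma>]) auto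
        have e2: "?e \<le> i n * h n + h n" for n
          using right_inverse_le[of "Suc (i n) * h n" t] i(2)[of n] h[of n] by (simp add: algebra_simps)
        have "(\<lambda>n. i n * h n) \<longlonglongrightarrow> ?e"
        proof (rule real_tendsto_sandwich)
          show "(\<lambda>n. ?e - h n) \<longlonglongrightarrow> ?e" using tendsto_diff[OF tendsto_const h0, of ?e] by simp
          show "\<forall>\<^sub>F n in sequentially. ?e - h n \<le> i n * h n"
            using e2 by (auto simp: algebra_simps)
        qed (use e1 in auto)
        then have "(\<lambda>n. f (i n * h n)) \<longlonglongrightarrow> f ?e"
          by (rule continuous_on_tendsto_compose[OF f])
             (use right_inverse_nonneg[of t \<sigma>] 3 \<sigma>0 h[THEN less_imp_le] in auto)
        then have "(\<lambda>n. g (f (i n * h n))) \<longlonglongrightarrow> g (f ?e)"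
          by (rule continuous_on_tendsto_compose[OF g]) auto
        then show ?thesis using 3 by (simp add: i(3))
      qed
    qed
  qed
  then show ?thesis unfolding G_int .
qed

lemma stopped_weight_tendsto:
  fixes f g \<psi> :: "real \<Rightarrow> real" and \<epsilon> :: real and T :: nat and h :: "nat \<Rightarrow> real"
  defines "h \<equiv> \<lambda>n. 1 / real (Suc n)"
  defines "\<sigma> \<equiv> first_below \<epsilon> f T"
  assumes f: "continuous_on {0..} f" and g: "continuous_on UNIV g" and \<psi>: "continuous_on UNIV \<psi>"
    and gC: "\<And>y. 0 \<le> g y \<and> g y \<le> C"
  shows "(\<lambda>n. stopped_weight \<epsilon> \<psi> (\<lambda>i. f (i * h n))
        (\<lambda>i. exp (- g (f (i * h n)) * (s (Suc i * h n) - s (i * h n)))) (T * Suc n)) \<longlonglongrightarrow>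
      exp (- (\<integral>t. indicator {0..<s \<sigma>} t * g (f (right_inverse s t)) \<partial>lborel)) * \<psi> (f \<sigma>)"
proof -
  define m where "m = (\<lambda>n. stop_index \<epsilon> (\<lambda>i. f (i * h n)) (T * Suc n))"
  have h: "0 < h n" for n by (simp add: h_def)
  have lim: "(\<lambda>n. m n * h n) \<longlonglongrightarrow> \<sigma>"
    unfolding m_def \<sigma>_def h_def by (rule stop_index_tendsto_first_below[OF f])
  have "(\<lambda>n. f (m n * h n)) \<longlonglongrightarrow> f \<sigma>"
    by (rule continuous_on_tendsto_compose[OF f lim])
       (use h[THEN less_imp_le] first_below_nonneg[of T] in \<open>auto simp: \<sigma>_def\<close>)
  then have l1: "(\<lambda>n. \<psi> (f (m n * h n))) \<longlonglongrightarrow> \<psi> (f \<sigma>)"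
    by (rule continuous_on_tendsto_compose[OF \<psi>]) auto
  have l2: "(\<lambda>n. exp (- (\<Sum>i<m n. g (f (i * h n)) * (s (Suc i * h n) - s (i * h n))))) \<longlonglongrightarrow>
     exp (- (\<integral>t. indicator {0..<s \<sigma>} t * g (f (right_inverse s t)) \<partial>lborel))"
    unfolding m_def \<sigma>_def h_def by (intro tendsto_intros grid_sum_tendsto[OF f g gC])
  have "stopped_weight \<epsilon> \<psi> (\<lambda>i. f (i * h n))
        (\<lambda>i. exp (- g (f (i * h n)) * (s (Suc i * h n) - s (i * h n)))) (T * Suc n) =
      exp (- (\<Sum>i<m n. g (f (i * h n)) * (s (Suc i * h n) - s (i * h n)))) * \<psi> (f (m n * h n))" for n
  proof -
    define y where "y = (\<lambda>i::nat. f (i * h n))"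
    define c where "c i = exp (- g (y i) * (s (Suc i * h n) - s (i * h n)))" for i :: nat
    have "(\<Prod>i<T * Suc n. if alive \<epsilon> y i then c i else 1) = prod c {i \<in> {..<T * Suc n}. alive \<epsilon> y i}"
      by (rule prod.inter_filter[symmetric]) simp
    also have "{i \<in> {..<T * Suc n}. alive \<epsilon> y i} = {..<stop_index \<epsilon> y (T * Suc n)}"
      by (auto simp only: less_stop_index_iff lessThan_iff mem_Collect_eq)
    also have "prod c \<dots> = exp (- (\<Sum>i<stop_index \<epsilon> y (T * Suc n). g (y i) * (s (Suc i * h n) - s (i * h n))))"
      by (simp add: c_def exp_sum sum_negf[symmetric])
    finally show ?thesis by (simp only: stopped_weight_def m_def c_def y_def)
  qed
  then show ?thesis using tendsto_mult[OF l2 l1] by simp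
qed

text \<open>By monotonicity c is the left limit of s at \<tau>. Strict increase keeps s below c
  before \<tau>, and c \<le> s \<tau> < s v for v > \<tau> shows that the inverse reaches \<tau>
  exactly at time c, whether or not s jumps there.\<close>

lemma Sup_before:
  assumes \<tau>: "0 < \<tau>"
  defines "c \<equiv> Sup (s ` {0..<\<tau>})"
  shows "\<And>u. 0 \<le> u \<Longrightarrow> u < \<tau> \<Longrightarrow> s u < c"
    and "\<And>t. t < c \<Longrightarrow> \<exists>u. 0 \<le> u \<and> u < \<tau> \<and> t < s u"
    and "\<And>t. 0 \<le> t \<Longrightarrow> t < c \<Longrightarrow> 0 \<le> right_inverse s t \<and> right_inverse s t < \<tau>"
    and "right_inverse s c = \<tau>" and "0 < c"
proof -
  have bdd: "bdd_above (s ` {0..<\<tau>})"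
    by (rule bdd_aboveI[of _ "s \<tau>"]) (auto intro!: s_le)
  have ne: "s ` {0..<\<tau>} \<noteq> {}" using \<tau> by auto
  show 1: "s u < c" if "0 \<le> u" "u < \<tau>" for u
  proof -
    have "s u < s ((u + \<tau>) / 2)" using that by (intro s_less) auto
    also have "s ((u + \<tau>) / 2) \<le> c" unfolding c_def by (intro cSup_upper bdd imageI) (use that in auto)
    finally show ?thesis .
  qed
  show "0 < c" using 1[of 0] \<tau> zero by simp
  show 2: "\<exists>u. 0 \<le> u \<and> u < \<tau> \<and> t < s u" if "t < c" for t
    using that unfolding c_def less_cSup_iff[OF ne bdd] by auto
  show "0 \<le> right_inverse s t \<and> right_inverse s t < \<tau>" if "0 \<le> t" "t < c" for t
  proof -
    obtain u where "0 \<le> u" "u < \<tau>" "t < s u" using 2[OF \<open>t < c\<close>] by auto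
    then show ?thesis using right_inverse_le[of u t] right_inverse_nonneg[of t u] that by auto
  qed
  have c_le: "c \<le> s \<tau>" unfolding c_def by (rule cSup_least[OF ne]) (auto intro!: s_le)
  show "right_inverse s c = \<tau>"
  proof (rule antisym)
    show "right_inverse s c \<le> \<tau>"
    proof (rule dense_ge)
      fix v assume "\<tau> < v"
      then have "s \<tau> < s v" using \<tau> by (intro s_less) auto
      then show "right_inverse s c \<le> v" using c_le \<open>\<tau> < v\<close> \<tau> by (intro right_inverse_le) auto
    qed
    show "\<tau> \<le> right_inverse s c"
    proof (rule dense_le_bounded[OF \<tau>])
      fix u assume u: "0 < u" "u < \<tau>"
      have "s \<tau> < s (\<tau> + 1)" using \<tau> by (intro s_less) auto
      then show "u \<le> right_inverse s c"
        using 1[of u] u c_le \<tau> by (intro right_inverse_ge[of u c "\<tau> + 1"]) auto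
    qed
  qed
qed

text \<open>Before the left limit the inverse stays in [0, \<tau>), where f is positive; at the left
  limit it equals \<tau>. If s jumps at \<tau>, the inverse thus arrives before time s
  \<tau>.\<close>

lemma hitting_time_time_changed:
  fixes f :: "real \<Rightarrow> real"
  assumes \<tau>: "0 < \<tau>" "f \<tau> = 0" and pos: "\<And>t. 0 \<le> t \<Longrightarrow> t < \<tau> \<Longrightarrow> 0 < f t"
  shows "Inf {ereal t | t. 0 \<le> t \<and> f (right_inverse s t) = 0} = ereal (Sup (s ` {0..<\<tau>}))"
proof (rule antisym)
  note sb = Sup_before[OF \<tau>(1)]
  show "Inf {ereal t | t. 0 \<le> t \<and> f (right_inverse s t) = 0} \<le> ereal (Sup (s ` {0..<\<tau>}))"
    by (rule Inf_lower) (use sb(4,5) \<tau> in auto)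
  show "ereal (Sup (s ` {0..<\<tau>})) \<le> Inf {ereal t | t. 0 \<le> t \<and> f (right_inverse s t) = 0}"
  proof (rule Inf_greatest)
    fix z assume "z \<in> {ereal t | t. 0 \<le> t \<and> f (right_inverse s t) = 0}"
    then obtain t where t: "z = ereal t" "0 \<le> t" "f (right_inverse s t) = 0" by auto
    have "\<not> t < Sup (s ` {0..<\<tau>})" using sb(3)[of t] pos[of "right_inverse s t"] t by auto
    then show "ereal (Sup (s ` {0..<\<tau>})) \<le> z" using t by simp
  qed
qed

text \<open>By continuity f drops below \<open>1 / real (Suc n)\<close> strictly before \<tau>, so s
  (\<sigma> n) stays below the left limit and tends to it; a jump of s at \<tau> is never counted.
  Barrier and horizon move together, and \<psi> (f (\<sigma> n)) tends to \<psi> 0 = 1.\<close>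

lemma stopped_integral_tendsto:
  fixes f g \<psi> :: "real \<Rightarrow> real"
  defines "\<sigma> \<equiv> \<lambda>n. first_below (1 / real (Suc n)) f (real n)"
  assumes \<tau>: "0 < \<tau>" "f \<tau> = 0" and pos: "\<And>t. 0 \<le> t \<Longrightarrow> t < \<tau> \<Longrightarrow> 0 < f t"
    and f: "continuous_on {0..} f" and g: "g \<in> borel_measurable borel" and \<psi>: "continuous_on UNIV \<psi>" "\<psi> 0 = 1"
    and gC: "\<And>y. 0 \<le> g y \<and> g y \<le> C"
  shows "(\<lambda>n. exp (- (\<integral>t. indicator {0..<s (\<sigma> n)} t * g (f (right_inverse s t)) \<partial>lborel)) * \<psi> (f (\<sigma> n))) \<longlonglongrightarrow>
    exp (- (\<integral>t. indicator {0..<Sup (s ` {0..<\<tau>})} t * g (f (right_inverse s t)) \<partial>lborel))"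
proof -
  note sb = Sup_before[OF \<tau>(1)]
  have \<sigma>0: "0 \<le> \<sigma> n" for n unfolding \<sigma>_def by (rule first_below_nonneg) simp
  have \<sigma>\<tau>: "\<sigma> n < \<tau>" for n
  proof -
    have "(f \<longlongrightarrow> f \<tau>) (at \<tau> within {0..})" using f \<tau>(1) by (auto simp: continuous_on_def)
    then have "\<forall>\<^sub>F u in at \<tau> within {0..}. f u < 1 / real (Suc n)" using \<tau> by (intro order_tendstoD) auto
    then obtain d where d: "0 < d" "\<And>u. 0 \<le> u \<Longrightarrow> u \<noteq> \<tau> \<Longrightarrow> dist u \<tau> < d \<Longrightarrow> f u < 1 / real (Suc n)"
      by (auto simp: eventually_at)
    define u where "u = max 0 (\<tau> - d / 2)"
    have u: "0 \<le> u" "u < \<tau>" "dist u \<tau> < d" using d \<tau> by (auto simp: u_def dist_real_def)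
    then have "\<sigma> n \<le> u" unfolding \<sigma>_def using d(2)[of u] by (intro first_below_lower) auto
    with u show ?thesis by simp
  qed
  have ev: "\<forall>\<^sub>F n in sequentially. v < \<sigma> n" if v: "0 \<le> v" "v < \<tau>" for v
  proof -
    define w where "w = (v + \<tau>) / 2"
    have w: "v < w" "w < \<tau>" "0 \<le> w" using v by (auto simp: w_def)
    \<comment> \<open>On [0, w] the path has a positive minimum, so a barrier below this minimum is
      not crossed before w.\<close>
    have "continuous_on {0..w} f" by (rule continuous_on_subset[OF f]) auto
    then obtain t0 where t0: "t0 \<in> {0..w}" "\<And>t. t \<in> {0..w} \<Longrightarrow> f t0 \<le> f t"
      using continuous_attains_inf[of "{0..w}" f] w by auto
    have ft0: "0 < f t0" using pos[of t0] t0 w by auto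
    have "\<forall>\<^sub>F n in sequentially. 1 / real (Suc n) < f t0"
      using LIMSEQ_Suc[OF lim_1_over_n] ft0 by (rule order_tendstoD)
    moreover have "\<forall>\<^sub>F n in sequentially. w < real n"
      using filterlim_real_sequentially by (simp add: filterlim_at_top_dense)
    ultimately show ?thesis
    proof eventually_elim
      case (elim n)
      have "w \<le> \<sigma> n" unfolding \<sigma>_def
      proof (rule first_below_greatest)
        fix t assume t: "0 \<le> t" "t \<le> real n" "f t < 1 / real (Suc n)"
        then show "w \<le> t" using t0(2)[of t] elim by (cases "w \<le> t") auto
      qed (use elim in auto)
      with w show ?case by simp
    qed
  qed
  have \<sigma>lim: "\<sigma> \<longlonglongrightarrow> \<tau>"
  proof (rule order_tendstoI)
    fix v assume "v < \<tau>"
    with ev[of "max v 0"] \<tau> show "\<forall>\<^sub>F n in sequentially. v < \<sigma> n"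
      by (auto elim: eventually_mono)
  qed (use \<sigma>\<tau> in \<open>auto intro!: always_eventually intro: less_trans\<close>)
  have "(\<lambda>n. f (\<sigma> n)) \<longlonglongrightarrow> f \<tau>"
    by (rule continuous_on_tendsto_compose[OF f \<sigma>lim]) (use \<tau> \<sigma>0 in auto)
  then have "(\<lambda>n. \<psi> (f (\<sigma> n))) \<longlonglongrightarrow> \<psi> (f \<tau>)"
    by (rule continuous_on_tendsto_compose[OF \<psi>(1)]) auto
  then have l1: "(\<lambda>n. \<psi> (f (\<sigma> n))) \<longlonglongrightarrow> 1" using \<tau> \<psi> by simp
  let ?c = "Sup (s ` {0..<\<tau>})"
  have meas: "(\<lambda>t. indicator {0..<b} t * g (f (right_inverse s t))) \<in> borel_measurable lborel" if "b \<le> ?c" for b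
    using measurable_time_changed[OF _ f g, of b] sb(2) that by force
  have l2: "(\<lambda>n. \<integral>t. indicator {0..<s (\<sigma> n)} t * g (f (right_inverse s t)) \<partial>lborel) \<longlonglongrightarrow>
      (\<integral>t. indicator {0..<?c} t * g (f (right_inverse s t)) \<partial>lborel)"
  proof (rule integral_dominated_convergence)
    show "integrable lborel (\<lambda>t. C * indicator {0..<?c} t)" using sb(5) by simp
    have C: "0 \<le> C" using gC[of 0] by linarith
    show "AE t in lborel. norm (indicator {0..<s (\<sigma> n)} t * g (f (right_inverse s t))) \<le> C * indicator {0..<?c} t" for n
      using sb(1)[OF \<sigma>0 \<sigma>\<tau>, of n] gC C by (intro AE_I2) (auto simp: indicator_def)
    show "AE t in lborel. (\<lambda>n. indicator {0..<s (\<sigma> n)} t * g (f (right_inverse s t))) \<longlonglongrightarrow>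
        indicator {0..<?c} t * g (f (right_inverse s t))"
    proof (rule AE_I2)
      fix t
      have "\<forall>\<^sub>F n in sequentially. indicator {0..<s (\<sigma> n)} t = (indicator {0..<?c} t :: real)"
      proof (cases "0 \<le> t \<and> t < ?c")
        case True
        then obtain u where u: "0 \<le> u" "u < \<tau>" "t < s u" using sb(2)[of t] by auto
        from ev[OF u(1,2)] show ?thesis
          by eventually_elim (use u True s_less[of u] in \<open>force simp: indicator_def\<close>)
      next
        case False
        then show ?thesis using sb(1)[OF \<sigma>0 \<sigma>\<tau>] by (auto simp: indicator_def intro!: always_eventually dest: less_trans)
      qed
      then have "\<forall>\<^sub>F n in sequentially. indicator {0..<s (\<sigma> n)} t * g (f (right_inverse s t)) =
          indicator {0..<?c} t * g (f (right_inverse s t))"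
        by eventually_elim simp
      then show "(\<lambda>n. indicator {0..<s (\<sigma> n)} t * g (f (right_inverse s t))) \<longlonglongrightarrow>
        indicator {0..<?c} t * g (f (right_inverse s t))" by (rule tendsto_eventually)
    qed
  qed (use meas sb(1)[OF \<sigma>0 \<sigma>\<tau>] in \<open>auto simp: less_imp_le\<close>)
  show ?thesis
    using tendsto_mult[OF tendsto_exp[OF tendsto_minus[OF l2]] l1] by simp
qed

end

text \<open>The zero set is closed, so its infimum is a zero; by the intermediate value theorem a
  nonpositive value before it would force an earlier zero.\<close>

lemma first_zero:
  fixes f :: "real \<Rightarrow> real"
  assumes f: "continuous_on {0..} f" and pos: "0 < f 0" and "0 \<le> v" "f v \<le> 0"
  obtains \<tau> where "0 < \<tau>" "f \<tau> = 0" "\<And>t. 0 \<le> t \<Longrightarrow> t < \<tau> \<Longrightarrow> 0 < f t"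
proof -
  let ?A = "{0..} \<inter> f -` {0}"
  have ivt: "\<exists>t. 0 \<le> t \<and> t \<le> w \<and> f t = 0" if "0 \<le> w" "f w \<le> 0" for w
    using IVT2'[of f w 0 0] that pos continuous_on_subset[OF f, of "{0..w}"] by auto
  have cl: "closed ?A" by (rule continuous_closed_preimage[OF f]) auto
  have ne: "?A \<noteq> {}" using ivt[of v] assms by auto
  have bdd: "bdd_below ?A" by (rule bdd_belowI[of _ 0]) auto
  define \<tau> where "\<tau> = Inf ?A"
  have \<tau>: "\<tau> \<in> ?A" unfolding \<tau>_def by (rule closed_contains_Inf[OF ne bdd cl])
  show thesis
  proof (rule that)
    show "f \<tau> = 0" "0 < \<tau>" using \<tau> pos by (auto simp: le_less)
    show "0 < f t" if "0 \<le> t" "t < \<tau>" for t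
    proof (rule ccontr)
      assume "\<not> 0 < f t"
      with ivt[of t] \<open>0 \<le> t\<close> obtain r where "0 \<le> r" "r \<le> t" "f r = 0" by auto
      then have "\<tau> \<le> r" unfolding \<tau>_def by (intro cInf_lower bdd) auto
      with \<open>r \<le> t\<close> that show False by simp
    qed
  qed
qed

section \<open>The Riccati equation\<close>

text \<open>The equation sees k only on \<open>{0..a}\<close>, so g may later be replaced by its
  extension by 0 to the negative half line.\<close>

lemma nonneg_riccati_solution_cong:
  assumes "\<And>s. 0 \<le> s \<Longrightarrow> k s = k' s"
  shows "nonneg_riccati_solution \<alpha> a k u \<longleftrightarrow> nonneg_riccati_solution \<alpha> a k' u"
proof -
  have "(LBINT s:{r..a}. k s) = (LBINT s:{r..a}. k' s)" if "r \<in> {0..a}" for r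
    using assms that by (intro set_lebesgue_integral_cong) auto
  then show ?thesis unfolding nonneg_riccati_solution_def by auto
qed

section \<open>A priori properties of Riccati solutions\<close>

lemma integral_Icc_nonneg:
  fixes f :: "real \<Rightarrow> real"
  assumes "\<And>s. s \<in> {r..a} \<Longrightarrow> 0 \<le> f s"
  shows "0 \<le> integral {r..a} f"
  \<comment> \<open>The integral of a non-integrable function is 0 by default, which settles the
    second case.\<close>
  using assms by (cases "f integrable_on {r..a}") (auto intro: integral_nonneg simp: not_integrable_integral)

lemma bounded_measurable_integrable_on:
  fixes k :: "real \<Rightarrow> real"
  assumes [measurable]: "k \<in> borel_measurable borel" and k: "\<And>y. 0 \<le> k y \<and> k y \<le> K"
  shows "set_integrable lborel {r..a} k" "k integrable_on {r..a}"
    "(LBINT s:{r..a}. k s) = integral {r..a} k"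
proof -
  show 1: "set_integrable lborel {r..a} k"
    unfolding set_integrable_def
  proof (rule Bochner_Integration.integrable_bound)
    show "integrable lborel (\<lambda>x. K * indicator {r..a} x)"
      by (intro integrable_mult_right integrable_real_indicator) (auto simp: emeasure_lborel_Icc_eq)
    show "AE x in lborel. norm (indicator {r..a} x *\<^sub>R k x) \<le> norm (K * indicator {r..a} x)"
      using k k[THEN conjunct1, THEN order_trans, OF k[THEN conjunct2]]
      by (intro AE_I2) (simp add: indicator_def abs_of_nonneg)
  qed measurable
  show "k integrable_on {r..a}" "(LBINT s:{r..a}. k s) = integral {r..a} k"
    using set_borel_integral_eq_integral[OF 1] by auto
qed

text \<open>Moves the equation from the Lebesgue to the Henstock-Kurzweil integral, for which the
  rules on splitting and differentiating indefinite integrals are at hand.\<close>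

lemma riccati_solution_HK:
  assumes sol: "nonneg_riccati_solution \<alpha> a k u" and r: "0 \<le> r" "r \<le> a"
    and k: "k \<in> borel_measurable borel" "\<And>y. 0 \<le> k y \<and> k y \<le> K"
  shows "(\<lambda>s. (u s)\<^sup>2 + \<alpha> * u s) integrable_on {r..a}"
    "u r + 2 * integral {r..a} (\<lambda>s. (u s)\<^sup>2 + \<alpha> * u s) = integral {r..a} k"
proof -
  have "r \<in> {0..a}" using r by simp
  then have *: "set_integrable lborel {r..a} (\<lambda>s. (u s)\<^sup>2 + \<alpha> * u s)"
      "u r + 2 * (LBINT s:{r..a}. (u s)\<^sup>2 + \<alpha> * u s) = (LBINT s:{r..a}. k s)"
    using sol unfolding nonneg_riccati_solution_def by blast+
  show "(\<lambda>s. (u s)\<^sup>2 + \<alpha> * u s) integrable_on {r..a}"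
      "u r + 2 * integral {r..a} (\<lambda>s. (u s)\<^sup>2 + \<alpha> * u s) = integral {r..a} k"
    using *(2) unfolding set_borel_integral_eq_integral(2)[OF *(1)] bounded_measurable_integrable_on(3)[OF k]
    using set_borel_integral_eq_integral(1)[OF *(1)] by auto
qed

text \<open>Continuity is not part of the notion of solution: it follows because the equation
  exhibits u as a difference of indefinite integrals. Dropping the nonnegative integral on the left
  gives the upper bound.\<close>

lemma riccati_solution_bounds:
  assumes sol: "nonneg_riccati_solution \<alpha> a k u" and a: "0 \<le> a" and \<alpha>: "0 \<le> \<alpha>"
    and k: "k \<in> borel_measurable borel" "\<And>y. 0 \<le> k y \<and> k y \<le> K"
  shows "continuous_on {0..a} u" "\<And>r. 0 \<le> r \<Longrightarrow> 0 \<le> u r"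
    and "\<And>r. 0 \<le> r \<Longrightarrow> u r \<le> integral {0..a} k" "integral {0..a} k \<le> K * a"
proof -
  note HK = riccati_solution_HK[OF sol _ _ k]
  show u0: "0 \<le> u r" if "0 \<le> r" for r using sol that by (simp add: nonneg_riccati_solution_def)
  have "continuous_on {0..a} (\<lambda>r. integral {r..a} k - 2 * integral {r..a} (\<lambda>s. (u s)\<^sup>2 + \<alpha> * u s))"
    using HK(1)[of 0] a bounded_measurable_integrable_on(2)[OF k]
    by (intro continuous_intros indefinite_integral_continuous_1') auto
  then show "continuous_on {0..a} u"
    by (rule continuous_on_eq) (use HK(2) in \<open>auto simp: algebra_simps\<close>)
  have "integral {0..a} k \<le> integral {0..a} (\<lambda>_. K)"
    by (rule integral_le) (use bounded_measurable_integrable_on(2)[OF k] k in auto)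
  then show "integral {0..a} k \<le> K * a" using a by (simp add: mult.commute)
  have K0: "0 \<le> integral {0..a} k" by (rule integral_Icc_nonneg) (use k in auto)
  show "u r \<le> integral {0..a} k" if "0 \<le> r" for r
  proof (cases "r \<le> a")
    case True
    have "0 \<le> integral {r..a} (\<lambda>s. (u s)\<^sup>2 + \<alpha> * u s)"
      by (rule integral_Icc_nonneg) (use u0 \<alpha> that in auto)
    moreover have "integral {r..a} k \<le> integral {0..a} k"
      by (rule integral_subset_le) (use that k bounded_measurable_integrable_on(2)[OF k] in auto)
    ultimately show ?thesis using HK(2)[OF that True] by linarith
  next
    case False
    then show ?thesis using sol K0 by (simp add: nonneg_riccati_solution_def)
  qed
qed

section \<open>Stability and uniqueness\<close>

lemma abs_integral_le:
  fixes f g :: "real \<Rightarrow> real"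
  assumes "f integrable_on S" "g integrable_on S" "\<And>x. x \<in> S \<Longrightarrow> \<bar>f x\<bar> \<le> g x"
  shows "\<bar>integral S f\<bar> \<le> integral S g"
  using integral_norm_bound_integral[of f S g] assms by simp

lemma integral_tail_deriv:
  fixes f :: "real \<Rightarrow> real"
  assumes f: "continuous_on {0..a} f" and r: "0 < r" "r < a"
  shows "((\<lambda>r. integral {r..a} f) has_real_derivative - f r) (at r)"
proof -
  have int: "f integrable_on {0..a}" using f by (rule integrable_continuous_real)
  have "((\<lambda>x. integral {0..x} f) has_real_derivative f r) (at r within {0..a})"
    using f by (rule integral_has_real_derivative) (use r in auto)
  then have "((\<lambda>x. integral {0..x} f) has_real_derivative f r) (at r)"
    using r by (simp add: at_within_Icc_at)
  then have d: "((\<lambda>x. integral {0..a} f - integral {0..x} f) has_real_derivative - f r) (at r)"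
    by (auto intro!: derivative_eq_intros)
  have "eventually (\<lambda>x. x \<in> {0<..<a}) (nhds r)" by (rule eventually_nhds_in_open) (use r in auto)
  then have "eventually (\<lambda>x. integral {0..a} f - integral {0..x} f = integral {x..a} f) (nhds r)"
  proof eventually_elim
    fix x assume "x \<in> {0<..<a}"
    then have "integral {0..x} f + integral {x..a} f = integral {0..a} f"
      by (intro Henstock_Kurzweil_Integration.integral_combine int) auto
    then show "integral {0..a} f - integral {0..x} f = integral {x..a} f" by simp
  qed
  then have "((\<lambda>x. integral {0..a} f - integral {0..x} f) has_real_derivative - f r) (at r) \<longleftrightarrow> ?thesis"
    by (intro DERIV_cong_ev refl)
  with d show ?thesis by blast
qed

text \<open>With I r = c + L * integral {r..a} d, the function I r * exp (L r) has derivative L exp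
  (L r) (I r - d r) \<ge> 0; its values at r and at a, where I a = c, are compared.\<close>

lemma backward_Gronwall:
  fixes d :: "real \<Rightarrow> real"
  assumes d: "continuous_on {0..a} d" and L: "0 \<le> L"
    and le: "\<And>r. 0 \<le> r \<Longrightarrow> r \<le> a \<Longrightarrow> d r \<le> c + L * integral {r..a} d"
    and r: "0 \<le> r" "r \<le> a"
  shows "d r \<le> c * exp (L * (a - r))"
proof -
  let ?I = "\<lambda>r. c + L * integral {r..a} d"
  have cI: "continuous_on {0..a} (\<lambda>r. integral {r..a} d)"
    using integrable_continuous_real[OF d] by (rule indefinite_integral_continuous_1')
  have "?I r * exp (L * r) \<le> ?I a * exp (L * a)"
  proof (rule DERIV_nonneg_imp_increasing_open[OF r(2)])
    fix x assume x: "r < x" "x < a"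
    have D: "((\<lambda>r. integral {r..a} d) has_real_derivative - d x) (at x)"
      by (rule integral_tail_deriv[OF d]) (use x r in auto)
    have "((\<lambda>r. ?I r * exp (L * r)) has_real_derivative L * exp (L * x) * (?I x - d x)) (at x)"
      by (auto intro!: derivative_eq_intros D simp: algebra_simps)
    moreover have "0 \<le> L * exp (L * x) * (?I x - d x)" using le[of x] x r L by simp
    ultimately show "\<exists>y. ((\<lambda>r. ?I r * exp (L * r)) has_real_derivative y) (at x) \<and> 0 \<le> y" by blast
  next
    show "continuous_on {r..a} (\<lambda>r. ?I r * exp (L * r))"
      using continuous_on_subset[OF cI, of "{r..a}"] r by (intro continuous_intros) auto
  qed
  then have "?I r * exp (L * r) \<le> c * exp (L * a)" by simp
  moreover have "exp (L * a) = exp (L * (a - r)) * exp (L * r)" by (simp add: exp_add[symmetric] algebra_simps)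
  ultimately have "?I r \<le> c * exp (L * (a - r))" by simp
  with le[OF r] show ?thesis by linarith
qed

text \<open>The nonlinear terms differ by (u1 + u2 + \<alpha>) (u1 - u2), and both solutions lie in
  [0, K a], so Gronwall applies. The distance of k1 and k2 is measured in L1, so that almost
  everywhere approximation of g suffices later.\<close>

lemma riccati_stability:
  assumes sol1: "nonneg_riccati_solution \<alpha> a k1 u1" and sol2: "nonneg_riccati_solution \<alpha> a k2 u2"
    and a: "0 \<le> a" and \<alpha>: "0 \<le> \<alpha>"
    and k1: "k1 \<in> borel_measurable borel" "\<And>y. 0 \<le> k1 y \<and> k1 y \<le> K"
    and k2: "k2 \<in> borel_measurable borel" "\<And>y. 0 \<le> k2 y \<and> k2 y \<le> K"
    and r: "0 \<le> r" "r \<le> a"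
  shows "\<bar>u1 r - u2 r\<bar> \<le> integral {0..a} (\<lambda>s. \<bar>k1 s - k2 s\<bar>) * exp (2 * (2 * (K * a) + \<alpha>) * a)"
proof -
  note b1 = riccati_solution_bounds[OF sol1 a \<alpha> k1] and b2 = riccati_solution_bounds[OF sol2 a \<alpha> k2]
  note h1 = riccati_solution_HK[OF sol1 _ _ k1] and h2 = riccati_solution_HK[OF sol2 _ _ k2]
  let ?q1 = "\<lambda>s. (u1 s)\<^sup>2 + \<alpha> * u1 s" and ?q2 = "\<lambda>s. (u2 s)\<^sup>2 + \<alpha> * u2 s"
  let ?d = "\<lambda>s. \<bar>u1 s - u2 s\<bar>" and ?k = "\<lambda>s. \<bar>k1 s - k2 s\<bar>"
  define L where "L = 2 * (2 * (K * a) + \<alpha>)"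
  have K: "0 \<le> K" using k1(2)[of 0] by linarith
  have L: "0 \<le> L" using K a \<alpha> by (simp add: L_def)
  have cd: "continuous_on {0..a} ?d" using b1(1) b2(1) by (intro continuous_intros)
  have kb: "(\<lambda>s. ?k s) \<in> borel_measurable borel" "\<And>y. 0 \<le> ?k y \<and> ?k y \<le> K"
  proof -
    show "(\<lambda>s. ?k s) \<in> borel_measurable borel" using k1(1) k2(1) by measurable
    show "0 \<le> ?k y \<and> ?k y \<le> K" for y using k1(2)[of y] k2(2)[of y] by auto
  qed
  note ki = bounded_measurable_integrable_on(2)[OF kb]
  have "?d r \<le> integral {0..a} ?k * exp (L * (a - r))"
  proof (rule backward_Gronwall[OF cd L _ r])
    fix r assume r: "0 \<le> r" "r \<le> a"
    have di: "?d integrable_on {r..a}"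
      by (rule integrable_continuous_real[OF continuous_on_subset[OF cd]]) (use r in auto)
    have "u1 r - u2 r = (integral {r..a} k1 - integral {r..a} k2) - 2 * (integral {r..a} ?q1 - integral {r..a} ?q2)"
      using h1(2)[OF r] h2(2)[OF r] by simp
    also have "integral {r..a} k1 - integral {r..a} k2 = integral {r..a} (\<lambda>s. k1 s - k2 s)"
      by (rule Henstock_Kurzweil_Integration.integral_diff[symmetric])
         (use bounded_measurable_integrable_on(2)[OF k1] bounded_measurable_integrable_on(2)[OF k2] in auto)
    also have "integral {r..a} ?q1 - integral {r..a} ?q2 = integral {r..a} (\<lambda>s. ?q1 s - ?q2 s)"
      by (rule Henstock_Kurzweil_Integration.integral_diff[symmetric]) (use h1(1)[OF r] h2(1)[OF r] in auto)
    finally have e: "u1 r - u2 r = integral {r..a} (\<lambda>s. k1 s - k2 s) - 2 * integral {r..a} (\<lambda>s. ?q1 s - ?q2 s)" .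
    have i1: "\<bar>integral {r..a} (\<lambda>s. k1 s - k2 s)\<bar> \<le> integral {r..a} ?k"
    proof (rule abs_integral_le)
      show "(\<lambda>s. k1 s - k2 s) integrable_on {r..a}"
        using bounded_measurable_integrable_on(2)[OF k1] bounded_measurable_integrable_on(2)[OF k2]
        by (intro integrable_diff) auto
    qed (use ki in auto)
    have i2: "\<bar>integral {r..a} (\<lambda>s. ?q1 s - ?q2 s)\<bar> \<le> integral {r..a} (\<lambda>s. L / 2 * ?d s)"
    proof (rule abs_integral_le)
      show "(\<lambda>s. ?q1 s - ?q2 s) integrable_on {r..a}" using h1(1)[OF r] h2(1)[OF r] by (intro integrable_diff)
      show "(\<lambda>s. L / 2 * ?d s) integrable_on {r..a}" using di by (rule integrable_on_mult_right)
      fix s assume s: "s \<in> {r..a}"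
      have "?q1 s - ?q2 s = (u1 s + u2 s + \<alpha>) * (u1 s - u2 s)" by (simp add: power2_eq_square algebra_simps)
      then have "\<bar>?q1 s - ?q2 s\<bar> = \<bar>u1 s + u2 s + \<alpha>\<bar> * ?d s" by (simp add: abs_mult)
      also have "\<dots> \<le> L / 2 * ?d s"
        using b1(2,3)[of s] b1(4) b2(2,3)[of s] b2(4) s r \<alpha> by (intro mult_right_mono) (auto simp: L_def)
      finally show "\<bar>?q1 s - ?q2 s\<bar> \<le> L / 2 * ?d s" .
    qed
    have "integral {r..a} (\<lambda>s. L / 2 * ?d s) = L / 2 * integral {r..a} ?d" by simp
    moreover have "integral {r..a} ?k \<le> integral {0..a} ?k"
      by (rule integral_subset_le) (use r ki in auto)
    ultimately show "?d r \<le> integral {0..a} ?k + L * integral {r..a} ?d"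
      using i1 i2 unfolding e by linarith
  qed
  also have "\<dots> \<le> integral {0..a} ?k * exp (L * a)"
    using L r by (intro mult_left_mono integral_Icc_nonneg) (auto intro!: mult_left_mono)
  finally show ?thesis by (simp add: L_def)
qed

lemma riccati_unique:
  assumes sol1: "nonneg_riccati_solution \<alpha> a k u1" and sol2: "nonneg_riccati_solution \<alpha> a k u2"
    and a: "0 \<le> a" and \<alpha>: "0 \<le> \<alpha>"
    and k: "k \<in> borel_measurable borel" "\<And>y. 0 \<le> k y \<and> k y \<le> K"
    and r: "0 \<le> r"
  shows "u1 r = u2 r"
proof (cases "r \<le> a")
  case True
  then show ?thesis using riccati_stability[OF sol1 sol2 a \<alpha> k k r] by simp
next
  case False
  then show ?thesis using sol1 sol2 by (simp add: nonneg_riccati_solution_def)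
qed

text \<open>Picard iteration for v r = exp (-M (a - r)) u r. The weight makes the map a contraction
  on the whole interval at once, without gluing short intervals.\<close>

lemma backward_integral_equation_exists:
  fixes q k :: "real \<Rightarrow> real"
  assumes a: "0 \<le> a" and q: "L-lipschitz_on UNIV q"
    and k: "k \<in> borel_measurable borel" "\<And>y. 0 \<le> k y \<and> k y \<le> K"
  shows "\<exists>u. continuous_on {0..a} u \<and> (\<forall>r\<in>{0..a}. u r = integral {r..a} (\<lambda>s. k s - q (u s)))"
proof -
  have L: "0 \<le> L" using q by (rule lipschitz_on_nonneg)
  \<comment> \<open>The weight turns the Lipschitz constant L into the contraction factor L/M \<le>
    1/2; the summand 1 keeps M positive when L = 0.\<close>
  define M where "M = 2 * L + 1"
  have M: "0 < M" "L / M \<le> 1 / 2" using L by (auto simp: M_def field_simps)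
  have cq: "continuous_on UNIV q" using q by (rule lipschitz_on_continuous_on)
  \<comment> \<open>Clamping to [0, a] lets \<open>T\<close> act on bounded continuous functions on
    the whole line, a complete type to which the contraction principle applies.\<close>
  define c where "c r = max 0 (min r a)" for r :: real
  have c: "0 \<le> c r" "c r \<le> a" for r using a by (auto simp: c_def)
  have cc: "continuous_on UNIV c" unfolding c_def by (intro continuous_intros)
  define F where "F v s = k s - q (exp (M * (a - s)) * v s)" for v :: "real \<Rightarrow> real" and s
  have Fi: "F v integrable_on {r..a}" if "continuous_on UNIV v" for v r
  proof -
    have "continuous_on {r..a} (\<lambda>s. q (exp (M * (a - s)) * v s))"
      by (rule continuous_on_compose2[OF cq]) (auto intro!: continuous_intros continuous_on_subset[OF that])
    then show ?thesis unfolding F_def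
      by (intro integrable_diff bounded_measurable_integrable_on(2)[OF k] integrable_continuous_real)
  qed
  define T where "T v r = exp (- M * (a - c r)) * integral {c r..a} (F v)" for v r
  have Tb: "T v \<in> bcontfun" if v: "continuous_on UNIV v" for v
  proof -
    have cI: "continuous_on {0..a} (\<lambda>r. exp (- M * (a - r)) * integral {r..a} (F v))"
      using Fi[OF v, of 0] by (intro continuous_intros indefinite_integral_continuous_1')
    have T: "T v = (\<lambda>r. exp (- M * (a - r)) * integral {r..a} (F v)) \<circ> c" by (auto simp: T_def)
    have "continuous_on UNIV (T v)" unfolding T
      by (rule continuous_on_compose[OF cc continuous_on_subset[OF cI]]) (use c in auto)
    moreover have "range (T v) \<subseteq> (\<lambda>r. exp (- M * (a - r)) * integral {r..a} (F v)) ` {0..a}"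
      unfolding T using c by auto
    then have "bounded (range (T v))"
      using compact_imp_bounded[OF compact_continuous_image[OF cI compact_Icc]] bounded_subset by blast
    ultimately show ?thesis by (simp add: bcontfun_def)
  qed
  have exp_int: "((\<lambda>s. exp (M * (a - s))) has_integral (exp (M * (a - r)) - 1) / M) {r..a}" if "r \<le> a" for r
  proof -
    have "((\<lambda>s. exp (M * (a - s))) has_integral (- exp (M * (a - a)) / M - (- exp (M * (a - r)) / M))) {r..a}"
      by (rule fundamental_theorem_of_calculus[OF that])
         (use M in \<open>auto intro!: derivative_eq_intros simp: has_real_derivative_iff_has_vector_derivative[symmetric]\<close>)
    then show ?thesis by (simp add: diff_divide_distrib)
  qed
  define TT where "TT v = Bcontfun (T (apply_bcontfun v))" for v :: "real \<Rightarrow>\<^sub>C real"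
  have TT: "apply_bcontfun (TT v) = T (apply_bcontfun v)" for v
    unfolding TT_def by (rule Bcontfun_inverse[OF Tb]) simp
  have "dist (TT v) (TT w) \<le> 1 / 2 * dist v w" for v w
  proof (rule dist_bound)
    fix r
    let ?D = "dist v w"
    have "\<bar>integral {c r..a} (\<lambda>s. F v s - F w s)\<bar> \<le> integral {c r..a} (\<lambda>s. L * ?D * exp (M * (a - s)))"
    proof (rule abs_integral_le)
      show "(\<lambda>s. F v s - F w s) integrable_on {c r..a}" by (intro integrable_diff Fi) auto
      show "(\<lambda>s. L * ?D * exp (M * (a - s))) integrable_on {c r..a}"
        using exp_int[OF c(2)] by (intro integrable_on_mult_right) auto
      fix s
      have "\<bar>F v s - F w s\<bar> = dist (q (exp (M * (a - s)) * v s)) (q (exp (M * (a - s)) * w s))"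
        by (simp add: F_def dist_real_def abs_minus_commute)
      also have "\<dots> \<le> L * dist (exp (M * (a - s)) * v s) (exp (M * (a - s)) * w s)"
        by (rule lipschitz_onD[OF q]) auto
      also have "dist (exp (M * (a - s)) * v s) (exp (M * (a - s)) * w s) = exp (M * (a - s)) * dist (v s) (w s)"
        by (simp add: dist_real_def right_diff_distrib[symmetric] abs_mult)
      also have "L * \<dots> \<le> L * (exp (M * (a - s)) * ?D)"
        using L by (intro mult_left_mono dist_bounded) auto
      finally show "\<bar>F v s - F w s\<bar> \<le> L * ?D * exp (M * (a - s))" by (simp add: mult_ac)
    qed
    also have "\<dots> = L * ?D * ((exp (M * (a - c r)) - 1) / M)"
      using integral_unique[OF exp_int[OF c(2)]] by simp
    also have "\<dots> \<le> L * ?D * (exp (M * (a - c r)) / M)"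
      using L M by (intro mult_left_mono divide_right_mono) auto
    finally have *: "\<bar>integral {c r..a} (\<lambda>s. F v s - F w s)\<bar> \<le> L * ?D * (exp (M * (a - c r)) / M)" .
    have "dist (TT v r) (TT w r) = exp (- M * (a - c r)) * \<bar>integral {c r..a} (F v) - integral {c r..a} (F w)\<bar>"
      by (simp add: TT T_def dist_real_def right_diff_distrib[symmetric] abs_mult)
    also have "integral {c r..a} (F v) - integral {c r..a} (F w) = integral {c r..a} (\<lambda>s. F v s - F w s)"
      by (rule Henstock_Kurzweil_Integration.integral_diff[symmetric]) (auto intro!: Fi)
    also have "exp (- M * (a - c r)) * \<bar>\<dots>\<bar> \<le> exp (- M * (a - c r)) * (L * ?D * (exp (M * (a - c r)) / M))"
      using * by (intro mult_left_mono) auto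
    also have "\<dots> = L / M * ?D" by (simp add: exp_minus)
    also have "\<dots> \<le> 1 / 2 * ?D" using M by (intro mult_right_mono) auto
    finally show "dist (TT v r) (TT w r) \<le> 1 / 2 * ?D" .
  qed
  then have "\<exists>!v. TT v = v" by (intro banach_fix_type[of "1 / 2"]) auto
  then obtain v where v: "TT v = v" by auto
  define u where "u r = exp (M * (a - r)) * v r" for r
  have "continuous_on {0..a} u" unfolding u_def by (intro continuous_intros) auto
  moreover have "u r = integral {r..a} (\<lambda>s. k s - q (u s))" if "r \<in> {0..a}" for r
  proof -
    have "c r = r" using that by (auto simp: c_def)
    moreover have "v r = T v r" using TT[of v] unfolding v by metis
    ultimately have "v r = exp (- M * (a - r)) * integral {r..a} (F v)"
      by (simp only: T_def)
    then have "u r = integral {r..a} (F v)" by (simp add: u_def exp_minus)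
    then show ?thesis by (simp add: F_def[abs_def] u_def[abs_def])
  qed
  ultimately show ?thesis by blast
qed

text \<open>The nonlinearity is only locally Lipschitz. Truncating its argument to the a priori
  range [0, K a] makes it globally Lipschitz, and the solution of the truncated equation turns out
  to stay in that range, so it solves the original one.\<close>

lemma riccati_exists:
  assumes a: "0 \<le> a" and \<alpha>: "0 \<le> \<alpha>"
    and k: "k \<in> borel_measurable borel" "\<And>y. 0 \<le> k y \<and> k y \<le> K"
  shows "\<exists>u. nonneg_riccati_solution \<alpha> a k u \<and> continuous_on {0..} u"
proof -
  have K: "0 \<le> K" using k(2)[of 0] by linarith
  define R where "R = K * a"
  have R: "0 \<le> R" using K a by (simp add: R_def)
  define cl where "cl z = max 0 (min z R)" for z :: real
  have cl: "0 \<le> cl z" "cl z \<le> R" for z using R by (auto simp: cl_def)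
  define q where "q z = 2 * ((cl z)\<^sup>2 + \<alpha> * cl z)" for z
  have q0: "0 \<le> q z" for z using cl \<alpha> by (simp add: q_def)
  have q: "(2 * (2 * R + \<alpha>))-lipschitz_on UNIV q"
  proof (rule lipschitz_onI)
    fix x y :: real
    have "q x - q y = 2 * (cl x + cl y + \<alpha>) * (cl x - cl y)" by (simp add: q_def power2_eq_square algebra_simps)
    then have "\<bar>q x - q y\<bar> = \<bar>2 * (cl x + cl y + \<alpha>)\<bar> * \<bar>cl x - cl y\<bar>" by (simp add: abs_mult)
    also have "\<dots> \<le> 2 * (2 * R + \<alpha>) * \<bar>x - y\<bar>"
      using cl[of x] cl[of y] \<alpha> by (intro mult_mono) (auto simp: cl_def)
    finally show "dist (q x) (q y) \<le> 2 * (2 * R + \<alpha>) * dist x y" by (simp add: dist_real_def)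
  qed (use R \<alpha> in auto)
  obtain u where cu: "continuous_on {0..a} u" and u: "\<And>r. r \<in> {0..a} \<Longrightarrow> u r = integral {r..a} (\<lambda>s. k s - q (u s))"
    using backward_integral_equation_exists[OF a q k] by auto
  have qi: "(\<lambda>s. q (u s)) integrable_on {r..t}" if "0 \<le> r" "t \<le> a" for r t
    by (intro integrable_continuous_real continuous_on_compose2[OF lipschitz_on_continuous_on[OF q]]
        continuous_on_subset[OF cu]) (use that in auto)
  note ki = bounded_measurable_integrable_on(2)[OF k]
  have ua: "u a = 0" using u[of a] a by simp
  have upper: "u r \<le> R" if r: "r \<in> {0..a}" for r
  proof -
    have "u r \<le> integral {r..a} k"
      unfolding u[OF r] by (rule integral_le) (use qi ki q0 r in \<open>auto intro!: integrable_diff\<close>)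
    also have "\<dots> \<le> integral {0..a} k"
      by (rule integral_subset_le) (use r ki k in auto)
    also have "\<dots> \<le> integral {0..a} (\<lambda>_. K)"
      by (rule integral_le) (use ki k in auto)
    also have "\<dots> = R" using a by (simp add: R_def)
    finally show ?thesis .
  qed
  \<comment> \<open>If u r < 0, then u \<le> 0 up to its first zero r1, which exists because u a =
    0. On that stretch the truncated nonlinearity vanishes, so u r = integral {r..r1} k \<ge> 0, a
    contradiction.\<close>
  have lower: "0 \<le> u r" if r: "r \<in> {0..a}" for r
  proof (rule ccontr)
    assume neg: "\<not> 0 \<le> u r"
    let ?A = "{r..a} \<inter> u -` {0}"
    have cr: "continuous_on {r..a} u" using cu by (rule continuous_on_subset) (use r in auto)
    have cl': "closed ?A" by (rule continuous_closed_preimage[OF cr]) auto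
    have ne: "?A \<noteq> {}" using ua r by auto
    have bdd: "bdd_below ?A" by (rule bdd_belowI[of _ r]) auto
    define r1 where "r1 = Inf ?A"
    have r1: "r1 \<in> ?A" unfolding r1_def by (rule closed_contains_Inf[OF ne bdd cl'])
    have nonpos: "u s \<le> 0" if s: "s \<in> {r..r1}" for s
    proof (rule ccontr)
      assume "\<not> u s \<le> 0"
      moreover have "continuous_on {r..s} u" using cr by (rule continuous_on_subset) (use s r1 in auto)
      ultimately obtain z where z: "r \<le> z" "z \<le> s" "u z = 0"
        using IVT'[of u r 0 s] neg s by auto
      then have "r1 \<le> z" unfolding r1_def using s r1 by (intro cInf_lower bdd) auto
      with z s have "s = z" by auto
      with z \<open>\<not> u s \<le> 0\<close> show False by simp
    qed
    have Fi: "(\<lambda>s. k s - q (u s)) integrable_on {r..a}" using r by (intro integrable_diff ki qi) auto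
    have "integral {r..r1} (\<lambda>s. k s - q (u s)) + integral {r1..a} (\<lambda>s. k s - q (u s)) = integral {r..a} (\<lambda>s. k s - q (u s))"
      by (rule Henstock_Kurzweil_Integration.integral_combine) (use r1 Fi in auto)
    then have "u r = integral {r..r1} (\<lambda>s. k s - q (u s)) + u r1"
      using u[of r] u[of r1] r r1 by auto
    moreover have "0 \<le> integral {r..r1} (\<lambda>s. k s - q (u s))"
    proof (rule integral_Icc_nonneg)
      fix s assume "s \<in> {r..r1}"
      then have "cl (u s) = 0" using nonpos[of s] R by (simp add: cl_def max_def min_def)
      then show "0 \<le> k s - q (u s)" using k by (simp add: q_def)
    qed
    ultimately show False using neg r1 by auto
  qed
  have qu: "q (u s) = 2 * ((u s)\<^sup>2 + \<alpha> * u s)" if "s \<in> {0..a}" for s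
    using lower[OF that] upper[OF that] by (simp add: q_def cl_def)
  \<comment> \<open>Extension by 0 beyond a is continuous because u a = 0.\<close>
  define w where "w r = (if 0 \<le> r \<and> r \<le> a then u r else 0)" for r
  have cw: "continuous_on {0..} w"
  proof -
    have "continuous_on {0..} (\<lambda>r. u (min r a))"
      by (rule continuous_on_compose2[OF cu]) (auto intro!: continuous_intros simp: a)
    then show ?thesis by (rule continuous_on_eq) (auto simp: w_def min_def ua)
  qed
  have "nonneg_riccati_solution \<alpha> a k w"
    unfolding nonneg_riccati_solution_def
  proof (intro conjI allI impI ballI)
    fix r assume r: "r \<in> {0..a}"
    have "continuous_on {r..a} (\<lambda>s. (w s)\<^sup>2 + \<alpha> * w s)"
      using r by (intro continuous_intros continuous_on_subset[OF cw]) auto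
    then show si: "set_integrable lborel {r..a} (\<lambda>s. (w s)\<^sup>2 + \<alpha> * w s)"
      by (rule borel_integrable_atLeastAtMost')
    have "integral {r..a} (\<lambda>s. k s - q (u s)) = integral {r..a} k - integral {r..a} (\<lambda>s. q (u s))"
      using r by (intro Henstock_Kurzweil_Integration.integral_diff ki qi) auto
    also have "integral {r..a} (\<lambda>s. q (u s)) = integral {r..a} (\<lambda>s. 2 * ((w s)\<^sup>2 + \<alpha> * w s))"
      by (rule integral_cong) (use qu r in \<open>auto simp: w_def\<close>)
    also have "\<dots> = 2 * integral {r..a} (\<lambda>s. (w s)\<^sup>2 + \<alpha> * w s)"
      by (rule integral_mult_right)
    finally have "u r + 2 * integral {r..a} (\<lambda>s. (w s)\<^sup>2 + \<alpha> * w s) = integral {r..a} k"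
      using u[OF r] by linarith
    then show "w r + 2 * (LBINT s:{r..a}. (w s)\<^sup>2 + \<alpha> * w s) = (LBINT s:{r..a}. k s)"
      using set_borel_integral_eq_integral(2)[OF si] bounded_measurable_integrable_on(3)[OF k] r
      by (simp add: w_def)
  qed (use lower in \<open>auto simp: w_def\<close>)
  with cw show ?thesis by blast
qed

section \<open>Linearisation of the Riccati equation\<close>

lemma uniform_Taylor2_if_smooth:
  assumes D1: "\<And>y. 0 < y \<Longrightarrow> (\<psi> has_real_derivative D1 y) (at y)"
    and D2: "\<And>y. 0 < y \<Longrightarrow> (D1 has_real_derivative D2 y) (at y)"
    and uc: "uniformly_continuous_on {0<..} D2" and \<epsilon>: "0 < \<epsilon>"
  shows "uniform_Taylor2 \<epsilon> \<psi> D1 D2"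
  unfolding uniform_Taylor2_def
proof (intro allI impI)
  fix \<eta> :: real assume \<eta>: "0 < \<eta>"
  obtain d where d: "0 < d" "\<And>x y. 0 < x \<Longrightarrow> 0 < y \<Longrightarrow> dist y x < d \<Longrightarrow> dist (D2 y) (D2 x) < \<eta>"
    using uc \<eta> unfolding uniformly_continuous_on_def by (metis greaterThan_iff)
  show "\<exists>\<delta>>0. \<forall>y\<ge>\<epsilon>. \<forall>z. \<bar>z\<bar> < \<delta> \<longrightarrow> \<bar>\<psi> (y + z) - \<psi> y - D1 y * z - D2 y * z\<^sup>2 / 2\<bar> \<le> \<eta> * z\<^sup>2"
  \<comment> \<open>\<epsilon> keeps the segment from y to y + z inside the open half line where
    \<psi> is differentiable; d controls the oscillation of D2 in the Lagrange remainder.\<close>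
  proof (intro exI[of _ "min d \<epsilon>"] conjI allI impI)
    show "0 < min d \<epsilon>" using d \<epsilon> by simp
    fix y z assume y: "\<epsilon> \<le> y" and z: "\<bar>z\<bar> < min d \<epsilon>"
    show "\<bar>\<psi> (y + z) - \<psi> y - D1 y * z - D2 y * z\<^sup>2 / 2\<bar> \<le> \<eta> * z\<^sup>2"
    proof (cases "z = 0")
      case False
      define diff where "diff m = (if m = 0 then \<psi> else if m = 1 then D1 else D2)" for m :: nat
      have "\<exists>t. (if y + z < y then y + z < t \<and> t < y else y < t \<and> t < y + z) \<and>
         \<psi> (y + z) = (\<Sum>m<(2::nat). (diff m y / fact m) * (y + z - y) ^ m) + (diff 2 t / fact 2) * (y + z - y) ^ 2"
      proof (rule Taylor)
        show "\<forall>(m::nat) t. m < 2 \<and> min y (y + z) \<le> t \<and> t \<le> max y (y + z) \<longrightarrow> DERIV (diff m) t :> diff (Suc m) t"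
        proof (intro allI impI)
          fix m :: nat and t assume "m < 2 \<and> min y (y + z) \<le> t \<and> t \<le> max y (y + z)"
          then have "0 < t" "m = 0 \<or> m = 1" using y z by (auto simp: min_def split: if_splits)
          then show "DERIV (diff m) t :> diff (Suc m) t" using D1 D2 by (auto simp: diff_def)
        qed
      qed (use False in \<open>auto simp: diff_def\<close>)
      then obtain t where t: "if y + z < y then y + z < t \<and> t < y else y < t \<and> t < y + z"
        and eq: "\<psi> (y + z) = \<psi> y + D1 y * z + D2 t / 2 * z\<^sup>2"
        by (auto simp: diff_def numeral_2_eq_2)
      have "0 < t" "dist t y < d" using t y z by (auto simp: dist_real_def split: if_splits)
      then have "\<bar>D2 t - D2 y\<bar> < \<eta>" using d(2)[of y t] y \<epsilon> by (simp add: dist_real_def)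
      then have "\<bar>(D2 t - D2 y) / 2\<bar> * z\<^sup>2 \<le> \<eta> * z\<^sup>2" by (intro mult_right_mono) auto
      moreover
      have "\<psi> (y + z) - \<psi> y - D1 y * z - D2 y * z\<^sup>2 / 2 = (D2 t - D2 y) / 2 * z\<^sup>2"
        unfolding eq by (simp add: algebra_simps diff_divide_distrib)
      then have "\<bar>\<psi> (y + z) - \<psi> y - D1 y * z - D2 y * z\<^sup>2 / 2\<bar> = \<bar>(D2 t - D2 y) / 2\<bar> * z\<^sup>2"
        by (simp only: abs_mult abs_power2)
      ultimately show ?thesis by (simp only:)
    qed simp
  qed
qed

text \<open>For y < 0 the interval is empty and the value is 1, which continues the function
  continuously to the whole line with modulus at most 1 when u \<ge> 0; derivatives are taken only
  at y > 0.\<close>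

definition riccati_potential :: "(real \<Rightarrow> real) \<Rightarrow> real \<Rightarrow> real" where
  "riccati_potential u y = exp (- 2 * integral {0..y} u)"

lemma riccati_potential_props:
  assumes u: "continuous_on {0..} u" "\<forall>r\<ge>0. 0 \<le> u r"
  shows "continuous_on UNIV (riccati_potential u)" "\<bar>riccati_potential u y\<bar> \<le> 1" "0 < riccati_potential u y"
    "riccati_potential u 0 = 1"
    and "0 < y \<Longrightarrow> (riccati_potential u has_real_derivative - 2 * u y * riccati_potential u y) (at y)"
proof -
  have int: "u integrable_on {0..b}" for b
    by (rule integrable_continuous_real[OF continuous_on_subset[OF u(1)]]) auto
  show d: "(riccati_potential u has_real_derivative - 2 * u y * riccati_potential u y) (at y)" if y: "0 < y" for y
  proof -
    have "((\<lambda>x. integral {0..x} u) has_real_derivative u y) (at y within {0..y + 1})"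
      by (rule integral_has_real_derivative[OF continuous_on_subset[OF u(1)]]) (use y in auto)
    then have "((\<lambda>x. integral {0..x} u) has_real_derivative u y) (at y)"
      using y by (simp add: at_within_Icc_at)
    then show ?thesis unfolding riccati_potential_def[abs_def]
      by (auto intro!: derivative_eq_intros)
  qed
  show "0 < riccati_potential u y" "riccati_potential u 0 = 1" by (simp_all add: riccati_potential_def)
  have "0 \<le> integral {0..y} u" by (rule integral_Icc_nonneg) (use u in auto)
  then show "\<bar>riccati_potential u y\<bar> \<le> 1" by (simp add: riccati_potential_def)
  have "continuous_on UNIV (\<lambda>y. integral {0..max 0 y} u)"
    unfolding continuous_on_eq_continuous_at[OF open_UNIV]
  proof
    fix y :: real
    have "continuous_on {0..max 0 y + 1} (\<lambda>x. integral {0..x} u)"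
      by (rule indefinite_integral_continuous_1[OF int])
    then have "continuous_on {..<max 0 y + 1} (\<lambda>y. integral {0..max 0 y} u)"
      by (rule continuous_on_compose2) (auto intro!: continuous_intros)
    then show "isCont (\<lambda>y. integral {0..max 0 y} u) y"
      by (subst (asm) continuous_on_eq_continuous_at) auto
  qed
  moreover have "integral {0..max 0 y} u = integral {0..y} u" for y
    by (cases "0 \<le> y") auto
  ultimately have "continuous_on UNIV (\<lambda>y. integral {0..y} u)" by simp
  then show "continuous_on UNIV (riccati_potential u)"
    unfolding riccati_potential_def[abs_def] by (intro continuous_intros)
qed

text \<open>Differentiating the integral equation gives u' = 2 (u^2 + \<alpha> u) - k. Hence (-2 u
  \<psi>)' = (4 u^2 - 2 u') \<psi> = (2 k - 4 \<alpha> u) \<psi>: the squares cancel, and so do the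
  \<alpha> u terms in D2/2 - \<alpha> D1.\<close>

lemma riccati_potential_Taylor:
  assumes sol: "nonneg_riccati_solution \<alpha> a k u" and u: "continuous_on {0..} u" and a: "0 \<le> a" and \<alpha>: "0 \<le> \<alpha>"
    and k: "continuous_on UNIV k" "\<And>y. 0 \<le> k y \<and> k y \<le> K" "\<And>y. a \<le> y \<Longrightarrow> k y = 0" and \<epsilon>: "0 < \<epsilon>"
  defines "\<psi> \<equiv> riccati_potential u"
  defines "D1 \<equiv> \<lambda>y. - 2 * u y * \<psi> y" and "D2 \<equiv> \<lambda>y. (2 * k y - 4 * \<alpha> * u y) * \<psi> y"
  shows "uniform_Taylor2 \<epsilon> \<psi> D1 D2"
    and "\<exists>C\<ge>K. \<forall>y\<ge>0. \<bar>D1 y\<bar> \<le> C \<and> \<bar>D2 y\<bar> \<le> C"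
    and "D2 y / 2 - \<alpha> * D1 y = k y * \<psi> y"
proof -
  have km: "k \<in> borel_measurable borel" using k(1) by (rule borel_measurable_continuous_onI)
  note b = riccati_solution_bounds[OF sol a \<alpha> km k(2)]
  note HK = riccati_solution_HK[OF sol _ _ km k(2)]
  have "\<forall>r\<ge>0. 0 \<le> u r" using b(2) by blast
  note \<psi> = riccati_potential_props[OF u this, folded \<psi>_def]
  have uz: "u r = 0" if "a \<le> r" for r
  proof (cases "r = a")
    case True
    then show ?thesis using HK(2)[of a] a by simp
  qed (use sol that in \<open>simp add: nonneg_riccati_solution_def\<close>)
  let ?F = "\<lambda>s. k s - 2 * ((u s)\<^sup>2 + \<alpha> * u s)"
  have cF: "continuous_on {0..b} ?F" for b
    by (intro continuous_intros continuous_on_subset[OF k(1)] continuous_on_subset[OF u]) auto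
  \<comment> \<open>Since u and k vanish from a on, the equation extends to every right end b \<ge>
    a. Thereby a becomes an interior point, and u is differentiable there too.\<close>
  have u_eq: "u r = integral {r..b} ?F" if r: "0 \<le> r" "r \<le> b" and ab: "a \<le> b" for r b
  proof (cases "r \<le> a")
    case True
    have "integral {r..a} ?F + integral {a..b} ?F = integral {r..b} ?F"
      by (rule Henstock_Kurzweil_Integration.integral_combine[OF True ab])
         (rule integrable_continuous_real[OF continuous_on_subset[OF cF]], use r in auto)
    moreover have "integral {a..b} ?F = integral {a..b} (\<lambda>_. 0)"
      by (rule integral_cong) (use uz k(3) in auto)
    moreover have "integral {r..a} ?F = integral {r..a} k - integral {r..a} (\<lambda>s. 2 * ((u s)\<^sup>2 + \<alpha> * u s))"
      using HK(1)[OF r(1) True] bounded_measurable_integrable_on(2)[OF km k(2)]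
      by (intro Henstock_Kurzweil_Integration.integral_diff integrable_on_mult_right) auto
    moreover have "integral {r..a} (\<lambda>s. 2 * ((u s)\<^sup>2 + \<alpha> * u s)) = 2 * integral {r..a} (\<lambda>s. (u s)\<^sup>2 + \<alpha> * u s)"
      by (rule integral_mult_right)
    moreover have "integral {a..b} (\<lambda>_. 0 :: real) = 0" by simp
    ultimately show ?thesis using HK(2)[OF r(1) True] by linarith
  next
    case False
    then have "integral {r..b} ?F = integral {r..b} (\<lambda>_. 0)"
      by (intro integral_cong) (use uz k(3) in auto)
    then show ?thesis using uz[of r] False by simp
  qed
  have du: "(u has_real_derivative - ?F y) (at y)" if y: "0 < y" for y
  proof -
    define b where "b = a + y + 1"
    have "((\<lambda>r. integral {r..b} ?F) has_real_derivative - ?F y) (at y)"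
      by (rule integral_tail_deriv[OF cF]) (use y a in \<open>auto simp: b_def\<close>)
    moreover have "eventually (\<lambda>x. x \<in> {0<..<b}) (nhds y)"
      by (rule eventually_nhds_in_open) (use y a in \<open>auto simp: b_def\<close>)
    then have "eventually (\<lambda>x. u x = integral {x..b} ?F) (nhds y)"
      by eventually_elim (rule u_eq, use y a in \<open>auto simp: b_def\<close>)
    then have "(u has_real_derivative - ?F y) (at y) \<longleftrightarrow> ((\<lambda>r. integral {r..b} ?F) has_real_derivative - ?F y) (at y)"
      by (intro DERIV_cong_ev refl)
    ultimately show ?thesis by blast
  qed
  show "uniform_Taylor2 \<epsilon> \<psi> D1 D2"
  proof (rule uniform_Taylor2_if_smooth[OF _ _ _ \<epsilon>])
    show "(\<psi> has_real_derivative D1 y) (at y)" if "0 < y" for y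
      unfolding D1_def using \<psi>(5)[OF that] .
    show "(D1 has_real_derivative D2 y) (at y)" if "0 < y" for y
      unfolding D1_def D2_def
      by (auto intro!: derivative_eq_intros du[OF that] \<psi>(5)[OF that] simp: power2_eq_square algebra_simps)
    have "continuous_on {0..a} D2" unfolding D2_def
      by (intro continuous_intros continuous_on_subset[OF k(1)] continuous_on_subset[OF u] continuous_on_subset[OF \<psi>(1)]) auto
    then have uc: "uniformly_continuous_on {0..a} D2" by (rule compact_uniformly_continuous) simp
    \<comment> \<open>\<open>D2\<close> vanishes from a on, so it factors through
      \<open>min y a\<close>, and compactness of [0, a] gives uniform continuity on the unbounded
      domain.\<close>
    have "uniformly_continuous_on {0<..} (\<lambda>y. min y a)"
      unfolding uniformly_continuous_on_def by (intro allI impI exI conjI ballI, assumption) (auto simp: dist_real_def min_def)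
    moreover have "uniformly_continuous_on ((\<lambda>y. min y a) ` {0<..}) D2"
    proof -
      have "(\<lambda>y. min y a) ` {0<..} \<subseteq> {0..a}" using a by auto
      with uc show ?thesis unfolding uniformly_continuous_on_def by (meson subsetD)
    qed
    ultimately have "uniformly_continuous_on {0<..} (\<lambda>y. D2 (min y a))"
      by (rule uniformly_continuous_on_compose)
    moreover have "D2 (min y a) = D2 y" for y
      using uz[of y] uz[of a] k(3)[of y] k(3)[of a] by (auto simp: D2_def min_def)
    ultimately show "uniformly_continuous_on {0<..} D2" by simp
  qed
  show "\<exists>C\<ge>K. \<forall>y\<ge>0. \<bar>D1 y\<bar> \<le> C \<and> \<bar>D2 y\<bar> \<le> C"
  proof (intro exI conjI allI impI)
    let ?U = "integral {0..a} k"
    have K: "0 \<le> K" using k(2)[of 0] by linarith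
    have U: "0 \<le> ?U" by (rule integral_Icc_nonneg) (use k in auto)
    show "K \<le> 2 * K + (2 + 4 * \<alpha>) * ?U" using K U \<alpha> by simp
    fix y :: real assume y: "0 \<le> y"
    have "\<bar>D1 y\<bar> \<le> 2 * ?U * 1"
      unfolding D1_def abs_mult by (intro mult_mono) (use b(2,3)[OF y] \<psi>(2) in auto)
    then show "\<bar>D1 y\<bar> \<le> 2 * K + (2 + 4 * \<alpha>) * ?U" using K U \<alpha> by (simp add: distrib_right add_increasing2 add_increasing)
    have "\<alpha> * u y \<le> \<alpha> * ?U" "0 \<le> \<alpha> * u y" using b(2,3)[OF y] \<alpha> by (auto intro!: mult_left_mono)
    then have "\<bar>2 * k y - 4 * \<alpha> * u y\<bar> \<le> 2 * K + 4 * (\<alpha> * ?U)" using k(2)[of y] by auto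
    then have "\<bar>D2 y\<bar> \<le> (2 * K + 4 * (\<alpha> * ?U)) * 1"
      unfolding D2_def abs_mult by (rule mult_mono) (use \<psi>(2) K U \<alpha> in auto)
    then show "\<bar>D2 y\<bar> \<le> 2 * K + (2 + 4 * \<alpha>) * ?U" using U by (simp add: distrib_right)
  qed
  show "D2 y / 2 - \<alpha> * D1 y = k y * \<psi> y"
    by (simp add: D1_def D2_def algebra_simps diff_divide_distrib)
qed

section \<open>Time-changed Brownian motion\<close>

text \<open>For \<open>\<lambda> = c\<^sup>2/2 + \<alpha>c\<close> the process \<open>exp (- \<lambda>t - c X t)\<close> is a martingale; letting \<open>c\<close> tend to 0 shows
  that the level is reached almost surely.\<close>

lemma (in prob_space) drifted_Brownian_motion_nonpos:
  assumes bm: "standard_brownian_motion M B"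
    and X: "\<And>t \<omega>. X t \<omega> = x + B t \<omega> - \<alpha> * t" and \<alpha>: "0 \<le> \<alpha>" and x: "0 \<le> x"
  shows "AE \<omega> in M. \<exists>t\<ge>0. X t \<omega> \<le> 0"
proof -
  \<comment> \<open>Starting one unit higher, X' < 1 means X < 0. A path without such a grid time
    stays above the barrier 1/2, which is kept away from 0, where \<psi> is not smooth.\<close>
  define X' where "X' = (\<lambda>t \<omega>. (x + 1) + B t \<omega> - \<alpha> * t)"
  define h where "h n = 1 / real (Suc n)" for n
  have h: "0 < h n" for n by (simp add: h_def)
  have B: "B t \<in> borel_measurable M" if "0 \<le> t" for t
    using bm that by (auto simp: standard_brownian_motion_def stoch_process_def)
  have X'm [measurable]: "X' (real i * h n) \<in> borel_measurable M" for i n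
    unfolding X'_def using B[of "real i * h n"] h[of n] by simp
  define H where "H = {\<omega> \<in> space M. \<exists>i n. X' (real i * h n) \<omega> < 1}"
  have Hm [measurable]: "H \<in> sets M" unfolding H_def by measurable
  have lower: "exp (- c * (x + 1)) \<le> prob H" if c: "0 < c" for c
  proof -
    \<comment> \<open>The eigenvalue of exp (-c y) under the generator f''/2 - \<alpha> f', so that
      a constant killing rate takes the place of k. The constant function c/2 below produces this
      exponential as a Riccati potential.\<close>
    define rate where "rate = c\<^sup>2 / 2 + \<alpha> * c"
    have rate: "0 < rate" unfolding rate_def using c \<alpha> by (simp add: add_pos_nonneg)
    define u where "u = (\<lambda>_::real. c / 2)"
    define \<psi> where "\<psi> = riccati_potential u"
    have "continuous_on {0..} u" "\<forall>r\<ge>0. 0 \<le> u r" using c by (auto simp: u_def)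
    note \<psi> = riccati_potential_props[OF this, folded \<psi>_def]
    have \<psi>e: "\<psi> y = exp (- c * y)" if "0 \<le> y" for y
      using that by (simp add: \<psi>_def riccati_potential_def u_def)
    have [measurable]: "\<psi> \<in> borel_measurable borel" using \<psi>(1) by (rule borel_measurable_continuous_onI)
    have D1: "(\<psi> has_real_derivative - c * \<psi> y) (at y)" if "0 < y" for y
      using \<psi>(5)[OF that] by (simp add: u_def)
    have T: "uniform_Taylor2 (1 / 2) \<psi> (\<lambda>y. - c * \<psi> y) (\<lambda>y. c\<^sup>2 * \<psi> y)"
    proof (rule uniform_Taylor2_if_smooth)
      show "((\<lambda>y. - c * \<psi> y) has_real_derivative c\<^sup>2 * \<psi> y) (at y)" if "0 < y" for y
        using D1[OF that] by (auto intro!: derivative_eq_intros simp: power2_eq_square)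
      have "c-lipschitz_on {0<..} \<psi>"
      proof (rule lipschitz_onI)
        fix y z :: real assume yz: "y \<in> {0<..}" "z \<in> {0<..}"
        have "norm (\<psi> y - \<psi> z) \<le> c * norm (y - z)"
        proof (rule field_differentiable_bound[where S = "{0<..}"])
          show "(\<psi> has_field_derivative - c * \<psi> w) (at w within {0<..})" if "w \<in> {0<..}" for w
            using D1[of w] that by (auto intro: has_field_derivative_at_within)
          show "norm (- c * \<psi> w) \<le> c" for w
            using \<psi>(2)[of w] c by (simp add: abs_mult mult_left_le)
        qed (use yz in auto)
        then show "dist (\<psi> y) (\<psi> z) \<le> c * dist y z" by (simp add: dist_norm)
      qed (use c in auto)
      then have "uniformly_continuous_on {0<..} \<psi>" by (rule lipschitz_on_uniformly_continuous)
      then show "uniformly_continuous_on {0<..} (\<lambda>y. c\<^sup>2 * \<psi> y)"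
        by (rule uniformly_continuous_on_cmul_left)
    qed (use D1 in auto)
    have lim: "(\<lambda>n. \<integral>\<omega>. stopped_weight (1 / 2) \<psi> (\<lambda>i. X' (i * h n) \<omega>) (\<lambda>i. exp (- h n * rate))
            (N * Suc n) \<partial>M) \<longlonglongrightarrow> \<psi> (x + 1)" for N
      unfolding h_def
    proof (rule stopped_Feynman_Kac_limit[OF bm _ T, where K = "rate + c + c\<^sup>2"])
      show "X' t \<omega> = (x + 1) + B t \<omega> - \<alpha> * t" for t \<omega> by (simp add: X'_def)
      show "\<bar>\<psi> y\<bar> \<le> 1" for y by (rule \<psi>(2))
      show "0 \<le> rate \<and> rate \<le> rate + c + c\<^sup>2" using rate c by simp
      show "c\<^sup>2 * \<psi> y / 2 - \<alpha> * (- c * \<psi> y) = rate * \<psi> y" for y by (simp add: rate_def algebra_simps)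
      fix y
      have "\<bar>- c * \<psi> y\<bar> \<le> c * 1" "\<bar>c\<^sup>2 * \<psi> y\<bar> \<le> c\<^sup>2 * 1"
        unfolding abs_mult by (intro mult_mono, use \<psi>(2) c in auto)+
      then show "\<bar>- c * \<psi> y\<bar> \<le> rate + c + c\<^sup>2 \<and> \<bar>c\<^sup>2 * \<psi> y\<bar> \<le> rate + c + c\<^sup>2"
        using rate c zero_le_power2[of c] by auto
    qed auto
    have bound: "(\<integral>\<omega>. stopped_weight (1 / 2) \<psi> (\<lambda>i. X' (i * h n) \<omega>) (\<lambda>i. exp (- h n * rate)) (N * Suc n) \<partial>M)
        \<le> prob H + exp (- rate) ^ N" for n N
    proof -
      let ?w = "\<lambda>\<omega>. stopped_weight (1 / 2) \<psi> (\<lambda>i. X' (i * h n) \<omega>) (\<lambda>i. exp (- h n * rate)) (N * Suc n)"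
      have w1: "\<bar>?w \<omega>\<bar> \<le> 1" for \<omega>
        by (rule abs_stopped_weight_le) (use h[of n] rate \<psi>(2) in auto)
      have "?w \<omega> \<le> indicator H \<omega> + exp (- rate) ^ N" if \<omega>: "\<omega> \<in> space M" for \<omega>
      proof (cases "\<omega> \<in> H")
        case True
        then show ?thesis using w1[of \<omega>] by (simp add: add_increasing2 abs_le_iff)
      next
        case False
        then have "1 \<le> X' (real i * h n) \<omega>" for i using \<omega> by (auto simp: H_def not_less)
        then have "1 / 2 \<le> X' (real i * h n) \<omega>" for i by (rule order_trans[rotated]) simp
        then have al: "alive (1 / 2) (\<lambda>i. X' (i * h n) \<omega>) j" for j
          by (simp add: alive_def)
        \<comment> \<open>Without a visit below 1 all \<open>N * Suc n\<close> factors are present,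
          and they multiply to exp (-rate N), which vanishes as N grows.\<close>
        have "?w \<omega> = exp (- h n * rate) ^ (N * Suc n) * \<psi> (X' (stop_index (1 / 2) (\<lambda>i. X' (i * h n) \<omega>) (N * Suc n) * h n) \<omega>)"
          unfolding stopped_weight_def using al by simp
        also have "\<dots> \<le> exp (- h n * rate) ^ (N * Suc n) * 1"
          using \<psi>(2) by (intro mult_left_mono) (auto simp: abs_le_iff)
        also have "exp (- h n * rate) ^ (N * Suc n) = exp (- rate) ^ N"
          by (simp add: exp_of_nat_mult[symmetric] h_def del: of_nat_Suc mult_Suc_right)
        finally show ?thesis using False by simp
      qed
      moreover have iH: "integrable M (indicator H :: _ \<Rightarrow> real)"
        by (rule integrable_real_indicator[OF Hm]) (simp add: emeasure_eq_measure)
      ultimately have "(\<integral>\<omega>. ?w \<omega> \<partial>M) \<le> (\<integral>\<omega>. indicator H \<omega> + exp (- rate) ^ N \<partial>M)"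
      proof (intro integral_mono)
        show "integrable M ?w" by (rule integrable_const_bound[where B = 1]) (use w1 in auto)
        show "integrable M (\<lambda>\<omega>. indicator H \<omega> + exp (- rate) ^ N)"
          by (intro Bochner_Integration.integrable_add integrable_const iH)
      qed
      also have "\<dots> = prob H + exp (- rate) ^ N"
        using Hm by (subst Bochner_Integration.integral_add[OF iH integrable_const])
          (simp add: prob_space Int_absorb2 sets.sets_into_space)
      finally show ?thesis .
    qed
    have "\<psi> (x + 1) \<le> prob H + exp (- rate) ^ N" for N
      by (rule LIMSEQ_le_const2[OF lim[of N]]) (use bound in blast)
    moreover have "(\<lambda>N. prob H + exp (- rate) ^ N) \<longlonglongrightarrow> prob H + 0"
      by (intro tendsto_intros LIMSEQ_power_zero) (use rate in auto)
    ultimately have "\<psi> (x + 1) \<le> prob H + 0" by (intro LIMSEQ_le_const) auto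
    then show ?thesis using \<psi>e[of "x + 1"] x by simp
  qed
  \<comment> \<open>Here h n merely serves as a choice of c tending to 0.\<close>
  have "(\<lambda>n. exp (- h n * (x + 1))) \<longlonglongrightarrow> exp (- 0 * (x + 1))"
    unfolding h_def by (intro tendsto_intros LIMSEQ_Suc[OF lim_1_over_n])
  then have "1 \<le> prob H"
    by (intro LIMSEQ_le_const2[where X = "\<lambda>n. exp (- h n * (x + 1))"]) (use lower h in auto)
  then have "prob H = 1" using prob_le_1[of H] by linarith
  then have "AE \<omega> in M. \<omega> \<in> H" by (simp add: prob_eq_1)
  then show ?thesis
  proof eventually_elim
    case (elim \<omega>)
    then obtain i n where "X' (real i * h n) \<omega> < 1" by (auto simp: H_def)
    then have "X (real i * h n) \<omega> \<le> 0" by (simp add: X'_def X)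
    then show ?case using h[of n] by (intro exI[of _ "real i * h n"]) auto
  qed
qed

text \<open>F agrees almost everywhere with the pointwise \<open>lim\<close> of the sequence, which
  is measurable for the completion; completeness transfers this to F. Applied to a constant
  sequence, it replaces an integrand by an almost everywhere equal one of unknown
  measurability.\<close>

lemma completion_bounded_limit:
  fixes f :: "nat \<Rightarrow> 'a \<Rightarrow> real"
  assumes M: "prob_space M" and f [measurable]: "\<And>n. f n \<in> borel_measurable (completion M)"
    and b: "\<And>n. AE \<omega> in M. \<bar>f n \<omega>\<bar> \<le> 1" and lim: "AE \<omega> in M. (\<lambda>n. f n \<omega>) \<longlonglongrightarrow> F \<omega>"
  shows "F \<in> borel_measurable (completion M)"
    and "(\<lambda>n. \<integral>\<omega>. f n \<omega> \<partial>completion M) \<longlonglongrightarrow> (\<integral>\<omega>. F \<omega> \<partial>completion M)"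
proof -
  interpret prob_space "completion M" using M by (rule prob_space.prob_space_completion)
  have L: "(\<lambda>\<omega>. lim (\<lambda>n. f n \<omega>)) \<in> borel_measurable (completion M)" by measurable
  have lim': "AE \<omega> in completion M. (\<lambda>n. f n \<omega>) \<longlonglongrightarrow> F \<omega>" using lim by (rule AE_completion)
  show F: "F \<in> borel_measurable (completion M)"
  proof (rule measurableI)
    fix A :: "real set" assume A: "A \<in> sets borel"
    show "F -` A \<inter> space (completion M) \<in> sets (completion M)"
    proof (rule completion.in_sets_AE)
      show "(\<lambda>\<omega>. lim (\<lambda>n. f n \<omega>)) -` A \<inter> space (completion M) \<in> sets (completion M)"
        using L A by (rule measurable_sets)
      show "AE \<omega> in completion M. (\<omega> \<in> (\<lambda>\<omega>. lim (\<lambda>n. f n \<omega>)) -` A \<inter> space (completion M)) =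
          (\<omega> \<in> F -` A \<inter> space (completion M))"
        using lim' by eventually_elim (auto dest: limI)
    qed auto
  qed simp
  show "(\<lambda>n. \<integral>\<omega>. f n \<omega> \<partial>completion M) \<longlonglongrightarrow> (\<integral>\<omega>. F \<omega> \<partial>completion M)"
  proof (rule integral_dominated_convergence)
    show "integrable (completion M) (\<lambda>_. 1 :: real)" by simp
    show "AE \<omega> in completion M. norm (f n \<omega>) \<le> 1" for n
      using AE_completion[OF b[of n]] by simp
  qed (use F f lim' in auto)
qed

text \<open>All three are read off at time 1, where exp (-\<phi> q) is the Laplace transform of a
  nonnegative variable; continuity is dominated convergence.\<close>

lemma (in prob_space) laplace_exponent_props:
  assumes S: "subordinator M S" and \<phi>: "laplace_exponent M S \<phi>"
  shows "\<phi> 0 = 0" "\<And>q r. 0 \<le> q \<Longrightarrow> q \<le> r \<Longrightarrow> \<phi> q \<le> \<phi> r" "continuous_on {0..} \<phi>"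
proof -
  have E: "(\<integral>\<omega>. exp (- q * S 1 \<omega>) \<partial>M) = exp (- \<phi> q)" if "0 \<le> q" for q
    using \<phi> that by (auto simp: laplace_exponent_def dest: spec[of _ 1])
  have Sm [measurable]: "S 1 \<in> borel_measurable M"
    using S by (auto simp: subordinator_def levy_process_def stoch_process_def)
  have "AE \<omega> in M. S 0 \<omega> = 0" "AE \<omega> in M. mono_on {0..} (\<lambda>t. S t \<omega>)"
    using S by (auto simp: subordinator_def levy_process_def)
  then have S1: "AE \<omega> in M. 0 \<le> S 1 \<omega>"
  proof eventually_elim
    case (elim \<omega>)
    then show ?case using mono_onD[OF elim(2), of 0 1] by simp
  qed
  have int: "integrable M (\<lambda>\<omega>. exp (- q * S 1 \<omega>))" if "0 \<le> q" for q
    by (rule integrable_const_bound[where B = 1]) (use S1 that in auto)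
  show "\<phi> 0 = 0" using E[of 0] by (simp add: prob_space)
  show "\<phi> q \<le> \<phi> r" if "0 \<le> q" "q \<le> r" for q r
  proof -
    have "(\<integral>\<omega>. exp (- r * S 1 \<omega>) \<partial>M) \<le> (\<integral>\<omega>. exp (- q * S 1 \<omega>) \<partial>M)"
    proof (rule integral_mono_AE)
      show "AE \<omega> in M. exp (- r * S 1 \<omega>) \<le> exp (- q * S 1 \<omega>)"
        using S1 by eventually_elim (use that in \<open>auto intro: mult_right_mono\<close>)
    qed (use int that in auto)
    then show ?thesis using E that by simp
  qed
  have "continuous_on {0..} (\<lambda>q. \<integral>\<omega>. exp (- q * S 1 \<omega>) \<partial>M)"
  proof (rule continuous_on_sequentiallyI)
    fix v q assume v: "\<forall>n. v n \<in> {0..}" and "q \<in> {0..}" and lim: "v \<longlonglongrightarrow> (q::real)"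
    show "(\<lambda>n. \<integral>\<omega>. exp (- v n * S 1 \<omega>) \<partial>M) \<longlonglongrightarrow> (\<integral>\<omega>. exp (- q * S 1 \<omega>) \<partial>M)"
    proof (rule integral_dominated_convergence)
      show "integrable M (\<lambda>_. 1 :: real)" by simp
      show "AE \<omega> in M. norm (exp (- v n * S 1 \<omega>)) \<le> 1" for n
        using S1 by eventually_elim (use v in \<open>auto intro!: mult_nonneg_nonneg\<close>)
      show "AE \<omega> in M. (\<lambda>n. exp (- v n * S 1 \<omega>)) \<longlonglongrightarrow> exp (- q * S 1 \<omega>)"
        by (intro AE_I2 tendsto_intros lim)
    qed auto
  qed
  then have "continuous_on {0..} (\<lambda>q. - ln (\<integral>\<omega>. exp (- q * S 1 \<omega>) \<partial>M))"
    by (intro continuous_intros) (use E in auto)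
  then show "continuous_on {0..} \<phi>" by (rule continuous_on_eq) (use E in auto)
qed

lemma (in prob_space) laplace_exponent_compose:
  assumes S: "subordinator M S" and \<phi>: "laplace_exponent M S \<phi>"
    and g: "g \<in> borel_measurable borel" "\<And>y. 0 \<le> g y \<and> g y \<le> C"
  shows "(\<lambda>y. \<phi> (g y)) \<in> borel_measurable borel" "\<And>y. 0 \<le> \<phi> (g y) \<and> \<phi> (g y) \<le> \<phi> C"
proof -
  note p = laplace_exponent_props[OF S \<phi>]
  have "continuous_on UNIV (\<lambda>q. \<phi> (max 0 q))"
    by (rule continuous_on_compose2[OF p(3)]) (auto intro!: continuous_intros)
  then have "(\<lambda>q. \<phi> (max 0 q)) \<in> borel_measurable borel" by (rule borel_measurable_continuous_onI)
  from measurable_compose[OF g(1) this] show "(\<lambda>y. \<phi> (g y)) \<in> borel_measurable borel"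
    using g(2) by (simp add: max_absorb2)
  show "0 \<le> \<phi> (g y) \<and> \<phi> (g y) \<le> \<phi> C" for y
    using p(1) p(2)[of 0 "g y"] p(2)[of "g y" C] g(2)[of y] by simp
qed

lemma interval_integral_0_ereal:
  fixes F :: "real \<Rightarrow> real"
  assumes "0 \<le> c"
  shows "(LBINT t=0..ereal c. F t) = (\<integral>t. indicator {0..<c} t * F t \<partial>lborel)"
  using interval_integral_Ico[of 0 c F] assms
  by (simp add: set_lebesgue_integral_def zero_ereal_def)

text \<open>\<open>start\<close> leaves out x = 0, where \<tau>* = 0 almost surely; that case is
  settled in the final proof.\<close>

locale time_changed_Brownian_motion = prob_space M for M :: "'w measure" +
  fixes B X S :: "real \<Rightarrow> 'w \<Rightarrow> real" and \<phi> :: "real \<Rightarrow> real" and x \<alpha> :: real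
  assumes S_strict: "strictly_increasing_subordinator M S"
    and Laplace: "laplace_exponent M S \<phi>"
    and bm: "standard_brownian_motion M B"
    and drift: "0 \<le> \<alpha>" and start: "0 < x"
    and X_eq: "\<And>t \<omega>. X t \<omega> = x + B t \<omega> - \<alpha> * t"
    and indep: "independent_processes M X S"
begin

section \<open>Good paths and the clock\<close>

lemma S_sub: "subordinator M S"
  using S_strict by (simp add: strictly_increasing_subordinator_def)

text \<open>Collects the almost sure properties once, so that the arguments on the clock become
  deterministic.\<close>

definition good_path :: "'w \<Rightarrow> bool" where
  "good_path \<omega> \<longleftrightarrow> continuous_on {0..} (\<lambda>t. X t \<omega>) \<and> X 0 \<omega> = x \<and> time_change (\<lambda>t. S t \<omega>) \<and> (\<exists>t\<ge>0. X t \<omega> \<le> 0)"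

lemma AE_good_path: "AE \<omega> in M. good_path \<omega>"
proof -
  have "AE \<omega> in M. B 0 \<omega> = 0" "AE \<omega> in M. continuous_on {0..} (\<lambda>t. B t \<omega>)"
    using bm by (auto simp: standard_brownian_motion_def)
  moreover have "AE \<omega> in M. S 0 \<omega> = 0" "AE \<omega> in M. cadlag (\<lambda>t. S t \<omega>)"
    "AE \<omega> in M. strict_mono_on {0..} (\<lambda>t. S t \<omega>)"
    using S_strict by (auto simp: strictly_increasing_subordinator_def subordinator_def levy_process_def)
  moreover have "AE \<omega> in M. \<exists>t\<ge>0. X t \<omega> \<le> 0"
    by (rule drifted_Brownian_motion_nonpos[OF bm X_eq drift]) (use start in auto)
  ultimately show ?thesis
  proof eventually_elim
    case (elim \<omega>)
    have "continuous_on {0..} (\<lambda>t. X t \<omega>)" unfolding X_eq using elim by (intro continuous_intros)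
    moreover have "X 0 \<omega> = x" using elim by (simp add: X_eq)
    moreover have "time_change (\<lambda>t. S t \<omega>)"
      by unfold_locales (use elim in \<open>auto simp: cadlag_def\<close>)
    ultimately show ?case using elim by (simp add: good_path_def)
  qed
qed

definition X_star :: "real \<Rightarrow> 'w \<Rightarrow> real" where
  "X_star t \<omega> = X (inverse_process S t \<omega>) \<omega>"

definition clock :: "(real \<Rightarrow> real) \<Rightarrow> 'w \<Rightarrow> real" where
  "clock g \<omega> = (LBINT t=0..hitting_time_zero X_star \<omega>. g (X_star t \<omega>))"

lemma X_star_eq: "X_star t \<omega> = X (right_inverse (\<lambda>t. S t \<omega>) t) \<omega>"
  by (simp add: X_star_def inverse_process_def right_inverse_def)

lemma good_path_hitting:
  assumes "good_path \<omega>"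
  shows "\<exists>\<tau>>0. X \<tau> \<omega> = 0 \<and> (\<forall>t. 0 \<le> t \<and> t < \<tau> \<longrightarrow> 0 < X t \<omega>) \<and>
    hitting_time_zero X_star \<omega> = ereal (Sup ((\<lambda>t. S t \<omega>) ` {0..<\<tau>}))"
proof -
  from assms obtain v where X: "continuous_on {0..} (\<lambda>t. X t \<omega>)" "X 0 \<omega> = x" and tc: "time_change (\<lambda>t. S t \<omega>)"
    and v: "0 \<le> v" "X v \<omega> \<le> 0" by (auto simp: good_path_def)
  obtain \<tau> where \<tau>: "0 < \<tau>" "X \<tau> \<omega> = 0" "\<And>t. 0 \<le> t \<Longrightarrow> t < \<tau> \<Longrightarrow> 0 < X t \<omega>"
    using first_zero[OF X(1) _ v] X(2) start by auto
  have "hitting_time_zero X_star \<omega> = ereal (Sup ((\<lambda>t. S t \<omega>) ` {0..<\<tau>}))"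
    using time_change.hitting_time_time_changed[where s = "\<lambda>t. S t \<omega>" and f = "\<lambda>t. X t \<omega>", OF tc \<tau>]
    by (simp add: hitting_time_zero_def X_star_eq)
  with \<tau> show ?thesis by blast
qed

text \<open>The interface to a good path: c is the left limit of S at the hitting time of X, and
  later proofs refer to c alone. Positivity of X* before c means that only values of g on the
  positive half line enter the clock.\<close>

lemma good_path_clock:
  assumes "good_path \<omega>"
  shows "\<exists>c>0. hitting_time_zero X_star \<omega> = ereal c \<and> (\<forall>g. clock g \<omega> = (\<integral>t. indicator {0..<c} t * g (X_star t \<omega>) \<partial>lborel)) \<and>
    (\<forall>t. 0 \<le> t \<and> t < c \<longrightarrow> 0 < X_star t \<omega>) \<and>
    (\<forall>g\<in>borel_measurable borel. (\<lambda>t. indicator {0..<c} t * g (X_star t \<omega>) :: real) \<in> borel_measurable lborel)"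
proof -
  obtain \<tau> where \<tau>: "0 < \<tau>" "X \<tau> \<omega> = 0" "\<And>t. 0 \<le> t \<Longrightarrow> t < \<tau> \<Longrightarrow> 0 < X t \<omega>"
    "hitting_time_zero X_star \<omega> = ereal (Sup ((\<lambda>t. S t \<omega>) ` {0..<\<tau>}))"
    using good_path_hitting[OF assms] by blast
  from assms have tc: "time_change (\<lambda>t. S t \<omega>)" and X: "continuous_on {0..} (\<lambda>t. X t \<omega>)"
    by (auto simp: good_path_def)
  note sb = time_change.Sup_before[OF tc \<tau>(1)]
  show ?thesis
  proof (intro exI[of _ "Sup ((\<lambda>t. S t \<omega>) ` {0..<\<tau>})"] conjI sb(5) \<tau>(4) allI impI ballI)
    show "clock g \<omega> = (\<integral>t. indicator {0..<Sup ((\<lambda>t. S t \<omega>) ` {0..<\<tau>})} t * g (X_star t \<omega>) \<partial>lborel)" for g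
      unfolding clock_def \<tau>(4) by (rule interval_integral_0_ereal) (use sb(5) in simp)
    show "0 < X_star t \<omega>" if "0 \<le> t \<and> t < Sup ((\<lambda>t. S t \<omega>) ` {0..<\<tau>})" for t
      unfolding X_star_eq using sb(3)[of t] that \<tau>(3) by blast
    show "(\<lambda>t. indicator {0..<Sup ((\<lambda>t. S t \<omega>) ` {0..<\<tau>})} t * g (X_star t \<omega>)) \<in> borel_measurable lborel"
      if g: "g \<in> borel_measurable borel" for g :: "real \<Rightarrow> real"
    proof -
      have "\<exists>v\<ge>0. t < S v \<omega>" if "t < Sup ((\<lambda>t. S t \<omega>) ` {0..<\<tau>})" for t using sb(2)[OF that] by blast
      from time_change.measurable_time_changed[where s = "\<lambda>t. S t \<omega>" and f = "\<lambda>t. X t \<omega>"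
          and c = "Sup ((\<lambda>t. S t \<omega>) ` {0..<\<tau>})", OF tc this X g]
      show ?thesis by (simp add: X_star_eq)
    qed
  qed
qed

lemma \<phi>_props: "\<phi> 0 = 0" "\<And>q r. 0 \<le> q \<Longrightarrow> q \<le> r \<Longrightarrow> \<phi> q \<le> \<phi> r" "continuous_on {0..} \<phi>"
  using laplace_exponent_props[OF S_sub Laplace] by auto

lemmas \<phi>_compose = laplace_exponent_compose[OF S_sub Laplace]

text \<open>Path by path the grid functional \<open>w\<close> tends to \<open>Q\<close>, the
  functional stopped at the first time below \<epsilon> or at the horizon N. The mean of
  \<open>Q\<close> is exactly \<psi> x for all \<epsilon> > 0 and N, so the second limit only
  concerns the convergence of \<open>Q\<close> to exp (-clock).\<close>

lemma expectation_continuous: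
  assumes a: "0 \<le> a" and g: "continuous_on UNIV g" "\<And>y. 0 \<le> g y \<and> g y \<le> C" "\<forall>y\<ge>a. g y = 0"
    and sol: "nonneg_riccati_solution \<alpha> a (\<lambda>s. \<phi> (g s)) u" and u: "continuous_on {0..} u"
  shows "(\<lambda>\<omega>. exp (- clock g \<omega>)) \<in> borel_measurable (completion M)"
    and "(\<integral>\<omega>. exp (- clock g \<omega>) \<partial>completion M) = riccati_potential u x"
proof -
  define k where "k y = \<phi> (g y)" for y
  have kc: "continuous_on UNIV k" unfolding k_def[abs_def]
    by (rule continuous_on_compose2[OF \<phi>_props(3) g(1)]) (use g(2) in auto)
  note k = kc \<phi>_compose(2)[OF borel_measurable_continuous_onI[OF g(1)] g(2), folded k_def]
  have ka: "k y = 0" if "a \<le> y" for y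
    using \<phi>_props(1) g(3) that by (simp add: k_def)
  have km [measurable]: "k \<in> borel_measurable borel" using k(1) by (rule borel_measurable_continuous_onI)
  have gm [measurable]: "g \<in> borel_measurable borel" using g(1) by (rule borel_measurable_continuous_onI)
  have u0: "\<forall>r\<ge>0. 0 \<le> u r" using sol by (simp add: nonneg_riccati_solution_def)
  define \<psi> where "\<psi> = riccati_potential u"
  note \<psi> = riccati_potential_props[OF u u0, folded \<psi>_def]
  have \<psi>m [measurable]: "\<psi> \<in> borel_measurable borel" using \<psi>(1) by (rule borel_measurable_continuous_onI)
  have Bm: "B t \<in> borel_measurable M" if "0 \<le> t" for t
    using bm that by (auto simp: standard_brownian_motion_def stoch_process_def)
  have Sm: "S t \<in> borel_measurable M" if "0 \<le> t" for t
    using S_sub that by (auto simp: subordinator_def levy_process_def stoch_process_def)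
  define h where "h n = 1 / real (Suc n)" for n
  have h: "0 < h n" for n by (simp add: h_def)
  have Xhm [measurable]: "X (real i * h n) \<in> borel_measurable M" for i n
  proof -
    have "X (real i * h n) = (\<lambda>\<omega>. x + B (real i * h n) \<omega> - \<alpha> * (real i * h n))" by (auto simp: X_eq)
    then show ?thesis using Bm[of "real i * h n"] h[of n] by simp
  qed
  have Shm [measurable]: "S (real i * h n) \<in> borel_measurable M" for i n
    using Sm[of "real i * h n"] h[of n] by simp
  define w where "w \<epsilon> N n \<omega> = stopped_weight \<epsilon> \<psi> (\<lambda>i. X (i * h n) \<omega>)
      (\<lambda>i. exp (- g (X (i * h n) \<omega>) * (S (Suc i * h n) \<omega> - S (i * h n) \<omega>))) (N * Suc n)" for \<epsilon> N n \<omega>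
  have wm: "w \<epsilon> N n \<in> borel_measurable M" for \<epsilon> N n
    unfolding w_def by measurable
  have w1: "AE \<omega> in M. \<bar>w \<epsilon> N n \<omega>\<bar> \<le> 1" for \<epsilon> N n
    using AE_good_path
  proof eventually_elim
    case (elim \<omega>)
    then have tc: "time_change (\<lambda>t. S t \<omega>)" by (simp add: good_path_def)
    show ?case unfolding w_def
    proof (rule abs_stopped_weight_le)
      fix i
      have "S (i * h n) \<omega> \<le> S (Suc i * h n) \<omega>"
        by (rule time_change.s_le[OF tc]) (use h[of n] in \<open>auto intro!: mult_right_mono\<close>)
      then show "0 \<le> exp (- g (X (i * h n) \<omega>) * (S (Suc i * h n) \<omega> - S (i * h n) \<omega>)) \<and>
          exp (- g (X (i * h n) \<omega>) * (S (Suc i * h n) \<omega> - S (i * h n) \<omega>)) \<le> 1"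
        using g(2)[of "X (i * h n) \<omega>"] by simp
    qed (rule \<psi>(2))
  qed
  define Q where "Q \<epsilon> N \<omega> = exp (- (\<integral>t. indicator {0..<S (first_below \<epsilon> (\<lambda>t. X t \<omega>) (real N)) \<omega>} t *
        g (X (right_inverse (\<lambda>t. S t \<omega>) t) \<omega>) \<partial>lborel)) * \<psi> (X (first_below \<epsilon> (\<lambda>t. X t \<omega>) (real N)) \<omega>)" for \<epsilon> N \<omega>
  have wQ: "AE \<omega> in M. (\<lambda>n. w \<epsilon> N n \<omega>) \<longlonglongrightarrow> Q \<epsilon> N \<omega>" for \<epsilon> N
    using AE_good_path
  proof eventually_elim
    case (elim \<omega>)
    then have tc: "time_change (\<lambda>t. S t \<omega>)" and Xc: "continuous_on {0..} (\<lambda>t. X t \<omega>)" by (auto simp: good_path_def)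
    show ?case unfolding w_def Q_def h_def
      by (rule time_change.stopped_weight_tendsto[OF tc Xc g(1) \<psi>(1) g(2)])
  qed
  have Qm: "Q \<epsilon> N \<in> borel_measurable (completion M)"
    and wQlim: "(\<lambda>n. \<integral>\<omega>. w \<epsilon> N n \<omega> \<partial>completion M) \<longlonglongrightarrow> (\<integral>\<omega>. Q \<epsilon> N \<omega> \<partial>completion M)" for \<epsilon> N
    using completion_bounded_limit[OF prob_space_axioms measurable_completion[OF wm] w1 wQ] by auto
  have QE: "(\<integral>\<omega>. Q \<epsilon> N \<omega> \<partial>completion M) = \<psi> x" if \<epsilon>: "0 < \<epsilon>" for \<epsilon> N
  proof -
    note T = riccati_potential_Taylor[OF sol[folded k_def] u a drift k ka \<epsilon>, folded \<psi>_def]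
    obtain K where K: "\<phi> C \<le> K" "\<And>y. 0 \<le> y \<Longrightarrow> \<bar>- 2 * u y * \<psi> y\<bar> \<le> K \<and> \<bar>(2 * k y - 4 * \<alpha> * u y) * \<psi> y\<bar> \<le> K"
      using T(2) by auto
    have "(\<lambda>n. \<integral>\<omega>. stopped_weight \<epsilon> \<psi> (\<lambda>i. X (i * h n) \<omega>) (\<lambda>i. exp (- h n * k (X (i * h n) \<omega>)))
            (N * Suc n) \<partial>M) \<longlonglongrightarrow> \<psi> x"
      unfolding h_def
    proof (rule stopped_Feynman_Kac_limit[OF bm X_eq T(1)])
      show "0 \<le> k y \<and> k y \<le> K" for y using k(2)[of y] K(1) by linarith
      show "\<bar>- 2 * u y * \<psi> y\<bar> \<le> K \<and> \<bar>(2 * k y - 4 * \<alpha> * u y) * \<psi> y\<bar> \<le> K" if "\<epsilon> \<le> y" for y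
        by (rule K(2)) (use that \<epsilon> in linarith)
    qed (use \<psi>(2) T(3) in auto)
    moreover have "(\<integral>\<omega>. w \<epsilon> N n \<omega> \<partial>completion M) =
        (\<integral>\<omega>. stopped_weight \<epsilon> \<psi> (\<lambda>i. X (i * h n) \<omega>) (\<lambda>i. exp (- h n * k (X (i * h n) \<omega>))) (N * Suc n) \<partial>M)" for n
      unfolding integral_completion[OF wm] unfolding w_def k_def
      by (rule Laplace_substitution[OF indep S_sub Laplace _ gm \<psi>m _ \<psi>(2) h]) (use km g(2) in \<open>auto simp: k_def[abs_def]\<close>)
    ultimately have "(\<lambda>n. \<integral>\<omega>. w \<epsilon> N n \<omega> \<partial>completion M) \<longlonglongrightarrow> \<psi> x" by simp
    with wQlim[of \<epsilon> N] show ?thesis by (rule LIMSEQ_unique)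
  qed
  have Q1: "AE \<omega> in M. \<bar>Q \<epsilon> N \<omega>\<bar> \<le> 1" for \<epsilon> N
  proof (rule AE_I2)
    fix \<omega>
    have "0 \<le> (\<integral>t. indicator {0..<S (first_below \<epsilon> (\<lambda>t. X t \<omega>) (real N)) \<omega>} t *
        g (X (right_inverse (\<lambda>t. S t \<omega>) t) \<omega>) \<partial>lborel)"
      by (rule Bochner_Integration.integral_nonneg) (use g(2) in auto)
    then show "\<bar>Q \<epsilon> N \<omega>\<bar> \<le> 1"
      unfolding Q_def abs_mult by (intro mult_le_one) (use \<psi>(2) in auto)
  qed
  have Qlim: "AE \<omega> in M. (\<lambda>n. Q (1 / real (Suc n)) n \<omega>) \<longlonglongrightarrow> exp (- clock g \<omega>)"
    using AE_good_path
  proof eventually_elim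
    case (elim \<omega>)
    then have tc: "time_change (\<lambda>t. S t \<omega>)" and Xc: "continuous_on {0..} (\<lambda>t. X t \<omega>)" by (auto simp: good_path_def)
    obtain \<tau> where \<tau>: "0 < \<tau>" "X \<tau> \<omega> = 0" "\<And>t. 0 \<le> t \<Longrightarrow> t < \<tau> \<Longrightarrow> 0 < X t \<omega>"
      "hitting_time_zero X_star \<omega> = ereal (Sup ((\<lambda>t. S t \<omega>) ` {0..<\<tau>}))"
      using good_path_hitting[OF elim] by blast
    have "clock g \<omega> = (\<integral>t. indicator {0..<Sup ((\<lambda>t. S t \<omega>) ` {0..<\<tau>})} t * g (X_star t \<omega>) \<partial>lborel)"
      unfolding clock_def \<tau>(4)
      by (rule interval_integral_0_ereal) (use time_change.Sup_before(5)[OF tc \<tau>(1)] in simp)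
    moreover have "(\<lambda>n. Q (1 / real (Suc n)) n \<omega>) \<longlonglongrightarrow>
        exp (- (\<integral>t. indicator {0..<Sup ((\<lambda>t. S t \<omega>) ` {0..<\<tau>})} t * g (X_star t \<omega>) \<partial>lborel))"
      unfolding Q_def X_star_eq
      by (rule time_change.stopped_integral_tendsto[OF tc \<tau>(1,2) \<tau>(3) Xc gm \<psi>(1,4) g(2)])
    ultimately show ?case by simp
  qed
  show "(\<lambda>\<omega>. exp (- clock g \<omega>)) \<in> borel_measurable (completion M)"
    by (rule completion_bounded_limit(1)[OF prob_space_axioms Qm Q1 Qlim])
  have "(\<lambda>n. \<integral>\<omega>. Q (1 / real (Suc n)) n \<omega> \<partial>completion M) \<longlonglongrightarrow> (\<integral>\<omega>. exp (- clock g \<omega>) \<partial>completion M)"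
    by (rule completion_bounded_limit(2)[OF prob_space_axioms Qm Q1 Qlim])
  then show "(\<integral>\<omega>. exp (- clock g \<omega>) \<partial>completion M) = riccati_potential u x"
    by (simp add: QE \<psi>_def LIMSEQ_const_iff)
qed

section \<open>From continuous to Borel functions\<close>

lemma \<phi>_nonneg: "0 \<le> q \<Longrightarrow> 0 \<le> \<phi> q"
  using \<phi>_props(1) \<phi>_props(2)[of 0 q] by simp

lemma clock_nonneg:
  assumes "good_path \<omega>" "\<And>y. 0 \<le> g y"
  shows "0 \<le> clock g \<omega>"
proof -
  obtain c where "clock g \<omega> = (\<integral>t. indicator {0..<c} t * g (X_star t \<omega>) \<partial>lborel)"
    using good_path_clock[OF assms(1)] by blast
  then show ?thesis using assms(2) by (simp add: Bochner_Integration.integral_nonneg)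
qed

text \<open>Dominated convergence on the bounded interval before the hitting time. Convergence is
  asked for almost all times rather than for all values, which is the form that the null-set
  argument supplies.\<close>

lemma clock_tendsto:
  assumes \<omega>: "good_path \<omega>"
    and g: "\<And>n. g n \<in> borel_measurable borel" "f \<in> borel_measurable borel" "\<And>n y. 0 \<le> g n y \<and> g n y \<le> C"
    and lim: "AE t in lborel. 0 \<le> t \<and> ereal t < hitting_time_zero X_star \<omega> \<longrightarrow> (\<lambda>n. g n (X_star t \<omega>)) \<longlonglongrightarrow> f (X_star t \<omega>)"
  shows "(\<lambda>n. clock (g n) \<omega>) \<longlonglongrightarrow> clock f \<omega>"
proof -
  obtain c where c: "0 < c" "hitting_time_zero X_star \<omega> = ereal c"
    "\<And>g. clock g \<omega> = (\<integral>t. indicator {0..<c} t * g (X_star t \<omega>) \<partial>lborel)"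
    "\<And>g :: real \<Rightarrow> real. g \<in> borel_measurable borel \<Longrightarrow> (\<lambda>t. indicator {0..<c} t * g (X_star t \<omega>)) \<in> borel_measurable lborel"
    using good_path_clock[OF \<omega>] by blast
  show ?thesis unfolding c(3)
  proof (rule integral_dominated_convergence)
    show "integrable lborel (\<lambda>t. C * indicator {0..<c} t)" using c(1) by simp
    show "AE t in lborel. norm (indicator {0..<c} t * g n (X_star t \<omega>)) \<le> C * indicator {0..<c} t" for n
      using g(3)[of n] by (intro AE_I2) (auto simp: indicator_def)
    show "AE t in lborel. (\<lambda>n. indicator {0..<c} t * g n (X_star t \<omega>)) \<longlonglongrightarrow> indicator {0..<c} t * f (X_star t \<omega>)"
      using lim by eventually_elim (auto simp: c(2) indicator_def)
  qed (use c(4) g in auto)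
qed

text \<open>Continuous functions supported in U increase to its indicator. For each of them the
  Riccati solution is at most the integral of \<phi> (g m) over [0, a], hence at most \<phi> 1 times
  the measure of U in [0, a]; the resulting lower bound survives the limit.\<close>

lemma expectation_open:
  assumes a: "0 \<le> a" and U: "open U" "U \<subseteq> {..<a}"
  shows "(\<lambda>\<omega>. exp (- clock (indicator U) \<omega>)) \<in> borel_measurable (completion M)"
    and "exp (- 2 * x * (\<phi> 1 * measure lborel (U \<inter> {0..a}))) \<le> (\<integral>\<omega>. exp (- clock (indicator U) \<omega>) \<partial>completion M)"
proof -
  \<comment> \<open>The distance to the closed complement is positive exactly on U, so its capped
    multiples tend to the indicator. \<open>U \<subseteq> {..<a}\<close> makes the complement
    nonempty and \<open>g m\<close> zero from a on.\<close>
  define g where "g m y = min 1 (real m * infdist y (- U))" for m y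
  have ne: "- U \<noteq> {}" and cl: "closed (- U)" using U by auto
  have gc: "continuous_on UNIV (g m)" for m
    unfolding g_def[abs_def] by (intro continuous_intros)
  then have gm: "g m \<in> borel_measurable borel" for m by (rule borel_measurable_continuous_onI)
  have g01: "0 \<le> g m y \<and> g m y \<le> 1" for m y by (simp add: g_def infdist_nonneg)
  have gU: "g m y = 0" if "y \<notin> U" for m y using that by (simp add: g_def)
  have glim: "(\<lambda>m. g m y) \<longlonglongrightarrow> indicator U y" for y
  proof (cases "y \<in> U")
    case True
    then have d: "0 < infdist y (- U)" using infdist_pos_not_in_closed[OF cl ne] by auto
    have "\<forall>\<^sub>F m in sequentially. 1 / infdist y (- U) < real m"
      using filterlim_real_sequentially by (simp add: filterlim_at_top_dense)
    then have "\<forall>\<^sub>F m in sequentially. g m y = 1"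
      by eventually_elim (use d in \<open>simp add: g_def field_simps\<close>)
    then show ?thesis using True by (simp add: tendsto_eventually)
  qed (simp add: gU)
  have Um: "(indicator U :: real \<Rightarrow> real) \<in> borel_measurable borel" using U by (intro borel_measurable_indicator) auto
  note k = \<phi>_compose[OF gm g01]
  have "\<exists>u. nonneg_riccati_solution \<alpha> a (\<lambda>y. \<phi> (g m y)) u \<and> continuous_on {0..} u" for m
    by (rule riccati_exists[OF a drift k])
  then obtain u where u: "\<And>m. nonneg_riccati_solution \<alpha> a (\<lambda>y. \<phi> (g m y)) (u m)" "\<And>m. continuous_on {0..} (u m)"
    by metis
  have ga: "\<forall>y\<ge>a. g m y = 0" for m using U by (auto intro!: gU)
  note E = expectation_continuous[OF a gc g01 ga u]
  have lower: "exp (- 2 * x * (\<phi> 1 * measure lborel (U \<inter> {0..a}))) \<le> (\<integral>\<omega>. exp (- clock (g m) \<omega>) \<partial>completion M)" for m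
  proof -
    have "U \<inter> {0..a} \<in> sets borel" using U by auto
    moreover have "emeasure lborel (U \<inter> {0..a}) \<le> emeasure lborel {0..a}" by (rule emeasure_mono) auto
    then have fin: "emeasure lborel (U \<inter> {0..a}) < \<infinity>" using a by (simp add: le_less_trans)
    ultimately have iU: "integrable lborel (indicator (U \<inter> {0..a}) :: real \<Rightarrow> real)" by simp
    have "integral {0..a} (\<lambda>y. \<phi> (g m y)) = (\<integral>y. indicator {0..a} y * \<phi> (g m y) \<partial>lborel)"
      using bounded_measurable_integrable_on(3)[OF k, of 0 a m] by (simp add: set_lebesgue_integral_def)
    also have "\<dots> \<le> (\<integral>y. \<phi> 1 * indicator (U \<inter> {0..a}) y \<partial>lborel)"
    proof (rule integral_mono)
      show "integrable lborel (\<lambda>y. indicator {0..a} y * \<phi> (g m y))"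
        using bounded_measurable_integrable_on(1)[OF k, of 0 a m] by (simp add: set_integrable_def)
      show "indicator {0..a} y * \<phi> (g m y) \<le> \<phi> 1 * indicator (U \<inter> {0..a}) y" for y
        using k(2)[of m y] gU[of y m] \<phi>_props(1) by (auto simp: indicator_def)
    qed (use iU in auto)
    also have "\<dots> = \<phi> 1 * measure lborel (U \<inter> {0..a})" using fin U by simp
    finally have kU: "integral {0..a} (\<lambda>y. \<phi> (g m y)) \<le> \<phi> 1 * measure lborel (U \<inter> {0..a})" .
    note b = riccati_solution_bounds[OF u(1)[of m] a drift k]
    have "integral {0..x} (u m) \<le> integral {0..x} (\<lambda>_. \<phi> 1 * measure lborel (U \<inter> {0..a}))"
    proof (rule integral_le)
      show "u m integrable_on {0..x}"
        by (rule integrable_continuous_real[OF continuous_on_subset[OF u(2)]]) auto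
    qed (use b(3) kU in \<open>auto intro: order_trans\<close>)
    then have "integral {0..x} (u m) \<le> x * (\<phi> 1 * measure lborel (U \<inter> {0..a}))" using start by (simp add: mult_ac)
    then show ?thesis by (simp add: E(2) riccati_potential_def mult.assoc)
  qed
  have lim: "AE \<omega> in M. (\<lambda>m. exp (- clock (g m) \<omega>)) \<longlonglongrightarrow> exp (- clock (indicator U) \<omega>)"
    using AE_good_path
  proof eventually_elim
    case (elim \<omega>)
    show ?case
      by (intro tendsto_intros clock_tendsto[OF elim gm Um g01]) (use glim in auto)
  qed
  have b1: "AE \<omega> in M. \<bar>exp (- clock (g m) \<omega>)\<bar> \<le> 1" for m
    using AE_good_path by eventually_elim (use clock_nonneg g01 in auto)
  note L = completion_bounded_limit[OF prob_space_axioms E(1) b1 lim]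
  show "(\<lambda>\<omega>. exp (- clock (indicator U) \<omega>)) \<in> borel_measurable (completion M)" by (rule L(1))
  show "exp (- 2 * x * (\<phi> 1 * measure lborel (U \<inter> {0..a}))) \<le> (\<integral>\<omega>. exp (- clock (indicator U) \<omega>) \<partial>completion M)"
    by (rule LIMSEQ_le_const[OF L(2)]) (intro exI[of _ 0] allI impI lower)
qed

text \<open>The open-set bound replaces an occupation density for the time-changed process.\<close>

lemma null_set_not_visited:
  assumes a: "0 \<le> a" and N: "negligible N" "N \<subseteq> {0..a}"
  shows "AE \<omega> in M. AE t in lborel. 0 \<le> t \<and> ereal t < hitting_time_zero X_star \<omega> \<longrightarrow> X_star t \<omega> \<notin> N"
proof -
  have "\<exists>T. open T \<and> N \<subseteq> T \<and> emeasure lebesgue (T - N) < ennreal (1 / real (Suc j))" for j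
  proof -
    have "N \<in> sets lebesgue" using N(1) by (rule negligible_imp_sets)
    from sets_lebesgue_outer_open[OF this, of "1 / real (Suc j)"] show ?thesis
      by (metis divide_pos_pos of_nat_0_less_iff zero_less_Suc zero_less_one)
  qed
  then obtain T where T: "\<And>j. open (T j)" "\<And>j. N \<subseteq> T j" "\<And>j. emeasure lebesgue (T j - N) < ennreal (1 / real (Suc j))"
    by metis
  \<comment> \<open>The bound for open sets asks for a right end; a + 1 instead of a keeps N inside
    even if N contains a.\<close>
  define U where "U j = T j \<inter> {..<a + 1}" for j
  have U: "open (U j)" "U j \<subseteq> {..<a + 1}" "N \<subseteq> U j" for j
    using T N by (auto simp: U_def)
  have Um: "measure lborel (U j \<inter> {0..a + 1}) \<le> 1 / real (Suc j)" for j
  proof -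
    have s: "U j \<inter> {0..a + 1} \<in> sets borel" using U by auto
    have Tm: "T j \<in> sets lebesgue" "N \<in> sets lebesgue" using T(1) N(1) by (auto intro: negligible_imp_sets)
    have "emeasure lborel (U j \<inter> {0..a + 1}) = emeasure lebesgue (U j \<inter> {0..a + 1})" using s by simp
    also have "\<dots> \<le> emeasure lebesgue ((T j - N) \<union> N)"
      by (rule emeasure_mono) (use Tm in \<open>auto simp: U_def\<close>)
    also have "\<dots> \<le> emeasure lebesgue (T j - N) + emeasure lebesgue N"
      by (rule emeasure_subadditive) (use Tm in auto)
    also have "emeasure lebesgue N = 0" using N(1) by (simp add: negligible_iff_emeasure0 Tm)
    finally have "emeasure lborel (U j \<inter> {0..a + 1}) \<le> ennreal (1 / real (Suc j))" using T(3)[of j] by simp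
    then show ?thesis unfolding measure_def by (rule enn2real_leI[rotated]) simp
  qed
  have a1: "0 \<le> a + 1" using a by simp
  note E = expectation_open[OF a1 U(1,2)]
  \<comment> \<open>Z j is small exactly when the clock of \<open>U j\<close> is small. By the
    open-set bound its mean is at most 1 - exp (-2 x \<phi> 1 / (j + 1)), which tends to 0.\<close>
  define Z where "Z j \<omega> = 1 - exp (- clock (indicator (U j)) \<omega>)" for j \<omega>
  interpret C: prob_space "completion M" by (rule prob_space_completion)
  have Zm [measurable]: "Z j \<in> borel_measurable (completion M)" for j
    unfolding Z_def[abs_def] using E(1)[of j] by measurable
  have Z01: "AE \<omega> in completion M. 0 \<le> Z j \<omega> \<and> Z j \<omega> \<le> 1" for j
    using AE_completion[OF AE_good_path]
    by eventually_elim (use clock_nonneg[where g = "indicator (U j)"] in \<open>auto simp: Z_def\<close>)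
  have Zi: "integrable (completion M) (Z j)" for j
    by (rule C.integrable_const_bound[where B = 1]) (use Z01[of j] in auto)
  have Ei: "integrable (completion M) (\<lambda>\<omega>. exp (- clock (indicator (U j)) \<omega>))" for j
  proof -
    have "integrable (completion M) (\<lambda>\<omega>. 1 - Z j \<omega>)" using Zi[of j] by simp
    then show ?thesis by (simp add: Z_def)
  qed
  have Zb: "(\<integral>\<omega>. norm (Z j \<omega>) \<partial>completion M) \<le> 1 - exp (- 2 * x * (\<phi> 1 * (1 / real (Suc j))))" for j
  proof -
    have "(\<integral>\<omega>. norm (Z j \<omega>) \<partial>completion M) = (\<integral>\<omega>. Z j \<omega> \<partial>completion M)"
      by (rule integral_cong_AE) (use Z01[of j] in auto)
    also have "\<dots> = 1 - (\<integral>\<omega>. exp (- clock (indicator (U j)) \<omega>) \<partial>completion M)"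
      unfolding Z_def using Ei[of j] by (simp add: prob_space)
    also have "\<dots> \<le> 1 - exp (- 2 * x * (\<phi> 1 * measure lborel (U j \<inter> {0..a + 1})))" using E(2)[of j] by simp
    also have "\<dots> \<le> 1 - exp (- 2 * x * (\<phi> 1 * (1 / real (Suc j))))"
      using mult_left_mono[OF mult_left_mono[OF Um[of j] \<phi>_nonneg[of 1]], of "2 * x"] start by simp
    finally show ?thesis .
  qed
  have "(\<lambda>j. \<integral>\<omega>. norm (Z j \<omega>) \<partial>completion M) \<longlonglongrightarrow> 0"
  proof (rule Lim_null_comparison)
    have "(\<lambda>j. 1 - exp (- 2 * x * (\<phi> 1 * (1 / real (Suc j))))) \<longlonglongrightarrow> 1 - exp (- 2 * x * (\<phi> 1 * 0))"
      by (intro tendsto_intros LIMSEQ_Suc[OF lim_1_over_n])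
    then show "(\<lambda>j. 1 - exp (- 2 * x * (\<phi> 1 * (1 / real (Suc j))))) \<longlonglongrightarrow> 0" by simp
    show "\<forall>\<^sub>F j in sequentially. norm (\<integral>\<omega>. norm (Z j \<omega>) \<partial>completion M) \<le> 1 - exp (- 2 * x * (\<phi> 1 * (1 / real (Suc j))))"
    proof (intro always_eventually allI)
      fix j
      have "0 \<le> (\<integral>\<omega>. norm (Z j \<omega>) \<partial>completion M)" by (rule Bochner_Integration.integral_nonneg) simp
      with Zb[of j] show "norm (\<integral>\<omega>. norm (Z j \<omega>) \<partial>completion M) \<le> 1 - exp (- 2 * x * (\<phi> 1 * (1 / real (Suc j))))"
        by (simp only: real_norm_def abs_of_nonneg)
    qed
  qed
  \<comment> \<open>Convergence in mean gives almost sure convergence along a subsequence, which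
    suffices because the intersection \<open>G\<close> below lies in every
    \<open>U j\<close>.\<close>
  from tendsto_L1_AE_subseq[OF Zi this] obtain r where
    "AE \<omega> in completion M. (\<lambda>n. Z (r n) \<omega>) \<longlonglongrightarrow> 0" by blast
  then have "AE \<omega> in M. (\<lambda>n. Z (r n) \<omega>) \<longlonglongrightarrow> 0" by (simp only: AE_completion_iff)
  with AE_good_path show ?thesis
  proof eventually_elim
    case (elim \<omega>)
    obtain c where c: "0 < c" "hitting_time_zero X_star \<omega> = ereal c"
      "\<And>g. clock g \<omega> = (\<integral>t. indicator {0..<c} t * g (X_star t \<omega>) \<partial>lborel)"
      "\<And>g :: real \<Rightarrow> real. g \<in> borel_measurable borel \<Longrightarrow> (\<lambda>t. indicator {0..<c} t * g (X_star t \<omega>)) \<in> borel_measurable lborel"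
      using good_path_clock[OF elim(1)] by blast
    \<comment> \<open>N need not be Borel; the Borel set \<open>G\<close> contains it, and its clock
      is at most that of every \<open>U j\<close>, hence 0.\<close>
    define G where "G = (\<Inter>j. U j)"
    have G: "(indicator G :: real \<Rightarrow> real) \<in> borel_measurable borel"
      unfolding G_def using U(1) by (intro borel_measurable_indicator) auto
    have Uj: "(indicator (U j) :: real \<Rightarrow> real) \<in> borel_measurable borel" for j
      using U(1) by (intro borel_measurable_indicator) auto
    have int: "integrable lborel (\<lambda>t. indicator {0..<c} t * (indicator A (X_star t \<omega>) :: real))"
      if "(indicator A :: real \<Rightarrow> real) \<in> borel_measurable borel" for A
    proof (rule Bochner_Integration.integrable_bound)
      show "integrable lborel (indicator {0..<c} :: real \<Rightarrow> real)" using c(1) by simp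
    qed (use c(4)[OF that] in \<open>auto simp: indicator_def\<close>)
    have "clock (indicator G) \<omega> \<le> clock (indicator (U j)) \<omega>" for j
      unfolding c(3) by (rule integral_mono[OF int[OF G] int[OF Uj]]) (auto simp: indicator_def G_def)
    then have "1 - exp (- clock (indicator G) \<omega>) \<le> Z j \<omega>" for j by (simp add: Z_def)
    then have "1 - exp (- clock (indicator G) \<omega>) \<le> 0" by (intro LIMSEQ_le_const[OF elim(2)]) auto
    then have "clock (indicator G) \<omega> = 0"
      using clock_nonneg[OF elim(1), of "indicator G"] by simp
    then have "AE t in lborel. indicator {0..<c} t * (indicator G (X_star t \<omega>) :: real) = 0"
      unfolding c(3) by (subst (asm) integral_nonneg_eq_0_iff_AE[OF int[OF G]]) auto
    then show ?case
      by eventually_elim (use U(3) in \<open>auto simp: c(2) G_def indicator_def split: if_splits\<close>)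
  qed
qed

text \<open>Two limits have to match. On the right, \<phi> (h n) tends to \<phi> (g) in L1 on
  [0, a], and stability gives uniform convergence of the solutions. On the left, X* spends no time
  in the exceptional set, so the clocks converge.\<close>

lemma expectation_Borel:
  assumes a: "0 \<le> a" and g: "g \<in> borel_measurable borel" "\<And>y. 0 \<le> g y \<and> g y \<le> C" "\<And>y. a < y \<Longrightarrow> g y = 0"
    and sol: "nonneg_riccati_solution \<alpha> a (\<lambda>s. \<phi> (g s)) u" and u: "continuous_on {0..} u"
  shows "(\<lambda>\<omega>. exp (- clock g \<omega>)) \<in> borel_measurable (completion M)"
    and "(\<integral>\<omega>. exp (- clock g \<omega>) \<partial>completion M) = riccati_potential u x"
proof -
  have "g \<in> borel_measurable lebesgue" using g(1) by (intro measurable_completion) simp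
  then have "g measurable_on UNIV"
    by (intro lebesgue_measurable_imp_measurable_on) (auto simp: lebesgue_on_UNIV_eq)
  then obtain N0 G where N0: "negligible N0" and Gc: "\<And>n. continuous_on UNIV (G n)"
    and Glim: "\<And>y. y \<notin> N0 \<Longrightarrow> (\<lambda>n. G n y) \<longlonglongrightarrow> g y"
    unfolding measurable_on_def by auto
  \<comment> \<open>The point a is added because the cutoff in \<open>h\<close> vanishes there while
    g a may be nonzero.\<close>
  define N where "N = (N0 \<inter> {0..a}) \<union> {a}"
  have N: "negligible N" "N \<subseteq> {0..a}" unfolding N_def using N0 a by (auto intro: negligible_subset)
  \<comment> \<open>The first factor restores the bounds 0 and C; the second is a continuous cutoff
    that vanishes from a on and tends to 1 below a, as the continuous case requires.\<close>
  define h where "h n y = max 0 (min C (G n y)) * max 0 (min 1 (real n * (a - y)))" for n y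
  have C: "0 \<le> C" using g(2)[of 0] by linarith
  have hc: "continuous_on UNIV (h n)" for n
    unfolding h_def[abs_def] by (intro continuous_intros Gc)
  then have hm: "h n \<in> borel_measurable borel" for n by (rule borel_measurable_continuous_onI)
  have hC: "0 \<le> h n y \<and> h n y \<le> C" for n y
  proof -
    have "max 0 (min C (G n y)) * max 0 (min 1 (real n * (a - y))) \<le> C * 1"
      using C by (intro mult_mono) auto
    then show ?thesis by (simp add: h_def)
  qed
  have ha: "\<forall>y\<ge>a. h n y = 0" for n
  proof (intro allI impI)
    fix y assume that: "a \<le> y"
    have "real n * (a - y) \<le> 0" using that by (intro mult_nonneg_nonpos) auto
    then have "max 0 (min 1 (real n * (a - y))) = 0" by simp
    then show "h n y = 0" by (simp add: h_def)
  qed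
  have hlim: "(\<lambda>n. h n y) \<longlonglongrightarrow> g y" if "0 \<le> y" "y \<notin> N" for y
  proof (cases "y < a")
    case True
    have "y \<notin> N0" using that True by (auto simp: N_def)
    then have "(\<lambda>n. max 0 (min C (G n y))) \<longlonglongrightarrow> max 0 (min C (g y))"
      by (intro tendsto_intros Glim)
    moreover have "max 0 (min C (g y)) = g y" using g(2)[of y] by simp
    moreover have "\<forall>\<^sub>F n in sequentially. 1 / (a - y) < real n"
      using filterlim_real_sequentially by (simp add: filterlim_at_top_dense)
    then have "\<forall>\<^sub>F n in sequentially. max 0 (min 1 (real n * (a - y))) = 1"
      by eventually_elim (use True in \<open>simp add: field_simps max_def min_def\<close>)
    then have "(\<lambda>n. max 0 (min 1 (real n * (a - y)))) \<longlonglongrightarrow> 1" by (rule tendsto_eventually)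
    ultimately show ?thesis unfolding h_def using tendsto_mult by fastforce
  next
    case False
    with that have "a < y" by (auto simp: N_def)
    then show ?thesis using ha g(3) by simp
  qed
  note kh = \<phi>_compose[OF hm hC] and kg = \<phi>_compose[OF g(1,2)]
  have "\<exists>v. nonneg_riccati_solution \<alpha> a (\<lambda>y. \<phi> (h n y)) v \<and> continuous_on {0..} v" for n
    by (rule riccati_exists[OF a drift kh])
  then obtain v where v: "\<And>n. nonneg_riccati_solution \<alpha> a (\<lambda>y. \<phi> (h n y)) (v n)" "\<And>n. continuous_on {0..} (v n)"
    by metis
  note E = expectation_continuous[OF a hc hC ha v]
  define d where "d n = integral {0..a} (\<lambda>s. \<bar>\<phi> (h n s) - \<phi> (g s)\<bar>)" for n
  have d0: "d \<longlonglongrightarrow> 0"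
  proof -
    have km: "(\<lambda>s. \<bar>\<phi> (h n s) - \<phi> (g s)\<bar>) \<in> borel_measurable borel" for n
      using kh(1)[of n] kg(1) by measurable
    have kb: "0 \<le> \<bar>\<phi> (h n s) - \<phi> (g s)\<bar> \<and> \<bar>\<phi> (h n s) - \<phi> (g s)\<bar> \<le> \<phi> C" for n s
      using kh(2)[of n s] kg(2)[of s] by auto
    have "(\<lambda>n. \<integral>s. indicator {0..a} s * \<bar>\<phi> (h n s) - \<phi> (g s)\<bar> \<partial>lborel) \<longlonglongrightarrow> (\<integral>s. 0 \<partial>(lborel :: real measure))"
    proof (rule integral_dominated_convergence)
      show "integrable lborel (\<lambda>s. \<phi> C * indicator {0..a} s)" using a by simp
      show "AE s in lborel. norm (indicator {0..a} s * \<bar>\<phi> (h n s) - \<phi> (g s)\<bar>) \<le> \<phi> C * indicator {0..a} s" for n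
        using kb[of n] by (intro AE_I2) (auto simp: indicator_def)
      have "AE s in lebesgue. s \<notin> N" using N(1) by (intro AE_not_in) (simp add: negligible_iff_null_sets)
      then have "AE s in lborel. s \<notin> N" by (simp add: AE_completion_iff)
      then show "AE s in lborel. (\<lambda>n. indicator {0..a} s * \<bar>\<phi> (h n s) - \<phi> (g s)\<bar>) \<longlonglongrightarrow> 0"
      proof eventually_elim
        case (elim s)
        show ?case
        proof (cases "0 \<le> s")
          case True
          have "(\<lambda>n. \<phi> (h n s)) \<longlonglongrightarrow> \<phi> (g s)"
            by (rule continuous_on_tendsto_compose[OF \<phi>_props(3) hlim[OF True elim]]) (use g(2) hC in auto)
          then have "(\<lambda>n. \<bar>\<phi> (h n s) - \<phi> (g s)\<bar>) \<longlonglongrightarrow> \<bar>\<phi> (g s) - \<phi> (g s)\<bar>" by (intro tendsto_intros)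
          then have "(\<lambda>n. \<bar>\<phi> (h n s) - \<phi> (g s)\<bar>) \<longlonglongrightarrow> 0" by simp
          then show ?thesis by (rule tendsto_mult_right_zero)
        qed simp
      qed
      show "(\<lambda>s. indicator {0..a} s * \<bar>\<phi> (h n s) - \<phi> (g s)\<bar>) \<in> borel_measurable lborel" for n
        using km[of n] by measurable
    qed simp
    moreover have "d = (\<lambda>n. \<integral>s. indicator {0..a} s * \<bar>\<phi> (h n s) - \<phi> (g s)\<bar> \<partial>lborel)"
    proof
      show "d n = (\<integral>s. indicator {0..a} s * \<bar>\<phi> (h n s) - \<phi> (g s)\<bar> \<partial>lborel)" for n
        using bounded_measurable_integrable_on(3)[OF km kb, of 0 a n] by (simp add: d_def set_lebesgue_integral_def)
    qed
    ultimately show ?thesis by simp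
  qed
  define K where "K = exp (2 * (2 * (\<phi> C * a) + \<alpha>) * a)"
  have dn: "0 \<le> d n" for n unfolding d_def by (rule integral_Icc_nonneg) simp
  have vu: "\<bar>v n r - u r\<bar> \<le> d n * K" if "0 \<le> r" for n r
  proof (cases "r \<le> a")
    case True
    then show ?thesis
      using riccati_stability[OF v(1) sol a drift kh kg that True] by (simp add: d_def K_def)
  next
    case False
    then show ?thesis using v(1)[of n] sol dn[of n] by (simp add: nonneg_riccati_solution_def K_def)
  qed
  have "(\<lambda>n. integral {0..x} (v n)) \<longlonglongrightarrow> integral {0..x} u"
  proof (rule LIM_zero_cancel, rule Lim_null_comparison)
    have vi: "v n integrable_on {0..x}" and ui: "u integrable_on {0..x}" for n
      by (auto intro!: integrable_continuous_real continuous_on_subset[OF v(2)] continuous_on_subset[OF u])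
    have "\<bar>integral {0..x} (v n) - integral {0..x} u\<bar> \<le> x * (d n * K)" for n
    proof -
      have "\<bar>integral {0..x} (\<lambda>s. v n s - u s)\<bar> \<le> integral {0..x} (\<lambda>_. d n * K)"
        by (rule abs_integral_le) (use vi ui vu in \<open>auto intro: integrable_diff\<close>)
      also have "integral {0..x} (\<lambda>s. v n s - u s) = integral {0..x} (v n) - integral {0..x} u"
        using vi ui by (rule Henstock_Kurzweil_Integration.integral_diff)
      finally show ?thesis using start by (simp add: mult_ac)
    qed
    then show "\<forall>\<^sub>F n in sequentially. norm (integral {0..x} (v n) - integral {0..x} u) \<le> x * (d n * K)"
      by (simp add: always_eventually)
    show "(\<lambda>n. x * (d n * K)) \<longlonglongrightarrow> 0"
      by (intro tendsto_mult_right_zero tendsto_mult_left_zero d0)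
  qed
  then have "(\<lambda>n. riccati_potential (v n) x) \<longlonglongrightarrow> riccati_potential u x"
    unfolding riccati_potential_def by (intro tendsto_intros)
  then have l1: "(\<lambda>n. \<integral>\<omega>. exp (- clock (h n) \<omega>) \<partial>completion M) \<longlonglongrightarrow> riccati_potential u x"
    by (simp add: E(2))
  have lim: "AE \<omega> in M. (\<lambda>n. exp (- clock (h n) \<omega>)) \<longlonglongrightarrow> exp (- clock g \<omega>)"
    using AE_good_path null_set_not_visited[OF a N]
  proof eventually_elim
    case (elim \<omega>)
    obtain c where c: "hitting_time_zero X_star \<omega> = ereal c" "\<And>t. 0 \<le> t \<Longrightarrow> t < c \<Longrightarrow> 0 < X_star t \<omega>"
      using good_path_clock[OF elim(1)] by blast
    have "AE t in lborel. 0 \<le> t \<and> ereal t < hitting_time_zero X_star \<omega> \<longrightarrow> (\<lambda>n. h n (X_star t \<omega>)) \<longlonglongrightarrow> g (X_star t \<omega>)"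
      using elim(2)
    proof eventually_elim
      case (elim t)
      then show ?case using c(1) c(2)[of t] by (auto intro!: hlim less_imp_le)
    qed
    then show ?case by (intro tendsto_intros clock_tendsto[OF elim(1) hm g(1) hC])
  qed
  have b1: "AE \<omega> in M. \<bar>exp (- clock (h n) \<omega>)\<bar> \<le> 1" for n
    using AE_good_path by eventually_elim (use clock_nonneg hC in auto)
  note L = completion_bounded_limit[OF prob_space_axioms E(1) b1 lim]
  show "(\<lambda>\<omega>. exp (- clock g \<omega>)) \<in> borel_measurable (completion M)" by (rule L(1))
  show "(\<integral>\<omega>. exp (- clock g \<omega>) \<partial>completion M) = riccati_potential u x"
    by (rule LIMSEQ_unique[OF L(2) l1])
qed

end

theorem theorem6:
  fixes M :: "'w measure"
    and B X S E Xstar :: "real \<Rightarrow> 'w \<Rightarrow> real"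
    and \<tau>star :: "'w \<Rightarrow> ereal"
    and \<phi> g :: "real \<Rightarrow> real"
    and x \<alpha> a :: real
  assumes "prob_space M"
    and "strictly_increasing_subordinator M S"
    and "laplace_exponent M S \<phi>"
    and "\<And>t \<omega>. E t \<omega> = inverse_process S t \<omega>"
    and "standard_brownian_motion M B"
    and "0 \<le> \<alpha>" and "0 \<le> x"
    and "\<And>t \<omega>. X t \<omega> = x + B t \<omega> - \<alpha> * t"
    and "independent_processes M X S"
    and "\<And>t \<omega>. Xstar t \<omega> = X (E t \<omega>) \<omega>"
    and "\<And>\<omega>. \<tau>star \<omega> = hitting_time_zero Xstar \<omega>"
    and "g \<in> borel_measurable (restrict_space borel {0..})"
    and "\<And>s. 0 \<le> s \<Longrightarrow> 0 \<le> g s"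
    and "bounded (g ` {0..})"
    and "0 \<le> a"
    and "compact (closure {s\<in>{0..}. g s \<noteq> 0})"
    and "closure {s\<in>{0..}. g s \<noteq> 0} \<subseteq> {0..a}"
  shows "\<exists>u. nonneg_riccati_solution \<alpha> a (\<lambda>s. \<phi> (g s)) u \<and>
             (\<forall>v. nonneg_riccati_solution \<alpha> a (\<lambda>s. \<phi> (g s)) v \<longrightarrow> (\<forall>r\<ge>0. v r = u r)) \<and>
             (\<integral>\<omega>. exp (- (LBINT t=0..\<tau>star \<omega>. g (Xstar t \<omega>))) \<partial>completion M)
               = exp (- 2 * (LBINT s=0..x. u s))"
proof -
  interpret prob_space M by fact
  have sub: "subordinator M S" using assms(2) by (simp add: strictly_increasing_subordinator_def)
  obtain C where C: "\<And>s. 0 \<le> s \<Longrightarrow> \<bar>g s\<bar> \<le> C" using assms(14) by (auto simp: bounded_iff)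
  have C0: "0 \<le> C" using C[of 0] by simp
  \<comment> \<open>g is measurable and controlled only on the half line. Extending it by 0 changes
    neither the equation nor, since X* is positive before \<tau>* on good paths, the clock.\<close>
  define g' where "g' y = (if 0 \<le> y then g y else 0)" for y
  have "(\<lambda>y. indicator {0..} y *\<^sub>R g y) \<in> borel_measurable borel"
    using assms(12) by (subst (asm) borel_measurable_restrict_space_iff) auto
  moreover have "g' = (\<lambda>y. indicator {0..} y *\<^sub>R g y)" by (auto simp: g'_def indicator_def)
  ultimately have g'm: "g' \<in> borel_measurable borel" by simp
  have g'C: "0 \<le> g' y \<and> g' y \<le> C" for y
    using assms(13)[of y] C[of y] C0 by (auto simp: g'_def)
  have g'a: "g' y = 0" if "a < y" for y
  proof (rule ccontr)
    assume "g' y \<noteq> 0"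
    then have "y \<in> {s \<in> {0..}. g s \<noteq> 0}" by (auto simp: g'_def split: if_splits)
    from subsetD[OF assms(17) subsetD[OF closure_subset this]] have "y \<in> {0..a}" .
    with that show False by simp
  qed
  note k = laplace_exponent_compose[OF sub assms(3) g'm g'C]
  have sol_iff: "nonneg_riccati_solution \<alpha> a (\<lambda>s. \<phi> (g s)) v \<longleftrightarrow> nonneg_riccati_solution \<alpha> a (\<lambda>s. \<phi> (g' s)) v" for v
    by (rule nonneg_riccati_solution_cong) (simp add: g'_def)
  obtain u where u: "nonneg_riccati_solution \<alpha> a (\<lambda>s. \<phi> (g' s)) u" "continuous_on {0..} u"
    using riccati_exists[OF assms(15,6) k] by blast
  have uniq: "v r = u r" if "nonneg_riccati_solution \<alpha> a (\<lambda>s. \<phi> (g s)) v" "0 \<le> r" for v r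
    by (rule riccati_unique[OF that(1)[unfolded sol_iff] u(1) assms(15,6) k that(2)])
  have rhs: "riccati_potential u x = exp (- 2 * (LBINT s=0..x. u s))"
  proof -
    have "set_integrable lborel {0..x} u"
      by (rule borel_integrable_atLeastAtMost'[OF continuous_on_subset[OF u(2)]]) auto
    from interval_integral_eq_integral[OF assms(7) this] show ?thesis
      by (simp add: riccati_potential_def zero_ereal_def)
  qed
  have "(\<integral>\<omega>. exp (- (LBINT t=0..\<tau>star \<omega>. g (Xstar t \<omega>))) \<partial>completion M) = riccati_potential u x"
  \<comment> \<open>For x = 0 the process starts at its target: almost surely E 0 = 0 by strict
    increase of S, so \<tau>* = 0 and both sides equal 1.\<close>
  proof (cases "x = 0")
    case True
    have "AE \<omega> in M. B 0 \<omega> = 0" using assms(5) by (simp add: standard_brownian_motion_def)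
    moreover have "AE \<omega> in M. S 0 \<omega> = 0" "AE \<omega> in M. strict_mono_on {0..} (\<lambda>t. S t \<omega>)"
      using assms(2) by (auto simp: strictly_increasing_subordinator_def subordinator_def levy_process_def)
    ultimately have one: "AE \<omega> in M. exp (- (LBINT t=0..\<tau>star \<omega>. g (Xstar t \<omega>))) = 1"
    proof eventually_elim
      case (elim \<omega>)
      have pos: "0 < S v \<omega>" if "0 < v" for v
        using strict_mono_onD[OF elim(3), of 0 v] that elim(2) by simp
      have "E 0 \<omega> = 0"
      proof (rule antisym)
        show "E 0 \<omega> \<le> 0"
        proof (rule dense_ge)
          fix v :: real assume "0 < v"
          then show "E 0 \<omega> \<le> v" unfolding assms(4) inverse_process_def
            using pos by (intro cInf_lower bdd_belowI[of _ 0]) auto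
        qed
        show "0 \<le> E 0 \<omega>" unfolding assms(4) inverse_process_def
          using pos[of 1] by (intro cInf_greatest) (auto intro!: exI[of _ 1])
      qed
      then have "Xstar 0 \<omega> = 0" using elim(1) True by (simp add: assms(8,10))
      then have "\<tau>star \<omega> \<le> ereal 0" unfolding assms(11) hitting_time_zero_def by (intro Inf_lower) auto
      moreover have "0 \<le> \<tau>star \<omega>" unfolding assms(11) hitting_time_zero_def by (intro Inf_greatest) auto
      ultimately have "\<tau>star \<omega> = 0" by (simp add: zero_ereal_def)
      then show ?case by simp
    qed
    \<comment> \<open>A constant sequence: the limit lemma also supplies measurability of the
      integrand on the right, which is known only to be 1 almost everywhere.\<close>
    have "(\<lambda>n::nat. \<integral>\<omega>. 1 \<partial>completion M) \<longlonglongrightarrow>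
        (\<integral>\<omega>. exp (- (LBINT t=0..\<tau>star \<omega>. g (Xstar t \<omega>))) \<partial>completion M)"
      by (rule completion_bounded_limit(2)[OF assms(1)]) (use one in \<open>auto simp: LIMSEQ_const_iff\<close>)
    then show ?thesis using True by (simp add: LIMSEQ_const_iff prob_space riccati_potential_def)
  next
    case False
    then have "0 < x" using assms(7) by simp
    interpret T: time_changed_Brownian_motion M B X S \<phi> x \<alpha>
      by unfold_locales fact+
    have Xs: "Xstar = T.X_star" by (intro ext) (simp add: assms(4,10) T.X_star_def)
    have cl: "(LBINT t=0..\<tau>star \<omega>. g (Xstar t \<omega>)) = T.clock g \<omega>" for \<omega>
      by (simp add: T.clock_def assms(11) Xs)
    note main = T.expectation_Borel[OF assms(15) g'm g'C g'a u]
    have "AE \<omega> in M. T.clock g' \<omega> = T.clock g \<omega>"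
      using T.AE_good_path
    proof eventually_elim
      case (elim \<omega>)
      obtain c where c: "\<And>g. T.clock g \<omega> = (\<integral>t. indicator {0..<c} t * g (T.X_star t \<omega>) \<partial>lborel)"
        "\<And>t. 0 \<le> t \<Longrightarrow> t < c \<Longrightarrow> 0 < T.X_star t \<omega>"
        using T.good_path_clock[OF elim] by blast
      show ?case unfolding c(1)
        by (rule Bochner_Integration.integral_cong) (use c(2) in \<open>auto simp: g'_def indicator_def less_imp_le\<close>)
    qed
    then have lim: "AE \<omega> in M. (\<lambda>n::nat. exp (- T.clock g' \<omega>)) \<longlonglongrightarrow> exp (- T.clock g \<omega>)"
      by eventually_elim simp
    have b: "AE \<omega> in M. \<bar>exp (- T.clock g' \<omega>)\<bar> \<le> 1"
      using T.AE_good_path by eventually_elim (use T.clock_nonneg g'C in auto)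
    have "(\<lambda>n::nat. \<integral>\<omega>. exp (- T.clock g' \<omega>) \<partial>completion M) \<longlonglongrightarrow> (\<integral>\<omega>. exp (- T.clock g \<omega>) \<partial>completion M)"
      by (rule completion_bounded_limit(2)[OF assms(1) _ b lim]) (rule main(1))
    then show ?thesis by (simp add: cl main(2) LIMSEQ_const_iff)
  qed
  then show ?thesis using u(1) uniq unfolding rhs sol_iff by blast
qed

end
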